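(* Let $f(t)=|t|^{\frac43}t$ (i.e. $f(t)=|t|^{q-2}t$ with $q=\frac{10}{3}$). Then there exists $a^*>0$ such that for every $a\in(0,a^*]$ the problem $$\Big(-u_{xx}+D_x^{-2}u_{yy}+\lambda u-f(u)\Big)_x=0 \text{ in } \mathbb{R}^2,\qquad \int_{\mathbb{R}^2}u^2\,dx\,dy=a^2,$$ has no nontrivial solution, i.e. there is no pair $(u,\lambda)\in S(a)\times\mathbb{R}$ which is a weak solution.
   Context: For $h:\mathbb{R}^2\to\mathbb{R}$ let $D_x^{-1}h(x,y)=\int_{-\infty}^x h(s,y)\,ds$. Let $Y=\{g_x: g\in C_0^\infty(\mathbb{R}^2)\}$ with inner product $\langle u,v\rangle_X=\int_{\mathbb{R}^2}(u_xv_x+D_x^{-1}u_y\,D_x^{-1}v_y+uv)\,dx\,dy$ and induced norm $\|\cdot\|$. The space $X$ consists of all $u:\mathbb{R}^2\to\mathbb{R}$ for which there is a sequence $(u_n)\subset Y$ with $u_n\to u$ a.e. and $\|u_j-u_k\|\to0$ as $j,k\to\infty$; it is a Hilbert space. Put $\langle u,v\rangle_0=\int_{\mathbb{R}^2}(u_xv_x+D_x^{-1}u_y\,D_x^{-1}v_y)\,dx\,dy$. For $a>0$, $S(a)=\{u\in X:\int_{\mathbb{R}^2}u^2=a^2\}$. A pair $(u,\lambda)\in S(a)\times\mathbb{R}$ is called a weak solution of the problem if $\langle u,\phi\rangle_0-\lambda\int_{\mathbb{R}^2}u\phi\,dx\,dy-\int_{\mathbb{R}^2}f(u)\phi\,dx\,dy=0$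 for all $\phi\in X$. *)

theory Defs
  imports "HOL-Analysis.Analysis"
begin

type_synonym fun2 = "real \<times> real \<Rightarrow> real"

definition px :: "fun2 \<Rightarrow> fun2" where
  "px g = (\<lambda>p. deriv (\<lambda>s. g (s, snd p)) (fst p))"

definition py :: "fun2 \<Rightarrow> fun2" where
  "py g = (\<lambda>p. deriv (\<lambda>t. g (fst p, t)) (snd p))"

coinductive smooth2 :: "fun2 \<Rightarrow> bool" where
  "(\<forall>p. g differentiable (at p)) \<Longrightarrow> smooth2 (px g) \<Longrightarrow> smooth2 (py g) \<Longrightarrow> smooth2 g"

definition C0inf :: "fun2 set" where
  "C0inf = {g. smooth2 g \<and> compact (closure {p. g p \<noteq> 0})}"

definition Dxinv :: "fun2 \<Rightarrow> fun2" where
  "Dxinv h = (\<lambda>(x, y). LINT s:{..x}|lebesgue. h (s, y))"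

definition Yspace :: "fun2 set" where
  "Yspace = {px g | g. g \<in> C0inf}"

definition innerX :: "fun2 \<Rightarrow> fun2 \<Rightarrow> real" where
  "innerX u v = (\<integral>p. px u p * px v p + Dxinv (py u) p * Dxinv (py v) p + u p * v p \<partial>lebesgue)"

definition normX :: "fun2 \<Rightarrow> real" where
  "normX u = sqrt (innerX u u)"

definition inner0Y :: "fun2 \<Rightarrow> fun2 \<Rightarrow> real" where
  "inner0Y u v = (\<integral>p. px u p * px v p + Dxinv (py u) p * Dxinv (py v) p \<partial>lebesgue)"

definition approx_seq :: "(nat \<Rightarrow> fun2) \<Rightarrow> fun2 \<Rightarrow> bool" where
  "approx_seq un u \<longleftrightarrow> (\<forall>n. un n \<in> Yspace) \<and>
     (AE p in lebesgue. (\<lambda>n. un n p) \<longlonglongrightarrow> u p) \<and>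
     (\<forall>e>0. \<exists>N. \<forall>j\<ge>N. \<forall>k\<ge>N. normX (\<lambda>p. un j p - un k p) < e)"

definition Xspace :: "fun2 set" where
  "Xspace = {u. \<exists>un. approx_seq un u}"

text \<open>The bilinear form <.,.>_0 on X, obtained by continuous extension from Y.\<close>
definition inner0 :: "fun2 \<Rightarrow> fun2 \<Rightarrow> real" where
  "inner0 u v = (THE L. \<forall>un vn. approx_seq un u \<longrightarrow> approx_seq vn v \<longrightarrow>
      (\<lambda>n. inner0Y (un n) (vn n)) \<longlonglongrightarrow> L)"

definition Sa :: "real \<Rightarrow> fun2 set" where
  "Sa a = {u \<in> Xspace. (\<integral>p. (u p)\<^sup>2 \<partial>lebesgue) = a\<^sup>2}"

definition weak_solution :: "(real \<Rightarrow> real) \<Rightarrow> real \<Rightarrow> fun2 \<Rightarrow> real \<Rightarrow> bool" where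
  "weak_solution f a u lam \<longleftrightarrow> u \<in> Sa a \<and>
     (\<forall>\<phi>\<in>Xspace. inner0 u \<phi> - lam * (\<integral>p. u p * \<phi> p \<partial>lebesgue)
                  - (\<integral>p. f (u p) * \<phi> p \<partial>lebesgue) = 0)"

end

theory Submission
  imports Defs
begin

text \<open>
  Write \<open>A\<close>, \<open>B\<close>, \<open>M\<close>, \<open>F\<close> for the integrals of \<open>u_x^2\<close>, \<open>w^2\<close> with \<open>w = D_x^(-1) u_y\<close>, \<open>u^2\<close> and
  \<open>|u|^(10/3)\<close>. The exponent \<open>10/3\<close> is mass critical: the dilation \<open>t^(3/2) u(t x, t^2 y)\<close> preserves \<open>M\<close>
  and multiplies \<open>A\<close>, \<open>B\<close>, \<open>F\<close> by \<open>t^2\<close>, so that a solution satisfies \<open>A + B = 3/5 F\<close>, without \<open>lambda\<close>.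
  The anisotropic Sobolev inequality bounds the integral of \<open>u^6\<close> by \<open>4 (A + B)^3\<close>; interpolating
  \<open>10/3\<close> between \<open>2\<close> and \<open>6\<close> turns this into \<open>F \<le> (A + B) (4/3 M + 1/3)\<close>, and hence \<open>M \<ge> 1\<close>.

  To justify the Pohozaev identities for weak solutions, first test with second \<open>x\<close>-differences of \<open>u\<close>:
  as \<open>u\<close> is in \<open>L^6\<close>, the nonlinearity is in \<open>L^2\<close>, so \<open>w_x = u_y\<close> is in \<open>L^2\<close> and \<open>u\<close> is \<open>L^2\<close>-Lipschitz
  under translations. Then test with \<open>(c q)_x\<close>, where \<open>q\<close> is a central difference quotient of the potential
  \<open>D_x^(-1) u\<close> in one coordinate direction and \<open>c\<close> is a truncation of that coordinate. The antisymmetry of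
  the central difference quotient replaces all second integrations by parts.
\<close>

text \<open>An element of \<open>Xspace\<close> is only an a.e. limit, and \<open>inner0\<close> is
  a definite description over all of its approximating sequences: nothing can be read off from it
  until the quadratic form is known to be closable. So a solution is replaced at once by Borel
  functions \<open>U\<close>, \<open>Ux\<close>, \<open>W\<close>, the limits of g_x, g_xx and g_y
  along a sequence of potentials g, and the equation is first extracted for test functions in Y
  only. The potentials themselves have no bound in square mean, only their derivatives do;
  closability in the component \<open>W\<close> has to work around this.

  Test functions must be x-derivatives, which dictates the multipliers. With c close to y and q
  close to w, the function (c q)_x stands for y u_y; with c close to x and q close to u, it stands
  for (x u)_x. Neither y u_y nor x u_x is known to be admissible: the weights are unbounded and the
  derivatives of u lie outside X. Truncations, and difference quotients of approximating potentials,
  make every test function smooth with compact support.\<close>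

declare split_paired_All [simp del] split_paired_Ex [simp del] split_paired_all [simp del]

section \<open>Square-integrable functions\<close>

definition L2 :: "('a::euclidean_space \<Rightarrow> real) \<Rightarrow> bool" where
  "L2 f \<longleftrightarrow> f \<in> borel_measurable lborel \<and> integrable lborel (\<lambda>p. (f p)\<^sup>2)"

definition ip :: "('a::euclidean_space \<Rightarrow> real) \<Rightarrow> ('a \<Rightarrow> real) \<Rightarrow> real" where
  "ip f g = (\<integral>p. f p * g p \<partial>lborel)"

definition nrm :: "('a::euclidean_space \<Rightarrow> real) \<Rightarrow> real" where
  "nrm f = sqrt (ip f f)"

lemma L2_measurable: "L2 f \<Longrightarrow> f \<in> borel_measurable lborel"
  by (simp add: L2_def)

lemma L2_borel_measurable: "L2 f \<Longrightarrow> f \<in> borel_measurable borel"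
  by (simp add: L2_def)

lemma L2_integrable_sq: "L2 f \<Longrightarrow> integrable lborel (\<lambda>p. (f p)\<^sup>2)"
  by (simp add: L2_def)

lemma L2_integrable_mult:
  assumes "L2 f" "L2 g" shows "integrable lborel (\<lambda>p. f p * g p)"
proof (rule Bochner_Integration.integrable_bound)
  show "integrable lborel (\<lambda>p. (f p)\<^sup>2 + (g p)\<^sup>2)"
    using assms by (auto simp: L2_def)
  show "(\<lambda>p. f p * g p) \<in> borel_measurable lborel"
    using assms by (auto simp: L2_def)
  have "\<bar>a * b\<bar> \<le> a\<^sup>2 + b\<^sup>2" for a b :: real
  proof -
    have "2 * (\<bar>a\<bar> * \<bar>b\<bar>) \<le> \<bar>a\<bar>\<^sup>2 + \<bar>b\<bar>\<^sup>2" using sum_squares_bound[of "\<bar>a\<bar>" "\<bar>b\<bar>"] by (simp add: mult.assoc)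
    moreover have "0 \<le> \<bar>a\<bar> * \<bar>b\<bar>" by simp
    ultimately have "\<bar>a\<bar> * \<bar>b\<bar> \<le> \<bar>a\<bar>\<^sup>2 + \<bar>b\<bar>\<^sup>2" by linarith
    then show ?thesis by (simp add: abs_mult)
  qed
  then show "AE p in lborel. norm (f p * g p) \<le> norm ((f p)\<^sup>2 + (g p)\<^sup>2)"
    by (simp add: abs_of_nonneg)
qed

lemma L2_bound:
  assumes "L2 f" "g \<in> borel_measurable lborel" "\<And>p. \<bar>g p\<bar> \<le> K * \<bar>f p\<bar>"
  shows "L2 g"
  unfolding L2_def
proof
  show "integrable lborel (\<lambda>p. (g p)\<^sup>2)"
  proof (rule Bochner_Integration.integrable_bound)
    show "integrable lborel (\<lambda>p. K\<^sup>2 * (f p)\<^sup>2)" using assms by (auto simp: L2_def)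
    show "(\<lambda>p. (g p)\<^sup>2) \<in> borel_measurable lborel" using assms(2) by measurable
    have "(g p)\<^sup>2 \<le> K\<^sup>2 * (f p)\<^sup>2" for p
      using power_mono[OF assms(3)[of p], of 2] by (simp add: power_mult_distrib)
    then show "AE p in lborel. norm ((g p)\<^sup>2) \<le> norm (K\<^sup>2 * (f p)\<^sup>2)" by simp
  qed
qed (fact assms(2))

lemma L2_cmult: "L2 f \<Longrightarrow> L2 (\<lambda>p. a * f p)"
  by (auto simp: L2_def power_mult_distrib)

lemma L2_divide: "L2 f \<Longrightarrow> L2 (\<lambda>p. f p / a)"
  by (auto simp: L2_def power_divide)

lemma L2_uminus: "L2 f \<Longrightarrow> L2 (\<lambda>p. - f p)"
  by (auto simp: L2_def)

lemma L2_add: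
  assumes "L2 f" "L2 g" shows "L2 (\<lambda>p. f p + g p)"
  using assms L2_integrable_mult[OF assms]
  by (auto simp: L2_def power2_sum mult.assoc)

lemma L2_diff: "L2 f \<Longrightarrow> L2 g \<Longrightarrow> L2 (\<lambda>p. f p - g p)"
  using L2_add[of f "\<lambda>p. - g p"] L2_uminus[of g] by simp

lemma L2_bmult:
  assumes "L2 f" "c \<in> borel_measurable lborel" "\<And>p. \<bar>c p\<bar> \<le> K"
  shows "L2 (\<lambda>p. c p * f p)"
proof (rule L2_bound[OF assms(1)])
  show "(\<lambda>p. c p * f p) \<in> borel_measurable lborel"
    using assms(1,2) by (auto simp: L2_def)
  show "\<And>p. \<bar>c p * f p\<bar> \<le> K * \<bar>f p\<bar>"
    by (simp add: abs_mult assms(3) mult_right_mono)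
qed

lemma ip_commute: "ip f g = ip g f"
  by (simp add: ip_def mult.commute)

lemma ip_self_nonneg [simp]: "0 \<le> ip f f"
  by (simp add: ip_def)

lemma nrm_nonneg [simp]: "0 \<le> nrm f"
  by (simp add: nrm_def)

lemma nrm_sq: "(nrm f)\<^sup>2 = ip f f"
  by (simp add: nrm_def)

lemma nrm_sq_integral: "(nrm f)\<^sup>2 = (\<integral>p. (f p)\<^sup>2 \<partial>lborel)"
  by (simp add: nrm_def ip_def power2_eq_square)

lemma nrm_zero [simp]: "nrm (\<lambda>p. 0) = 0"
  by (simp add: nrm_def ip_def)

lemma ip_add_left: "L2 f \<Longrightarrow> L2 g \<Longrightarrow> L2 h \<Longrightarrow> ip (\<lambda>p. f p + g p) h = ip f h + ip g h"
  unfolding ip_def using Bochner_Integration.integral_add[OF L2_integrable_mult[of f h] L2_integrable_mult[of g h]]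
  by (simp add: distrib_right)

lemma ip_diff_left: "L2 f \<Longrightarrow> L2 g \<Longrightarrow> L2 h \<Longrightarrow> ip (\<lambda>p. f p - g p) h = ip f h - ip g h"
  unfolding ip_def using Bochner_Integration.integral_diff[OF L2_integrable_mult[of f h] L2_integrable_mult[of g h]]
  by (simp add: left_diff_distrib)

lemma ip_add_right: "L2 f \<Longrightarrow> L2 g \<Longrightarrow> L2 h \<Longrightarrow> ip h (\<lambda>p. f p + g p) = ip h f + ip h g"
  using ip_add_left[of f g h] by (simp add: ip_commute)

lemma ip_diff_right: "L2 f \<Longrightarrow> L2 g \<Longrightarrow> L2 h \<Longrightarrow> ip h (\<lambda>p. f p - g p) = ip h f - ip h g"
  using ip_diff_left[of f g h] by (simp add: ip_commute)

lemma ip_cmult_left: "ip (\<lambda>p. a * f p) g = a * ip f g"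
  by (simp add: ip_def mult.assoc)

lemma ip_cmult_right: "ip f (\<lambda>p. a * g p) = a * ip f g"
  by (simp add: ip_def mult.left_commute)

lemma ip_divide_right: "ip f (\<lambda>p. g p / a) = ip f g / a"
  by (simp add: ip_def)

lemma nrm_cmult: "nrm (\<lambda>p. a * f p) = \<bar>a\<bar> * nrm f"
  by (simp add: nrm_def ip_cmult_left ip_cmult_right real_sqrt_mult flip: mult.assoc)

lemma nrm_divide: "nrm (\<lambda>p. f p / a) = nrm f / \<bar>a\<bar>"
  using nrm_cmult[of "inverse a" f] by (simp add: divide_inverse mult.commute)

lemma nrm_minus_commute: "nrm (\<lambda>p. f p - g p) = nrm (\<lambda>p. g p - f p)"
  by (simp add: nrm_def ip_def power2_commute flip: power2_eq_square)

text \<open>Cauchy-Schwarz from the sign of the quadratic polynomial t -> |t f + g|^2, minimised at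
  t = - ip f g / ip f f. If the leading coefficient vanishes, the affine function that is left can
  be nonnegative only with slope 0.\<close>

lemma ip_abs_le:
  assumes "L2 f" "L2 g" shows "\<bar>ip f g\<bar> \<le> nrm f * nrm g"
proof -
  have quad: "0 \<le> ip f f * t\<^sup>2 + 2 * ip f g * t + ip g g" for t
  proof -
    have "0 \<le> ip (\<lambda>p. t * f p + g p) (\<lambda>p. t * f p + g p)" by simp
    also have "\<dots> = ip f f * t\<^sup>2 + 2 * ip f g * t + ip g g"
      using assms
      by (simp add: ip_add_left ip_add_right L2_cmult L2_add ip_cmult_left ip_cmult_right
          ip_commute[of g f] power2_eq_square algebra_simps)
    finally show ?thesis .
  qed
  have "(ip f g)\<^sup>2 \<le> ip f f * ip g g"
  proof (cases "ip f f = 0")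
    case True
    then have "0 \<le> 2 * ip f g * t + ip g g" for t using quad[of t] by simp
    \<comment> \<open>For nonzero slope the affine function takes the value -1 at this
      point.\<close>
    from this[of "- (ip g g + 1) / (2 * ip f g)"] have "ip f g = 0"
      by (cases "ip f g = 0") simp_all
    then show ?thesis using True by simp
  next
    case False
    then have pos: "0 < ip f f" using ip_self_nonneg[of f] by linarith
    from quad[of "- ip f g / ip f f"] pos have "0 \<le> ip g g - (ip f g)\<^sup>2 / ip f f"
      by (simp add: power2_eq_square field_simps)
    then show ?thesis using pos by (simp add: field_simps)
  qed
  then have "sqrt ((ip f g)\<^sup>2) \<le> sqrt (ip f f * ip g g)" by (rule real_sqrt_le_mono)
  then show ?thesis by (simp add: nrm_def real_sqrt_mult)
qed

lemma nrm_triangle: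
  assumes "L2 f" "L2 g" shows "nrm (\<lambda>p. f p + g p) \<le> nrm f + nrm g"
proof (rule power2_le_imp_le)
  have "(nrm (\<lambda>p. f p + g p))\<^sup>2 = ip f f + 2 * ip f g + ip g g"
    using assms by (simp add: nrm_sq ip_add_left ip_add_right L2_add ip_commute[of g f])
  also have "\<dots> \<le> (nrm f)\<^sup>2 + 2 * (nrm f * nrm g) + (nrm g)\<^sup>2"
    using ip_abs_le[OF assms] by (simp add: nrm_sq)
  also have "\<dots> = (nrm f + nrm g)\<^sup>2" by (simp add: power2_sum)
  finally show "(nrm (\<lambda>p. f p + g p))\<^sup>2 \<le> (nrm f + nrm g)\<^sup>2" .
qed simp

lemma nrm_triangle_diff:
  assumes "L2 f" "L2 g" shows "nrm (\<lambda>p. f p - g p) \<le> nrm f + nrm g"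
  using nrm_triangle[OF assms(1) L2_cmult[OF assms(2), of "-1"]] nrm_cmult[of "-1" g]
  by simp

lemma nrm_triangle_trans:
  assumes "L2 f" "L2 g" "L2 h"
  shows "nrm (\<lambda>p. f p - h p) \<le> nrm (\<lambda>p. f p - g p) + nrm (\<lambda>p. g p - h p)"
  using nrm_triangle[OF L2_diff[OF assms(1,2)] L2_diff[OF assms(2,3)]] by simp

lemma nrm_le_add_diff:
  assumes "L2 f" "L2 g" shows "nrm f \<le> nrm g + nrm (\<lambda>p. f p - g p)"
  using nrm_triangle[OF assms(2) L2_diff[OF assms]] by simp

lemma nrm_bmult_le:
  assumes "L2 f" "c \<in> borel_measurable lborel" "\<And>p. \<bar>c p\<bar> \<le> K"
  shows "nrm (\<lambda>p. c p * f p) \<le> K * nrm f"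
proof -
  have K: "0 \<le> K" using order_trans[OF abs_ge_zero assms(3)] .
  show ?thesis
  proof (rule power2_le_imp_le)
    have "(nrm (\<lambda>p. c p * f p))\<^sup>2 \<le> (\<integral>p. K\<^sup>2 * (f p)\<^sup>2 \<partial>lborel)"
      unfolding nrm_sq_integral
    proof (rule integral_mono)
      show "integrable lborel (\<lambda>p. (c p * f p)\<^sup>2)" using L2_bmult[OF assms] by (rule L2_integrable_sq)
      show "integrable lborel (\<lambda>p. K\<^sup>2 * (f p)\<^sup>2)" using assms(1) by (simp add: L2_def)
      fix p
      have "(c p)\<^sup>2 \<le> K\<^sup>2" using assms(3)[of p] K by (simp add: abs_le_square_iff[symmetric])
      then show "(c p * f p)\<^sup>2 \<le> K\<^sup>2 * (f p)\<^sup>2" by (simp add: power_mult_distrib mult_right_mono)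
    qed
    then show "(nrm (\<lambda>p. c p * f p))\<^sup>2 \<le> (K * nrm f)\<^sup>2"
      by (simp add: power_mult_distrib nrm_sq_integral)
  qed (use K in simp)
qed

section \<open>Translations\<close>

lemma integral_shift:
  fixes f :: "'a::euclidean_space \<Rightarrow> real"
  assumes "f \<in> borel_measurable lborel"
  shows "(\<integral>p. f (p + a) \<partial>lborel) = (\<integral>p. f p \<partial>lborel)"
proof -
  have "(\<integral>p. f p \<partial>lborel) = (\<integral>p. f p \<partial>(distr lborel borel ((+) a)))"
    by (simp add: lborel_distr_plus)
  also have "\<dots> = (\<integral>p. f (a + p) \<partial>lborel)"
    using assms by (intro integral_distr) auto
  finally show ?thesis by (simp add: add.commute)
qed

lemma integrable_shift:
  fixes f :: "'a::euclidean_space \<Rightarrow> real"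
  assumes "integrable lborel f"
  shows "integrable lborel (\<lambda>p. f (p + a))"
proof -
  have "integrable (distr lborel borel ((+) a)) f" using assms by (simp add: lborel_distr_plus)
  then have "integrable lborel (\<lambda>p. f (a + p))"
    by (rule integrable_distr[rotated]) simp
  then show ?thesis by (simp add: add.commute)
qed

lemma L2_shift:
  assumes "L2 f" shows "L2 (\<lambda>p. f (p + a))"
  unfolding L2_def
proof
  show "(\<lambda>p. f (p + a)) \<in> borel_measurable lborel"
    using assms by (auto simp: L2_def)
  show "integrable lborel (\<lambda>p. (f (p + a))\<^sup>2)"
    using integrable_shift[OF L2_integrable_sq[OF assms]] by simp
qed

lemma ip_shift:
  assumes "L2 f" "L2 g" shows "ip (\<lambda>p. f (p + a)) (\<lambda>p. g (p + a)) = ip f g"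
  unfolding ip_def by (rule integral_shift) (use assms in \<open>auto simp: L2_def\<close>)

lemma ip_shift_move:
  assumes "L2 f" "L2 g" shows "ip (\<lambda>p. f (p + a)) g = ip f (\<lambda>p. g (p - a))"
  using ip_shift[OF assms(1) L2_shift[OF assms(2), of "-a"], of a] by simp

lemma nrm_shift: "L2 f \<Longrightarrow> nrm (\<lambda>p. f (p + a)) = nrm f"
  by (simp add: nrm_def ip_shift)

lemma nn_integral_sq: "L2 f \<Longrightarrow> (\<integral>\<^sup>+p. ennreal ((f p)\<^sup>2) \<partial>lborel) = ennreal ((nrm f)\<^sup>2)"
  unfolding nrm_sq_integral by (rule nn_integral_eq_integral) (auto simp: L2_def)

text \<open>Fatou and Tonelli deliver bounds on the extended integral; integrability is a
  consequence of such a bound, not something to be shown beforehand.\<close>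

lemma L2_nn_integralI:
  assumes "f \<in> borel_measurable lborel" "(\<integral>\<^sup>+p. ennreal ((f p)\<^sup>2) \<partial>lborel) \<le> ennreal (b\<^sup>2)" "0 \<le> b"
  shows "L2 f" "nrm f \<le> b"
proof -
  have "(\<integral>\<^sup>+p. ennreal ((f p)\<^sup>2) \<partial>lborel) < \<infinity>"
    using assms(2) by (rule le_less_trans) (simp add: ennreal_less_top)
  then show *: "L2 f"
    unfolding L2_def using assms(1) by (auto simp: integrable_iff_bounded)
  have "ennreal ((nrm f)\<^sup>2) \<le> ennreal (b\<^sup>2)"
    using assms(2) nn_integral_sq[OF *] by simp
  then have "(nrm f)\<^sup>2 \<le> b\<^sup>2" by (simp add: ennreal_le_iff)
  then show "nrm f \<le> b" using assms(3) by (rule power2_le_imp_le)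
qed

section \<open>Convergence and completeness in square mean\<close>

definition conv2 :: "(nat \<Rightarrow> 'a::euclidean_space \<Rightarrow> real) \<Rightarrow> ('a \<Rightarrow> real) \<Rightarrow> bool" where
  "conv2 f g \<longleftrightarrow> (\<forall>n. L2 (f n)) \<and> L2 g \<and> (\<lambda>n. nrm (\<lambda>p. f n p - g p)) \<longlonglongrightarrow> 0"

definition cauchy2 :: "(nat \<Rightarrow> 'a::euclidean_space \<Rightarrow> real) \<Rightarrow> bool" where
  "cauchy2 f \<longleftrightarrow> (\<forall>n. L2 (f n)) \<and>
     (\<forall>e>0. \<exists>N. \<forall>j\<ge>N. \<forall>k\<ge>N. nrm (\<lambda>p. f j p - f k p) < e)"

lemma cauchy2D: "cauchy2 f \<Longrightarrow> 0 < e \<Longrightarrow> \<exists>N. \<forall>j\<ge>N. \<forall>k\<ge>N. nrm (\<lambda>p. f j p - f k p) < e"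
  by (simp add: cauchy2_def)

lemma conv2D:
  assumes "conv2 f g" "0 < e" shows "\<exists>N. \<forall>n\<ge>N. nrm (\<lambda>p. f n p - g p) < e"
  using assms LIMSEQ_D[of "\<lambda>n. nrm (\<lambda>p. f n p - g p)" 0 e] by (simp add: conv2_def)

lemma conv2_L2: "conv2 f g \<Longrightarrow> L2 (f n)" "conv2 f g \<Longrightarrow> L2 g"
  by (auto simp: conv2_def)

lemma conv2_const: "L2 f \<Longrightarrow> conv2 (\<lambda>n. f) f"
  by (simp add: conv2_def)

lemma conv2I_le:
  assumes "\<And>n. L2 (f n)" "L2 g" "\<And>n. nrm (\<lambda>p. f n p - g p) \<le> b n" "b \<longlonglongrightarrow> 0"
  shows "conv2 f g"
  unfolding conv2_def using assms
  by (auto intro: tendsto_sandwich[of "\<lambda>n. 0" _ sequentially b])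

lemma conv2_subseq: "conv2 f g \<Longrightarrow> strict_mono r \<Longrightarrow> conv2 (\<lambda>n. f (r n)) g"
  unfolding conv2_def by (auto dest: LIMSEQ_subseq_LIMSEQ simp: o_def)

lemma conv2_add:
  assumes "conv2 f f'" "conv2 g g'"
  shows "conv2 (\<lambda>n p. f n p + g n p) (\<lambda>p. f' p + g' p)"
proof (rule conv2I_le)
  show "nrm (\<lambda>p. (f n p + g n p) - (f' p + g' p))
      \<le> nrm (\<lambda>p. f n p - f' p) + nrm (\<lambda>p. g n p - g' p)" for n
    using nrm_triangle[OF L2_diff[of "f n" f'] L2_diff[of "g n" g']] assms
    by (simp add: conv2_def algebra_simps)
  show "(\<lambda>n. nrm (\<lambda>p. f n p - f' p) + nrm (\<lambda>p. g n p - g' p)) \<longlonglongrightarrow> 0"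
    using assms by (auto simp: conv2_def intro: tendsto_add_zero)
qed (use assms in \<open>auto simp: conv2_def intro: L2_add\<close>)

lemma conv2_cmult:
  assumes "conv2 f f'" shows "conv2 (\<lambda>n p. a * f n p) (\<lambda>p. a * f' p)"
proof (rule conv2I_le)
  show "nrm (\<lambda>p. a * f n p - a * f' p) \<le> \<bar>a\<bar> * nrm (\<lambda>p. f n p - f' p)" for n
    using nrm_cmult[of a "\<lambda>p. f n p - f' p"] by (simp add: right_diff_distrib)
  show "(\<lambda>n. \<bar>a\<bar> * nrm (\<lambda>p. f n p - f' p)) \<longlonglongrightarrow> 0"
    using assms by (auto simp: conv2_def intro: tendsto_mult_right_zero)
qed (use assms in \<open>auto simp: conv2_def intro: L2_cmult\<close>)

lemma conv2_diff:
  assumes "conv2 f f'" "conv2 g g'"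
  shows "conv2 (\<lambda>n p. f n p - g n p) (\<lambda>p. f' p - g' p)"
  using conv2_add[OF assms(1) conv2_cmult[OF assms(2), of "-1"]] by simp

lemma conv2_shift:
  assumes "conv2 f f'" shows "conv2 (\<lambda>n p. f n (p + a)) (\<lambda>p. f' (p + a))"
  using assms nrm_shift[OF L2_diff[of "f n" f' for n], of _ a]
  by (auto simp: conv2_def L2_shift)

lemma conv2_bmult:
  assumes "conv2 f f'" "c \<in> borel_measurable lborel" "\<And>p. \<bar>c p\<bar> \<le> K"
  shows "conv2 (\<lambda>n p. c p * f n p) (\<lambda>p. c p * f' p)"
proof (rule conv2I_le)
  show "nrm (\<lambda>p. c p * f n p - c p * f' p) \<le> K * nrm (\<lambda>p. f n p - f' p)" for n
    using nrm_bmult_le[OF L2_diff[of "f n" f'] assms(2,3)] assms(1)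
    by (simp add: right_diff_distrib conv2_def)
  show "(\<lambda>n. K * nrm (\<lambda>p. f n p - f' p)) \<longlonglongrightarrow> 0"
    using assms by (auto simp: conv2_def intro: tendsto_mult_right_zero)
qed (use assms in \<open>auto simp: conv2_def intro!: L2_bmult[OF _ assms(2,3)]\<close>)

lemma conv2_nrm:
  assumes "conv2 f f'" shows "(\<lambda>n. nrm (f n)) \<longlonglongrightarrow> nrm f'"
proof (rule Lim_null[THEN iffD2], rule tendsto_rabs_zero_cancel, rule tendsto_sandwich[of "\<lambda>n. 0"])
  have "\<bar>nrm (f n) - nrm f'\<bar> \<le> nrm (\<lambda>p. f n p - f' p)" for n
    using nrm_le_add_diff[of "f n" f'] nrm_le_add_diff[of f' "f n"] assms
      nrm_minus_commute[of "f n" f'] by (simp add: conv2_def)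
  then show "\<forall>\<^sub>F n in sequentially. \<bar>nrm (f n) - nrm f'\<bar> \<le> nrm (\<lambda>p. f n p - f' p)" by simp
qed (use assms in \<open>auto simp: conv2_def\<close>)

lemma conv2_ip:
  assumes "conv2 f f'" "conv2 g g'" shows "(\<lambda>n. ip (f n) (g n)) \<longlonglongrightarrow> ip f' g'"
proof (rule Lim_null[THEN iffD2], rule tendsto_rabs_zero_cancel, rule tendsto_sandwich[of "\<lambda>n. 0"])
  let ?b = "\<lambda>n. nrm (\<lambda>p. f n p - f' p) * nrm (g n) + nrm f' * nrm (\<lambda>p. g n p - g' p)"
  have "\<bar>ip (f n) (g n) - ip f' g'\<bar> \<le> ?b n" for n
  proof -
    have L: "L2 (f n)" "L2 f'" "L2 (g n)" "L2 g'" using assms by (auto simp: conv2_def)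
    have "ip (f n) (g n) - ip f' g' = ip (\<lambda>p. f n p - f' p) (g n) + ip f' (\<lambda>p. g n p - g' p)"
      using L by (simp add: ip_diff_left ip_diff_right)
    then show ?thesis
      using ip_abs_le[OF L2_diff[OF L(1,2)] L(3)] ip_abs_le[OF L(2) L2_diff[OF L(3,4)]] by linarith
  qed
  then show "\<forall>\<^sub>F n in sequentially. \<bar>ip (f n) (g n) - ip f' g'\<bar> \<le> ?b n" by simp
  have "?b \<longlonglongrightarrow> 0 * nrm g' + nrm f' * 0"
    using assms conv2_nrm[OF assms(2)] unfolding conv2_def
    by (intro tendsto_intros) auto
  then show "?b \<longlonglongrightarrow> 0" by simp
qed auto

lemma conv2_ip_right: "conv2 g g' \<Longrightarrow> L2 f \<Longrightarrow> (\<lambda>n. ip f (g n)) \<longlonglongrightarrow> ip f g'"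
  by (rule conv2_ip[OF conv2_const])

lemma conv2_imp_cauchy2:
  assumes "conv2 f g" shows "cauchy2 f"
  unfolding cauchy2_def
proof (intro conjI allI impI)
  fix e :: real assume "0 < e"
  then obtain N where N: "\<And>n. n \<ge> N \<Longrightarrow> nrm (\<lambda>p. f n p - g p) < e / 2"
    using conv2D[OF assms, of "e / 2"] by auto
  show "\<exists>N. \<forall>j\<ge>N. \<forall>k\<ge>N. nrm (\<lambda>p. f j p - f k p) < e"
  proof (intro exI allI impI)
    fix j k assume "N \<le> j" "N \<le> k"
    then show "nrm (\<lambda>p. f j p - f k p) < e"
      using N[of j] N[of k] nrm_triangle_trans[of "f j" g "f k"] assms nrm_minus_commute[of g "f k"]
      by (simp add: conv2_def)
  qed
qed (use assms in \<open>auto simp: conv2_def\<close>)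

text \<open>Fatou's lemma in k with j fixed: the square of \<open>f j - g\<close> is the a.e. limit
  of the squares of \<open>f j - f k\<close>, so its integral stays within the Cauchy tolerance.
  Then \<open>g\<close> is in L2 because it differs from some \<open>f N\<close> by an L2
  function.\<close>

lemma cauchy2_AE_limit:
  assumes f: "cauchy2 f" and g: "g \<in> borel_measurable lborel"
    and ae: "AE p in lborel. (\<lambda>n. f n p) \<longlonglongrightarrow> g p"
  shows "conv2 f g"
proof -
  have L: "L2 (f n)" for n using f by (simp add: cauchy2_def)
  have meas[measurable]: "f n \<in> borel_measurable lborel" for n using L[of n] by (simp add: L2_def)
  note g[measurable]
  have *: "\<exists>N. \<forall>j\<ge>N. L2 (\<lambda>p. f j p - g p) \<and> nrm (\<lambda>p. f j p - g p) \<le> e" if "0 < e" for e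
  proof -
    obtain N where N: "\<And>j k. j \<ge> N \<Longrightarrow> k \<ge> N \<Longrightarrow> nrm (\<lambda>p. f j p - f k p) < e"
      using cauchy2D[OF f \<open>0 < e\<close>] by blast
    show ?thesis
    proof (intro exI allI impI)
      fix j assume j: "N \<le> j"
      have "(\<integral>\<^sup>+p. ennreal ((f j p - g p)\<^sup>2) \<partial>lborel)
          = (\<integral>\<^sup>+p. liminf (\<lambda>k. ennreal ((f j p - f k p)\<^sup>2)) \<partial>lborel)"
      proof (rule nn_integral_cong_AE, use ae in eventually_elim)
        fix p assume "(\<lambda>n. f n p) \<longlonglongrightarrow> g p"
        then have "(\<lambda>k. ennreal ((f j p - f k p)\<^sup>2)) \<longlonglongrightarrow> ennreal ((f j p - g p)\<^sup>2)"
          by (intro tendsto_intros)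
        then show "ennreal ((f j p - g p)\<^sup>2) = liminf (\<lambda>k. ennreal ((f j p - f k p)\<^sup>2))"
          by (rule lim_imp_Liminf[OF sequentially_bot, symmetric])
      qed
      also have "\<dots> \<le> liminf (\<lambda>k. \<integral>\<^sup>+p. ennreal ((f j p - f k p)\<^sup>2) \<partial>lborel)"
        by (rule nn_integral_liminf) measurable
      also have "\<dots> \<le> ennreal (e\<^sup>2)"
      proof (rule Liminf_le)
        have "(\<integral>\<^sup>+p. ennreal ((f j p - f k p)\<^sup>2) \<partial>lborel) \<le> ennreal (e\<^sup>2)" if "k \<ge> N" for k
          using N[OF j that] that by (subst nn_integral_sq) (auto intro!: L2_diff L ennreal_leI power_mono)
        then show "\<forall>\<^sub>F k in sequentially. (\<integral>\<^sup>+p. ennreal ((f j p - f k p)\<^sup>2) \<partial>lborel) \<le> ennreal (e\<^sup>2)"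
          by (auto simp: eventually_sequentially)
      qed simp
      finally show "L2 (\<lambda>p. f j p - g p) \<and> nrm (\<lambda>p. f j p - g p) \<le> e"
        using L2_nn_integralI[of "\<lambda>p. f j p - g p" e] that by auto
    qed
  qed
  have Lg: "L2 g"
  proof -
    obtain N where "L2 (\<lambda>p. f N p - g p)" using *[of 1] by auto
    from L2_diff[OF L[of N] this] show ?thesis by simp
  qed
  show ?thesis
    unfolding conv2_def LIMSEQ_iff
  proof (intro conjI allI impI L Lg)
    fix e :: real assume "0 < e"
    then obtain N where "\<forall>j\<ge>N. nrm (\<lambda>p. f j p - g p) \<le> e / 2" using *[of "e / 2"] by auto
    then show "\<exists>N. \<forall>j\<ge>N. norm (nrm (\<lambda>p. f j p - g p) - 0) < e"
      using \<open>0 < e\<close> by (intro exI[of _ N]) force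
  qed
qed

text \<open>The pointwise half of the Riesz-Fischer theorem: along a subsequence with geometrically
  small increments in norm, the increments are absolutely summable at almost every point.\<close>

lemma cauchy2_subseq_AE:
  assumes f: "cauchy2 f"
  obtains r g where "strict_mono r" "g \<in> borel_measurable lborel"
    "AE p in lborel. (\<lambda>n. f (r n) p) \<longlonglongrightarrow> g p"
proof -
  have L: "L2 (f n)" for n using f by (simp add: cauchy2_def)
  have meas[measurable]: "f n \<in> borel_measurable lborel" for n using L[of n] by (simp add: L2_def)
  have "\<exists>N. \<forall>j\<ge>N. \<forall>k\<ge>N. nrm (\<lambda>p. f j p - f k p) < (1/4)^i" for i
    using f unfolding cauchy2_def by simp
  then obtain M where M: "\<And>i j k. j \<ge> M i \<Longrightarrow> k \<ge> M i \<Longrightarrow> nrm (\<lambda>p. f j p - f k p) < (1/4)^i"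
    by metis
  \<comment> \<open>Taking the maximum with \<open>Suc v\<close> makes the indices strictly
    increasing while keeping \<open>M i \<le> r i\<close>.\<close>
  define r where "r = rec_nat (M 0) (\<lambda>i v. max (Suc v) (M (Suc i)))"
  have rS: "r (Suc i) = max (Suc (r i)) (M (Suc i))" for i by (simp add: r_def)
  have sm: "strict_mono r" by (rule strict_mono_Suc_iff[THEN iffD2]) (simp add: rS less_max_iff_disj)
  have rM: "r i \<ge> M i" for i by (cases i) (simp_all add: r_def)
  define d where "d i p = f (r (Suc i)) p - f (r i) p" for i p
  have Ld: "L2 (d i)" for i unfolding d_def by (intro L2_diff L)
  have dmeas[measurable]: "d i \<in> borel_measurable lborel" for i using Ld[of i] by (simp add: L2_def)
  have nd: "nrm (d i) \<le> (1/4)^i" for i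
    unfolding d_def
  proof (rule less_imp_le, rule M)
    show "M i \<le> r (Suc i)" "M i \<le> r i" using rM[of i] by (simp_all add: rS)
  qed
  \<comment> \<open>The weight 4^i is small enough for summability, since 4^i times the square of
    (1/4)^i is (1/4)^i, and large enough to give the pointwise decay (1/2)^i of \<open>d i p\<close>
    wherever the sum is finite.\<close>
  have "(\<integral>\<^sup>+p. (\<Sum>i. ennreal (4^i * (d i p)\<^sup>2)) \<partial>lborel) = (\<Sum>i. \<integral>\<^sup>+p. ennreal (4^i * (d i p)\<^sup>2) \<partial>lborel)"
    by (rule nn_integral_suminf) measurable
  also have "\<dots> \<le> (\<Sum>i. ennreal ((1/4)^i))"
  proof (rule suminf_le)
    fix i
    have "(\<integral>\<^sup>+p. ennreal (4^i * (d i p)\<^sup>2) \<partial>lborel) = ennreal (4^i) * (\<integral>\<^sup>+p. ennreal ((d i p)\<^sup>2) \<partial>lborel)"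
      by (subst nn_integral_cmult[symmetric]) (auto simp: ennreal_mult)
    also have "\<dots> = ennreal (4^i * (nrm (d i))\<^sup>2)"
      by (simp add: nn_integral_sq[OF Ld] ennreal_mult)
    also have "\<dots> \<le> ennreal (4^i * ((1/4)^i)\<^sup>2)"
      by (intro ennreal_leI mult_left_mono power_mono nd) auto
    also have "4^i * ((1/4)^i)\<^sup>2 = (1/4::real)^i"
      by (simp add: power2_eq_square power_divide field_simps)
    finally show "(\<integral>\<^sup>+p. ennreal (4^i * (d i p)\<^sup>2) \<partial>lborel) \<le> ennreal ((1/4)^i)" .
  qed auto
  also have "\<dots> = ennreal (\<Sum>i. (1/4)^i)"
    by (rule suminf_ennreal2) (auto intro: summable_geometric)
  finally have fin: "(\<integral>\<^sup>+p. (\<Sum>i. ennreal (4^i * (d i p)\<^sup>2)) \<partial>lborel) < \<infinity>"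
    by (rule le_less_trans) (simp add: ennreal_less_top)
  have "AE p in lborel. (\<Sum>i. ennreal (4^i * (d i p)\<^sup>2)) \<noteq> \<infinity>"
    by (rule nn_integral_noteq_infinite) (use fin in auto)
  then have conv: "AE p in lborel. convergent (\<lambda>n. f (r n) p)"
  proof eventually_elim
    case (elim p)
    then obtain C where C: "(\<Sum>i. ennreal (4^i * (d i p)\<^sup>2)) = ennreal C" "0 \<le> C"
      by (cases "\<Sum>i. ennreal (4^i * (d i p)\<^sup>2)") (auto simp: top_ennreal_def)
    have b: "\<bar>d i p\<bar> \<le> sqrt C * (1/2)^i" for i
    proof (rule power2_le_imp_le)
      have "ennreal (4^i * (d i p)\<^sup>2) \<le> ennreal C"
        using sum_le_suminf[of "\<lambda>i. ennreal (4^i * (d i p)\<^sup>2)" "{i}"] by (simp add: C)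
      then have "4^i * (d i p)\<^sup>2 \<le> C" using C(2) by (simp add: ennreal_le_iff)
      then show "\<bar>d i p\<bar>\<^sup>2 \<le> (sqrt C * (1/2)^i)\<^sup>2"
        using C(2) power_mult_distrib[of "2::real" 2 i]
        by (simp add: power_mult_distrib power_divide field_simps power2_eq_square flip: power_mult_distrib)
    qed (use C in simp)
    have "summable (\<lambda>i. d i p)"
      by (rule summable_comparison_test[of _ "\<lambda>i. sqrt C * (1/2)^i"])
        (use b in \<open>auto intro!: summable_mult summable_geometric\<close>)
    then have "convergent (\<lambda>n. (\<Sum>i<n. d i p) + f (r 0) p)"
      by (intro convergent_add convergent_const) (simp add: summable_iff_convergent)
    moreover have "(\<Sum>i<n. d i p) + f (r 0) p = f (r n) p" for n
      by (induction n) (simp_all add: d_def)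
    ultimately show ?case by simp
  qed
  show ?thesis
  proof (rule that[OF sm])
    show "(\<lambda>p. lim (\<lambda>n. f (r n) p)) \<in> borel_measurable lborel" by measurable
    show "AE p in lborel. (\<lambda>n. f (r n) p) \<longlonglongrightarrow> lim (\<lambda>n. f (r n) p)"
      using conv by eventually_elim (simp add: convergent_LIMSEQ_iff)
  qed
qed

lemma L2_complete:
  assumes f: "cauchy2 f" obtains g where "conv2 f g"
proof -
  obtain r g where r: "strict_mono r" and g: "g \<in> borel_measurable lborel"
    and ae: "AE p in lborel. (\<lambda>n. f (r n) p) \<longlonglongrightarrow> g p"
    using cauchy2_subseq_AE[OF f] .
  have L: "L2 (f n)" for n using f by (simp add: cauchy2_def)
  have "cauchy2 (\<lambda>n. f (r n))"
    unfolding cauchy2_def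
  proof (intro conjI allI impI L)
    fix e :: real assume "0 < e"
    then obtain N where "\<And>j k. j \<ge> N \<Longrightarrow> k \<ge> N \<Longrightarrow> nrm (\<lambda>p. f j p - f k p) < e"
      using cauchy2D[OF f \<open>0 < e\<close>] by blast
    then show "\<exists>N. \<forall>j\<ge>N. \<forall>k\<ge>N. nrm (\<lambda>p. f (r j) p - f (r k) p) < e"
      using seq_suble[OF r] by (meson order_trans)
  qed
  from cauchy2_AE_limit[OF this g ae] have c: "conv2 (\<lambda>n. f (r n)) g" .
  have Lg: "L2 g" using c by (simp add: conv2_def)
  have "conv2 f g"
    unfolding conv2_def LIMSEQ_iff
  proof (intro conjI allI impI L Lg)
    fix e :: real assume "0 < e"
    then obtain N where N: "\<And>j k. j \<ge> N \<Longrightarrow> k \<ge> N \<Longrightarrow> nrm (\<lambda>p. f j p - f k p) < e / 2"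
      using cauchy2D[OF f half_gt_zero[OF \<open>0 < e\<close>]] by blast
    obtain N' where N': "\<And>n. n \<ge> N' \<Longrightarrow> nrm (\<lambda>p. f (r n) p - g p) < e / 2"
      using conv2D[OF c half_gt_zero[OF \<open>0 < e\<close>]] by blast
    show "\<exists>N. \<forall>j\<ge>N. norm (nrm (\<lambda>p. f j p - g p) - 0) < e"
    proof (intro exI allI impI)
      fix j assume j: "N \<le> j"
      let ?m = "max N N'"
      have "nrm (\<lambda>p. f j p - f (r ?m) p) < e / 2"
        using N[OF j, of "r ?m"] seq_suble[OF r, of ?m] by simp
      moreover have "nrm (\<lambda>p. f (r ?m) p - g p) < e / 2" by (rule N') simp
      ultimately show "norm (nrm (\<lambda>p. f j p - g p) - 0) < e"
        using nrm_triangle_trans[OF L[of j] L[of "r ?m"] Lg] by simp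
    qed
  qed
  then show ?thesis by (rule that)
qed

lemma nrm_zero_AE:
  assumes "L2 f" "nrm f = 0" shows "AE p in lborel. f p = 0"
proof -
  have "(\<integral>p. (f p)\<^sup>2 \<partial>lborel) = 0" using assms(2) by (simp flip: nrm_sq_integral)
  then show ?thesis using integral_nonneg_eq_0_iff_AE[OF L2_integrable_sq[OF assms(1)]] by simp
qed

section \<open>Smooth functions in the plane\<close>

lemma smooth2_differentiable: "smooth2 g \<Longrightarrow> g differentiable (at p)"
  by (erule smooth2.cases) blast

lemma smooth2_px: "smooth2 g \<Longrightarrow> smooth2 (px g)"
  by (erule smooth2.cases) blast

lemma smooth2_py: "smooth2 g \<Longrightarrow> smooth2 (py g)"
  by (erule smooth2.cases) blast

lemma smooth2_continuous: "smooth2 g \<Longrightarrow> continuous_on S g"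
  by (intro continuous_at_imp_continuous_on ballI differentiable_imp_continuous_within smooth2_differentiable)

text \<open>Directional derivative: increments and difference quotients are estimated once for all
  directions \<open>d\<close>, and the Pohozaev argument then takes the two coordinate
  directions.\<close>

definition dd :: "real \<times> real \<Rightarrow> fun2 \<Rightarrow> fun2" where
  "dd d g = (\<lambda>p. fst d * px g p + snd d * py g p)"

lemma dd_coordinate: "dd (1, 0) g = px g" "dd (0, 1) g = py g"
  by (simp_all add: dd_def)

lemma has_derivative_dd:
  assumes "g differentiable (at p)" shows "(g has_derivative (\<lambda>d. dd d g p)) (at p)"
proof -
  obtain L where L: "(g has_derivative L) (at p)" using assms by (auto simp: differentiable_def)
  then have lin: "linear L" by (simp add: has_derivative_linear)
  have "((\<lambda>s. (s, snd p)) has_derivative (\<lambda>s. (s, 0))) (at (fst p))"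
    by (intro has_derivative_Pair has_derivative_ident has_derivative_const)
  then have "((\<lambda>s. g (s, snd p)) has_derivative (\<lambda>s. L (s, 0))) (at (fst p))"
    by (rule has_derivative_compose) (simp only: prod.collapse L)
  moreover have "(\<lambda>s. L (s, 0)) = (*) (L (1, 0))"
  proof
    show "L (s, 0) = L (1, 0) * s" for s
      using linear_scale[OF lin, of s "(1, 0)"] by (simp add: mult.commute)
  qed
  ultimately have "((\<lambda>s. g (s, snd p)) has_real_derivative L (1, 0)) (at (fst p))"
    by (simp only: has_field_derivative_def)
  then have x: "px g p = L (1, 0)" unfolding px_def by (rule DERIV_imp_deriv)
  have "((\<lambda>s. (fst p, s)) has_derivative (\<lambda>s. (0, s))) (at (snd p))"
    by (intro has_derivative_Pair has_derivative_ident has_derivative_const)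
  then have "((\<lambda>s. g (fst p, s)) has_derivative (\<lambda>s. L (0, s))) (at (snd p))"
    by (rule has_derivative_compose) (simp only: prod.collapse L)
  moreover have "(\<lambda>s. L (0, s)) = (*) (L (0, 1))"
  proof
    show "L (0, s) = L (0, 1) * s" for s
      using linear_scale[OF lin, of s "(0, 1)"] by (simp add: mult.commute)
  qed
  ultimately have "((\<lambda>s. g (fst p, s)) has_real_derivative L (0, 1)) (at (snd p))"
    by (simp only: has_field_derivative_def)
  then have y: "py g p = L (0, 1)" unfolding py_def by (rule DERIV_imp_deriv)
  have "L d = dd d g p" for d
    using linear_add[OF lin, of "(fst d, 0)" "(0, snd d)"]
      linear_scale[OF lin, of "fst d" "(1, 0)"] linear_scale[OF lin, of "snd d" "(0, 1)"]
    by (simp add: dd_def x y)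
  then have "L = (\<lambda>d. dd d g p)" by (rule ext)
  with L show ?thesis by simp
qed

lemma dd_eqI:
  assumes "(g has_derivative L) (at p)" shows "dd d g p = L d"
  using has_derivative_unique[OF has_derivative_dd[OF differentiableI[OF assms]] assms]
  by (rule fun_cong)

lemma px_eqI: "(g has_derivative L) (at p) \<Longrightarrow> px g p = L (1, 0)"
  using dd_eqI[of g L p "(1, 0)"] by (simp add: dd_def)

lemma py_eqI: "(g has_derivative L) (at p) \<Longrightarrow> py g p = L (0, 1)"
  using dd_eqI[of g L p "(0, 1)"] by (simp add: dd_def)

lemma smooth2_line_deriv:
  assumes "smooth2 g"
  shows "((\<lambda>s. g (p + s *\<^sub>R d)) has_real_derivative dd d g (p + s *\<^sub>R d)) (at s)"
proof -
  have "((\<lambda>s. g (p + s *\<^sub>R d)) has_derivative (\<lambda>s'. dd (s' *\<^sub>R d) g (p + s *\<^sub>R d))) (at s)"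
  proof (rule has_derivative_compose[of "\<lambda>s. p + s *\<^sub>R d" "\<lambda>s'. s' *\<^sub>R d"])
    show "((\<lambda>s. p + s *\<^sub>R d) has_derivative (\<lambda>s'. s' *\<^sub>R d)) (at s)"
      by (auto intro!: derivative_eq_intros)
  qed (intro has_derivative_dd smooth2_differentiable assms)
  moreover have "dd (s' *\<^sub>R d) g q = dd d g q * s'" for s' q by (simp add: dd_def algebra_simps)
  ultimately show ?thesis by (simp add: has_field_derivative_def)
qed

lemma smooth2_deriv_x: "smooth2 g \<Longrightarrow> ((\<lambda>s. g (s, y)) has_real_derivative px g (x, y)) (at x)"
  using smooth2_line_deriv[of g "(0, y)" "(1, 0)" x] by (simp add: dd_def)

lemma smooth2_deriv_y: "smooth2 g \<Longrightarrow> ((\<lambda>t. g (x, t)) has_real_derivative py g (x, y)) (at y)"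
  using smooth2_line_deriv[of g "(x, 0)" "(0, 1)" y] by (simp add: dd_def)

text \<open>Finite order of smoothness makes closure under products provable by induction, which the
  coinductive definition does not allow directly: a product is not differentiated into a product.\<close>

primrec smoothn :: "nat \<Rightarrow> fun2 \<Rightarrow> bool" where
  "smoothn 0 g \<longleftrightarrow> (\<forall>p. g differentiable (at p))"
| "smoothn (Suc n) g \<longleftrightarrow> (\<forall>p. g differentiable (at p)) \<and> smoothn n (px g) \<and> smoothn n (py g)"

lemma smoothn_differentiable: "smoothn n g \<Longrightarrow> g differentiable (at p)"
  by (cases n) (auto simp del: split_paired_All)

lemma smoothn_SucD: "smoothn (Suc n) g \<Longrightarrow> smoothn n g"
proof (induction n arbitrary: g)
  case (Suc n)
  have d: "\<forall>p. g differentiable (at p)" and "smoothn (Suc n) (px g)" "smoothn (Suc n) (py g)"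
    using Suc.prems unfolding smoothn.simps(2)[of "Suc n"] by blast+
  then have "smoothn n (px g)" "smoothn n (py g)" by (blast intro: Suc.IH)+
  with d show ?case by simp
qed simp

lemma smooth2_iff_smoothn: "smooth2 g \<longleftrightarrow> (\<forall>n. smoothn n g)"
proof
  assume "smooth2 g"
  have "smoothn n g" if "smooth2 g" for n g
    using that by (induction n arbitrary: g) (auto intro: smooth2_differentiable smooth2_px smooth2_py)
  then show "\<forall>n. smoothn n g" using \<open>smooth2 g\<close> by blast
next
  assume "\<forall>n. smoothn n g"
  then show "smooth2 g"
  proof (coinduction arbitrary: g)
    case smooth2
    then have "smoothn (Suc n) g" for n by blast
    then have "\<forall>n. smoothn n (px g)" "\<forall>n. smoothn n (py g)" by simp_all
    moreover have "\<forall>p. g differentiable (at p)" using smooth2 smoothn_differentiable by blast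
    ultimately show ?case by (intro exI[of _ g]) simp
  qed
qed

lemma px_add:
  assumes "f differentiable (at p)" "g differentiable (at p)"
  shows "px (\<lambda>p. f p + g p) p = px f p + px g p"
  using px_eqI[OF has_derivative_add[OF has_derivative_dd[OF assms(1)] has_derivative_dd[OF assms(2)]]]
  by (simp add: dd_def)

lemma py_add:
  assumes "f differentiable (at p)" "g differentiable (at p)"
  shows "py (\<lambda>p. f p + g p) p = py f p + py g p"
  using py_eqI[OF has_derivative_add[OF has_derivative_dd[OF assms(1)] has_derivative_dd[OF assms(2)]]]
  by (simp add: dd_def)

lemma px_mult:
  assumes "f differentiable (at p)" "g differentiable (at p)"
  shows "px (\<lambda>p. f p * g p) p = f p * px g p + px f p * g p"
  using px_eqI[OF has_derivative_mult[OF has_derivative_dd[OF assms(1)] has_derivative_dd[OF assms(2)]]]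
  by (simp add: dd_def)

lemma py_mult:
  assumes "f differentiable (at p)" "g differentiable (at p)"
  shows "py (\<lambda>p. f p * g p) p = f p * py g p + py f p * g p"
  using py_eqI[OF has_derivative_mult[OF has_derivative_dd[OF assms(1)] has_derivative_dd[OF assms(2)]]]
  by (simp add: dd_def)

lemma px_const [simp]: "px (\<lambda>p. c) = (\<lambda>p. 0)" by (simp add: px_def)
lemma py_const [simp]: "py (\<lambda>p. c) = (\<lambda>p. 0)" by (simp add: py_def)
lemma px_fst [simp]: "px fst = (\<lambda>p. 1)" by (simp add: px_def)
lemma py_fst [simp]: "py fst = (\<lambda>p. 0)" by (simp add: py_def)
lemma px_snd [simp]: "px snd = (\<lambda>p. 0)" by (simp add: px_def)
lemma py_snd [simp]: "py snd = (\<lambda>p. 1)" by (simp add: py_def)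

lemma smoothn_const: "smoothn n (\<lambda>p. c)"
  by (induction n arbitrary: c) auto

lemma smoothn_add: "smoothn n f \<Longrightarrow> smoothn n g \<Longrightarrow> smoothn n (\<lambda>p. f p + g p)"
proof (induction n arbitrary: f g)
  case (Suc n)
  have d: "f differentiable (at p)" "g differentiable (at p)" for p
    using Suc.prems smoothn_differentiable by blast+
  have "px (\<lambda>p. f p + g p) = (\<lambda>p. px f p + px g p)" "py (\<lambda>p. f p + g p) = (\<lambda>p. py f p + py g p)"
    by (simp_all add: fun_eq_iff px_add py_add d)
  then show ?case using Suc by (auto simp: d)
qed auto

lemma smoothn_mult: "smoothn n f \<Longrightarrow> smoothn n g \<Longrightarrow> smoothn n (\<lambda>p. f p * g p)"
proof (induction n arbitrary: f g)
  case (Suc n)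
  have d: "f differentiable (at p)" "g differentiable (at p)" for p
    using Suc.prems smoothn_differentiable by blast+
  have "px (\<lambda>p. f p * g p) = (\<lambda>p. f p * px g p + px f p * g p)"
       "py (\<lambda>p. f p * g p) = (\<lambda>p. f p * py g p + py f p * g p)"
    by (simp_all add: fun_eq_iff px_mult py_mult d)
  moreover have "smoothn n f" "smoothn n g" using Suc.prems by (blast intro: smoothn_SucD)+
  ultimately show ?case using Suc by (auto simp: d intro!: smoothn_add)
qed auto

text \<open>The coefficients may vanish, so this covers restriction to a coordinate axis.\<close>

definition diag_affine :: "real \<Rightarrow> real \<Rightarrow> real \<times> real \<Rightarrow> real \<times> real \<Rightarrow> real \<times> real" where
  "diag_affine a b q p = (a * fst p + fst q, b * snd p + snd q)"

lemma diag_affine_has_derivative: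
  assumes "g differentiable (at (diag_affine a b q p))"
  shows "((\<lambda>p. g (diag_affine a b q p)) has_derivative
     (\<lambda>d. dd (a * fst d, b * snd d) g (diag_affine a b q p))) (at p)"
proof (rule has_derivative_compose[of "diag_affine a b q" "\<lambda>d. (a * fst d, b * snd d)"])
  show "(diag_affine a b q has_derivative (\<lambda>d. (a * fst d, b * snd d))) (at p)"
    unfolding diag_affine_def[abs_def] by (auto intro!: derivative_eq_intros)
qed (rule has_derivative_dd[OF assms])

lemma px_diag_affine:
  assumes "g differentiable (at (diag_affine a b q p))"
  shows "px (\<lambda>p. g (diag_affine a b q p)) p = a * px g (diag_affine a b q p)"
  using px_eqI[OF diag_affine_has_derivative[OF assms]] by (simp add: dd_def)

lemma py_diag_affine:
  assumes "g differentiable (at (diag_affine a b q p))"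
  shows "py (\<lambda>p. g (diag_affine a b q p)) p = b * py g (diag_affine a b q p)"
  using py_eqI[OF diag_affine_has_derivative[OF assms]] by (simp add: dd_def)

lemma smoothn_diag_affine: "smoothn n g \<Longrightarrow> smoothn n (\<lambda>p. g (diag_affine a b q p))"
proof (induction n arbitrary: g)
  case 0
  then show ?case by (simp add: differentiableI[OF diag_affine_has_derivative])
next
  case (Suc n)
  have d: "g differentiable (at p)" for p using Suc.prems smoothn_differentiable by blast
  have "px (\<lambda>p. g (diag_affine a b q p)) = (\<lambda>p. a * px g (diag_affine a b q p))"
       "py (\<lambda>p. g (diag_affine a b q p)) = (\<lambda>p. b * py g (diag_affine a b q p))"
    by (simp_all add: fun_eq_iff px_diag_affine py_diag_affine d)
  then show ?case using Suc
    by (simp add: smoothn_mult smoothn_const differentiableI[OF diag_affine_has_derivative[OF d]])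
qed

lemma smooth2_const: "smooth2 (\<lambda>p. c)"
  by (simp add: smooth2_iff_smoothn smoothn_const)

lemma smooth2_fst: "smooth2 fst"
proof -
  have "smoothn n fst" for n by (cases n) (auto simp: smoothn_const intro: bounded_linear_imp_differentiable bounded_linear_fst)
  then show ?thesis by (simp add: smooth2_iff_smoothn)
qed

lemma smooth2_snd: "smooth2 snd"
proof -
  have "smoothn n snd" for n by (cases n) (auto simp: smoothn_const intro: bounded_linear_imp_differentiable bounded_linear_snd)
  then show ?thesis by (simp add: smooth2_iff_smoothn)
qed

lemma smooth2_add: "smooth2 f \<Longrightarrow> smooth2 g \<Longrightarrow> smooth2 (\<lambda>p. f p + g p)"
  by (simp add: smooth2_iff_smoothn smoothn_add)

lemma smooth2_mult: "smooth2 f \<Longrightarrow> smooth2 g \<Longrightarrow> smooth2 (\<lambda>p. f p * g p)"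
  by (simp add: smooth2_iff_smoothn smoothn_mult)

lemma smooth2_diff: "smooth2 f \<Longrightarrow> smooth2 g \<Longrightarrow> smooth2 (\<lambda>p. f p - g p)"
  using smooth2_add[of f "\<lambda>p. -1 * g p"] smooth2_mult[OF smooth2_const[of "-1"], of g] by simp

lemma smooth2_diag_affine: "smooth2 g \<Longrightarrow> smooth2 (\<lambda>p. g (diag_affine a b q p))"
  by (simp add: smooth2_iff_smoothn smoothn_diag_affine)

lemma smooth2_shift: "smooth2 g \<Longrightarrow> smooth2 (\<lambda>p. g (p + q))"
  using smooth2_diag_affine[of g 1 1 q] by (simp add: diag_affine_def flip: plus_prod_def)

lemma smooth2_px_add: "smooth2 f \<Longrightarrow> smooth2 g \<Longrightarrow> px (\<lambda>p. f p + g p) = (\<lambda>p. px f p + px g p)"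
  by (simp add: fun_eq_iff px_add smooth2_differentiable)

lemma smooth2_py_add: "smooth2 f \<Longrightarrow> smooth2 g \<Longrightarrow> py (\<lambda>p. f p + g p) = (\<lambda>p. py f p + py g p)"
  by (simp add: fun_eq_iff py_add smooth2_differentiable)

lemma smooth2_px_mult: "smooth2 f \<Longrightarrow> smooth2 g \<Longrightarrow> px (\<lambda>p. f p * g p) = (\<lambda>p. f p * px g p + px f p * g p)"
  by (simp add: fun_eq_iff px_mult smooth2_differentiable)

lemma smooth2_py_mult: "smooth2 f \<Longrightarrow> smooth2 g \<Longrightarrow> py (\<lambda>p. f p * g p) = (\<lambda>p. f p * py g p + py f p * g p)"
  by (simp add: fun_eq_iff py_mult smooth2_differentiable)

lemma smooth2_px_cmult: "smooth2 g \<Longrightarrow> px (\<lambda>p. c * g p) = (\<lambda>p. c * px g p)"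
  using smooth2_px_mult[OF smooth2_const, of g c] by simp

lemma smooth2_py_cmult: "smooth2 g \<Longrightarrow> py (\<lambda>p. c * g p) = (\<lambda>p. c * py g p)"
  using smooth2_py_mult[OF smooth2_const, of g c] by simp

lemma smooth2_px_diff: "smooth2 f \<Longrightarrow> smooth2 g \<Longrightarrow> px (\<lambda>p. f p - g p) = (\<lambda>p. px f p - px g p)"
  using smooth2_px_add[of f "\<lambda>p. -1 * g p"] smooth2_mult[OF smooth2_const[of "-1"], of g]
    smooth2_px_cmult[of g "-1"] by simp

lemma smooth2_py_diff: "smooth2 f \<Longrightarrow> smooth2 g \<Longrightarrow> py (\<lambda>p. f p - g p) = (\<lambda>p. py f p - py g p)"
  using smooth2_py_add[of f "\<lambda>p. -1 * g p"] smooth2_mult[OF smooth2_const[of "-1"], of g]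
    smooth2_py_cmult[of g "-1"] by simp

lemma smooth2_px_shift: "smooth2 g \<Longrightarrow> px (\<lambda>p. g (p + q)) = (\<lambda>p. px g (p + q))"
  using px_diag_affine[of g 1 1 q]
  by (simp add: diag_affine_def smooth2_differentiable fun_eq_iff flip: plus_prod_def)

lemma smooth2_py_shift: "smooth2 g \<Longrightarrow> py (\<lambda>p. g (p + q)) = (\<lambda>p. py g (p + q))"
  using py_diag_affine[of g 1 1 q]
  by (simp add: diag_affine_def smooth2_differentiable fun_eq_iff flip: plus_prod_def)

section \<open>Test functions with compact support\<close>

lemma C0inf_smooth2: "g \<in> C0inf \<Longrightarrow> smooth2 g"
  by (simp add: C0inf_def)

text \<open>Vanishing outside a ball passes through sums, products, shifts and derivatives more
  easily than compactness of the closed support.\<close>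

lemma C0inf_iff: "g \<in> C0inf \<longleftrightarrow> smooth2 g \<and> (\<exists>r>0. \<forall>p. r \<le> norm p \<longrightarrow> g p = 0)"
proof -
  have "compact (closure {p. g p \<noteq> 0}) \<longleftrightarrow> (\<exists>r>0. \<forall>p. r \<le> norm p \<longrightarrow> g p = 0)"
  proof
    assume "compact (closure {p. g p \<noteq> 0})"
    then have "bounded {p. g p \<noteq> 0}" by (meson bounded_subset closure_subset compact_imp_bounded)
    then obtain r where "0 < r" and r: "\<forall>p\<in>{p. g p \<noteq> 0}. norm p < r" using bounded_pos_less by blast
    then show "\<exists>r>0. \<forall>p. r \<le> norm p \<longrightarrow> g p = 0" by (intro exI[of _ r]) force
  next
    assume "\<exists>r>0. \<forall>p. r \<le> norm p \<longrightarrow> g p = 0"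
    then obtain r where r: "\<And>p. r \<le> norm p \<Longrightarrow> g p = 0" by blast
    have "{p. g p \<noteq> 0} \<subseteq> cball 0 r" using r by (force simp: not_le)
    then show "compact (closure {p. g p \<noteq> 0})"
      by (meson bounded_cball bounded_subset compact_closure)
  qed
  then show ?thesis by (simp add: C0inf_def)
qed

lemma C0infE:
  assumes "g \<in> C0inf" obtains r where "r > 0" "\<And>p. r \<le> norm p \<Longrightarrow> g p = 0"
  using assms C0inf_iff by auto

lemma C0inf_mult_left: "smooth2 c \<Longrightarrow> g \<in> C0inf \<Longrightarrow> (\<lambda>p. c p * g p) \<in> C0inf"
  by (auto simp: C0inf_iff smooth2_mult)

lemma C0inf_mult: "f \<in> C0inf \<Longrightarrow> g \<in> C0inf \<Longrightarrow> (\<lambda>p. f p * g p) \<in> C0inf"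
  by (simp add: C0inf_mult_left C0inf_smooth2)

lemma C0inf_cmult: "g \<in> C0inf \<Longrightarrow> (\<lambda>p. c * g p) \<in> C0inf"
  by (rule C0inf_mult_left[OF smooth2_const])

lemma C0inf_divide: "g \<in> C0inf \<Longrightarrow> (\<lambda>p. g p / c) \<in> C0inf"
  using C0inf_cmult[of g "inverse c"] by (simp add: divide_inverse mult.commute)

lemma C0inf_add:
  assumes "f \<in> C0inf" "g \<in> C0inf" shows "(\<lambda>p. f p + g p) \<in> C0inf"
proof -
  obtain r s where "0 < r" "\<And>p. r \<le> norm p \<Longrightarrow> f p = 0" "0 < s" "\<And>p. s \<le> norm p \<Longrightarrow> g p = 0"
    using C0infE[OF assms(1)] C0infE[OF assms(2)] by metis
  then have "\<exists>r>0. \<forall>p. r \<le> norm p \<longrightarrow> f p + g p = 0" by (intro exI[of _ "max r s"]) auto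
  then show ?thesis using assms by (simp add: C0inf_iff smooth2_add)
qed

lemma C0inf_diff: "f \<in> C0inf \<Longrightarrow> g \<in> C0inf \<Longrightarrow> (\<lambda>p. f p - g p) \<in> C0inf"
  using C0inf_add[of f "\<lambda>p. -1 * g p"] C0inf_cmult[of g "-1"] by simp

lemma C0inf_shift:
  assumes "g \<in> C0inf" shows "(\<lambda>p. g (p + q)) \<in> C0inf"
proof -
  obtain r where "0 < r" and r: "\<And>p. r \<le> norm p \<Longrightarrow> g p = 0" using C0infE[OF assms] by blast
  have "g (p + q) = 0" if "r + norm q \<le> norm p" for p
    using that norm_triangle_ineq4[of "p + q" q] by (intro r) simp
  then have "\<exists>r>0. \<forall>p. r \<le> norm p \<longrightarrow> g (p + q) = 0"
    using \<open>0 < r\<close> by (intro exI[of _ "r + norm q"]) (auto simp: add_pos_nonneg)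
  then show ?thesis using assms by (simp add: C0inf_iff smooth2_shift)
qed

text \<open>The strict inequality gives \<open>p\<close> a neighbourhood on which \<open>g\<close>
  vanishes; this is why the radius is enlarged to \<open>r + 1\<close> for derivatives.\<close>

lemma C0inf_dd_zero:
  assumes "smooth2 g" "\<And>p. r \<le> norm p \<Longrightarrow> g p = 0" "r < norm p"
  shows "dd d g p = 0"
proof -
  have "(g has_derivative (\<lambda>d. 0)) (at p)"
  proof (rule has_derivative_transform_within_open[OF has_derivative_const])
    show "open {p :: real \<times> real. r < norm p}" by (intro open_Collect_less continuous_intros)
  qed (use assms in auto)
  then show ?thesis by (rule dd_eqI)
qed

lemma C0inf_dd:
  assumes "g \<in> C0inf" shows "dd d g \<in> C0inf"
proof -
  have g: "smooth2 g" using assms by (rule C0inf_smooth2)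
  obtain r where "0 < r" and r: "\<And>p. r \<le> norm p \<Longrightarrow> g p = 0" using C0infE[OF assms] by blast
  have "dd d g p = 0" if "r + 1 \<le> norm p" for p
    using C0inf_dd_zero[of g r p d] g r that by simp
  moreover have "smooth2 (dd d g)"
    unfolding dd_def by (intro smooth2_add smooth2_mult smooth2_const smooth2_px smooth2_py g)
  ultimately show ?thesis using \<open>0 < r\<close> by (auto simp: C0inf_iff intro!: exI[of _ "r + 1"])
qed

lemma C0inf_px: "g \<in> C0inf \<Longrightarrow> px g \<in> C0inf"
  using C0inf_dd[of g "(1, 0)"] by (simp add: dd_coordinate)

lemma C0inf_py: "g \<in> C0inf \<Longrightarrow> py g \<in> C0inf"
  using C0inf_dd[of g "(0, 1)"] by (simp add: dd_coordinate)

lemma C0inf_continuous: "g \<in> C0inf \<Longrightarrow> continuous_on S g"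
  by (simp add: C0inf_smooth2 smooth2_continuous)

lemma C0inf_measurable: "g \<in> C0inf \<Longrightarrow> g \<in> borel_measurable borel"
  by (rule borel_measurable_continuous_onI) (rule C0inf_continuous)

lemma continuous_cpt_integrable:
  fixes f :: "'a::euclidean_space \<Rightarrow> real"
  assumes "continuous_on UNIV f" "\<And>p. r \<le> norm p \<Longrightarrow> f p = 0"
  shows "integrable lborel f"
proof -
  have "integrable lborel (\<lambda>p. indicator (cball 0 r) p *\<^sub>R f p)"
    by (rule borel_integrable_compact) (auto intro: continuous_on_subset[OF assms(1)])
  moreover have "(\<lambda>p. indicator (cball 0 r) p *\<^sub>R f p) = f"
    using assms(2) by (auto simp: indicator_def fun_eq_iff)
  ultimately show ?thesis by (simp only:)
qed

lemma C0inf_integrable: "g \<in> C0inf \<Longrightarrow> integrable lborel g"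
  by (metis C0infE C0inf_continuous continuous_cpt_integrable)

lemma C0inf_L2: "g \<in> C0inf \<Longrightarrow> L2 g"
  using C0inf_integrable[OF C0inf_mult[of g g]] C0inf_measurable[of g]
  by (simp add: L2_def power2_eq_square)

lemma C0inf_bounded: assumes "g \<in> C0inf" obtains K where "K > 0" "\<And>p. \<bar>g p\<bar> \<le> K"
proof -
  obtain r where "0 < r" and r: "\<And>p. r \<le> norm p \<Longrightarrow> g p = 0" using C0infE[OF assms] by blast
  have "compact (g ` cball 0 r)"
    by (intro compact_continuous_image C0inf_continuous assms compact_cball)
  then obtain K where K: "K > 0" "\<And>p. p \<in> cball 0 r \<Longrightarrow> \<bar>g p\<bar> \<le> K"
    using compact_imp_bounded bounded_pos by (metis imageI real_norm_def)
  have "\<bar>g p\<bar> \<le> K" for p using K r[of p] by (cases "norm p \<le> r") auto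
  then show ?thesis using K that by blast
qed

section \<open>Integration by parts and increments\<close>

lemma lborel2_integral:
  fixes f :: fun2
  assumes "integrable lborel f"
  shows "(\<integral>p. f p \<partial>lborel) = (\<integral>x. \<integral>y. f (x, y) \<partial>lborel \<partial>lborel)" (is ?A)
    and "(\<integral>p. f p \<partial>lborel) = (\<integral>y. \<integral>x. f (x, y) \<partial>lborel \<partial>lborel)" (is ?B)
proof -
  have i: "integrable (lborel \<Otimes>\<^sub>M lborel) f" using assms by (simp add: lborel_prod)
  have i': "integrable (lborel \<Otimes>\<^sub>M lborel) (\<lambda>(x, y). f (x, y))" using i by simp
  show ?A
    using lborel_pair.integral_fst[OF i'] by (simp add: lborel_prod)
  show ?B
    using lborel_pair.integral_snd[OF i'] by (simp add: lborel_prod)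
qed

lemma integral_deriv_cpt:
  fixes F :: "real \<Rightarrow> real"
  assumes der: "\<And>x. (F has_real_derivative F' x) (at x)" and cont: "continuous_on UNIV F'"
    and supp: "\<And>x. r \<le> \<bar>x\<bar> \<Longrightarrow> F x = 0" "\<And>x. r \<le> \<bar>x\<bar> \<Longrightarrow> F' x = 0" and "0 \<le> r"
  shows "(\<integral>x. F' x \<partial>lborel) = 0" (is ?A)
    and "(\<integral>s. F' s * indicator {..x} s \<partial>lborel) = F x" (is ?B)
proof -
  \<comment> \<open>The left end lies to the left of \<open>x\<close> and outside the support, so
    the boundary term there is 0.\<close>
  have *: "(\<integral>s. F' s * indicator {-(r + \<bar>x\<bar>)..x} s \<partial>lborel) = F x" for x
  proof -
    have "(\<integral>s. F' s * indicator {-(r + \<bar>x\<bar>)..x} s \<partial>lborel) = F x - F (-(r + \<bar>x\<bar>))"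
      using \<open>0 \<le> r\<close> by (intro integral_FTC_Icc_real der)
        (use cont in \<open>auto simp: continuous_on_eq_continuous_at\<close>)
    then show ?thesis using supp(1)[of "-(r + \<bar>x\<bar>)"] \<open>0 \<le> r\<close> by simp
  qed
  have "(\<lambda>s. F' s * indicator {-(r + \<bar>r\<bar>)..r} s) = F'"
  proof
    show "F' s * indicator {-(r + \<bar>r\<bar>)..r} s = F' s" for s
    using supp(2)[of s] \<open>0 \<le> r\<close> by (cases "r \<le> \<bar>s\<bar>") (auto simp: indicator_def not_le abs_less_iff)
  qed
  then show ?A using *[of r] supp(1)[of r] \<open>0 \<le> r\<close> by (simp only: abs_of_nonneg)
  have "(\<lambda>s. F' s * indicator {-(r + \<bar>x\<bar>)..x} s) = (\<lambda>s. F' s * indicator {..x} s)"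
  proof
    show "F' s * indicator {-(r + \<bar>x\<bar>)..x} s = F' s * indicator {..x} s" for s
    using supp(2)[of s] \<open>0 \<le> r\<close> by (cases "r \<le> \<bar>s\<bar>") (auto simp: indicator_def not_le abs_less_iff)
  qed
  then show ?B using *[of x] by (simp only:)
qed

lemma norm_Pair_ge: "\<bar>x\<bar> \<le> norm (x :: real, y :: real)" "\<bar>y\<bar> \<le> norm (x :: real, y :: real)"
  using norm_fst_le[of x y] norm_snd_le[of y x] by auto

lemma C0inf_radius:
  assumes "g \<in> C0inf"
  shows "\<exists>r>0. \<forall>p. r \<le> norm p \<longrightarrow> g p = 0 \<and> px g p = 0 \<and> py g p = 0"
proof -
  obtain r1 where r1: "r1 > 0" "\<And>p. r1 \<le> norm p \<Longrightarrow> g p = 0"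
    using C0infE[OF assms] by blast
  obtain r2 where r2: "r2 > 0" "\<And>p. r2 \<le> norm p \<Longrightarrow> px g p = 0"
    using C0infE[OF C0inf_px[OF assms]] by blast
  obtain r3 where r3: "r3 > 0" "\<And>p. r3 \<le> norm p \<Longrightarrow> py g p = 0"
    using C0infE[OF C0inf_py[OF assms]] by blast
  show ?thesis by (rule exI[of _ "max r1 (max r2 r3)"]) (use r1 r2 r3 in simp)
qed

lemma C0inf_slice_x:
  assumes "g \<in> C0inf"
  shows "(\<integral>x. px g (x, y) \<partial>lborel) = 0" (is ?A)
    and "(\<integral>s. px g (s, y) * indicator {..x} s \<partial>lborel) = g (x, y)" (is ?B)
proof -
  obtain r where r: "r > 0" "\<And>p. r \<le> norm p \<Longrightarrow> g p = 0" "\<And>p. r \<le> norm p \<Longrightarrow> px g p = 0"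
    "\<And>p. r \<le> norm p \<Longrightarrow> py g p = 0"
    using C0inf_radius[OF assms] by blast
  have c: "continuous_on UNIV (\<lambda>x. px g (x, y))"
    by (rule continuous_on_compose2[OF C0inf_continuous[OF C0inf_px[OF assms], of UNIV]])
      (auto intro!: continuous_intros)
  note * = integral_deriv_cpt[where F = "\<lambda>x. g (x, y)" and r = r, OF smooth2_deriv_x[OF C0inf_smooth2[OF assms]] c]
  have z: "g (u, y) = 0" "px g (u, y) = 0" if "r \<le> \<bar>u\<bar>" for u
    using r(2,3)[of "(u, y)"] norm_Pair_ge(1)[where x = u and y = y] that by simp_all
  show ?A
    by (rule *(1)) (use r(1) z in simp_all)
  show ?B
    by (rule *(2)) (use r(1) z in simp_all)
qed

lemma C0inf_slice_y:
  assumes "g \<in> C0inf"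
  shows "(\<integral>y. py g (x, y) \<partial>lborel) = 0" (is ?A)
    and "(\<integral>t. py g (x, t) * indicator {..y} t \<partial>lborel) = g (x, y)" (is ?B)
proof -
  obtain r where r: "r > 0" "\<And>p. r \<le> norm p \<Longrightarrow> g p = 0" "\<And>p. r \<le> norm p \<Longrightarrow> px g p = 0"
    "\<And>p. r \<le> norm p \<Longrightarrow> py g p = 0"
    using C0inf_radius[OF assms] by blast
  have c: "continuous_on UNIV (\<lambda>y. py g (x, y))"
    by (rule continuous_on_compose2[OF C0inf_continuous[OF C0inf_py[OF assms], of UNIV]])
      (auto intro!: continuous_intros)
  note * = integral_deriv_cpt[where F = "\<lambda>y. g (x, y)" and r = r, OF smooth2_deriv_y[OF C0inf_smooth2[OF assms]] c]
  have z: "g (x, u) = 0" "py g (x, u) = 0" if "r \<le> \<bar>u\<bar>" for u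
    using r(2,4)[of "(x, u)"] norm_Pair_ge(2)[where x = x and y = u] that by simp_all
  show ?A
    by (rule *(1)) (use r(1) z in simp_all)
  show ?B
    by (rule *(2)) (use r(1) z in simp_all)
qed

lemma C0inf_integral_px: "g \<in> C0inf \<Longrightarrow> (\<integral>p. px g p \<partial>lborel) = 0"
  by (simp add: lborel2_integral(2)[OF C0inf_integrable[OF C0inf_px]] C0inf_slice_x)

lemma C0inf_integral_py: "g \<in> C0inf \<Longrightarrow> (\<integral>p. py g p \<partial>lborel) = 0"
  by (simp add: lborel2_integral(1)[OF C0inf_integrable[OF C0inf_py]] C0inf_slice_y)

lemma ip_px:
  assumes "f \<in> C0inf" "g \<in> C0inf" shows "ip f (px g) = - ip (px f) g"
proof -
  have "0 = (\<integral>p. f p * px g p + px f p * g p \<partial>lborel)"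
    using C0inf_integral_px[OF C0inf_mult[OF assms]] by (simp add: smooth2_px_mult assms C0inf_smooth2)
  also have "\<dots> = ip f (px g) + ip (px f) g"
    unfolding ip_def by (intro Bochner_Integration.integral_add C0inf_integrable C0inf_mult C0inf_px assms)
  finally show ?thesis by simp
qed

lemma ip_py:
  assumes "f \<in> C0inf" "g \<in> C0inf" shows "ip f (py g) = - ip (py f) g"
proof -
  have "0 = (\<integral>p. f p * py g p + py f p * g p \<partial>lborel)"
    using C0inf_integral_py[OF C0inf_mult[OF assms]] by (simp add: smooth2_py_mult assms C0inf_smooth2)
  also have "\<dots> = ip f (py g) + ip (py f) g"
    unfolding ip_def by (intro Bochner_Integration.integral_add C0inf_integrable C0inf_mult C0inf_py assms)
  finally show ?thesis by simp
qed

text \<open>Clairaut's theorem. Write g(x, y) - g(a, y) as the integral of \<open>px g\<close> over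
  [a, x], differentiate under the integral sign in y, and then differentiate in x by the fundamental
  theorem of calculus.\<close>

lemma px_py_commute:
  assumes "smooth2 g" shows "px (py g) = py (px g)"
proof
  fix p :: "real \<times> real"
  obtain x0 y0 where p: "p = (x0, y0)" by (cases p)
  have c1: "continuous_on UNIV (px g)" and c2: "continuous_on UNIV (py (px g))"
    using assms by (auto intro: smooth2_continuous smooth2_px smooth2_py)
  have c1': "continuous_on S (\<lambda>s. px g (s, y))" for y S
    by (rule continuous_on_compose2[OF c1]) (auto intro!: continuous_intros)
  have c2': "continuous_on S (\<lambda>s. py (px g) (s, y))" for y S
    by (rule continuous_on_compose2[OF c2]) (auto intro!: continuous_intros)
  \<comment> \<open>With this base point x0 is interior to [a, x0 + 1], so the derivative within
    that interval is the full derivative.\<close>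
  define a where "a = x0 - 1"
  have FTC: "integral {a..x} (\<lambda>s. px g (s, y)) = g (x, y) - g (a, y)" if "a \<le> x" for x y
    by (rule integral_unique, rule fundamental_theorem_of_calculus[OF that])
      (auto intro!: has_field_derivative_at_within smooth2_deriv_x assms
        simp flip: has_real_derivative_iff_has_vector_derivative)
  have "integral {a..x} (\<lambda>s. py (px g) (s, y0)) = py g (x, y0) - py g (a, y0)" if "a \<le> x" for x
  proof (rule DERIV_unique)
    have "((\<lambda>y. integral (cbox a x) (\<lambda>s. px g (s, y))) has_field_derivative
        integral (cbox a x) (\<lambda>s. py (px g) (s, y0))) (at y0 within UNIV)"
    proof (rule leibniz_rule_field_derivative)
      show "((\<lambda>y. px g (t, y)) has_field_derivative py (px g) (t, y)) (at y within UNIV)" for t y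
        using smooth2_deriv_y[OF smooth2_px[OF assms]] by simp
      show "(\<lambda>s. px g (s, y)) integrable_on cbox a x" for y
        by (rule integrable_continuous) (rule c1')
      show "continuous_on (UNIV \<times> cbox a x) (\<lambda>(y, s). py (px g) (s, y))"
        unfolding split_beta
        by (rule continuous_on_compose2[OF c2]) (auto intro!: continuous_intros)
    qed auto
    then show "((\<lambda>y. g (x, y) - g (a, y)) has_field_derivative
        integral {a..x} (\<lambda>s. py (px g) (s, y0))) (at y0)"
      by (simp add: FTC[OF that])
    show "((\<lambda>y. g (x, y) - g (a, y)) has_field_derivative py g (x, y0) - py g (a, y0)) (at y0)"
      by (intro DERIV_diff smooth2_deriv_y assms)
  qed
  then have eq: "py g (x, y0) = integral {a..x} (\<lambda>s. py (px g) (s, y0)) + py g (a, y0)" if "x \<in> {a..x0 + 1}" for x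
    using that by simp
  have "((\<lambda>x. integral {a..x} (\<lambda>s. py (px g) (s, y0)) + py g (a, y0)) has_real_derivative py (px g) (x0, y0) + 0)
      (at x0 within {a..x0 + 1})"
    by (intro DERIV_add DERIV_const integral_has_real_derivative c2') (simp add: a_def)
  then have "((\<lambda>x. py g (x, y0)) has_real_derivative py (px g) (x0, y0)) (at x0 within {a..x0 + 1})"
    unfolding add_0_right
  proof (rule has_field_derivative_transform_within[OF _ zero_less_one])
    show "x0 \<in> {a..x0 + 1}" by (simp add: a_def)
  qed (rule eq[symmetric])
  then have "((\<lambda>x. py g (x, y0)) has_real_derivative py (px g) (x0, y0)) (at x0)"
    using at_within_interior[of x0 "{a..x0 + 1}"] by (simp add: a_def)
  then have "py (px g) (x0, y0) = px (py g) (x0, y0)"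
    by (rule DERIV_unique[OF _ smooth2_deriv_x[OF smooth2_py[OF assms]]])
  then show "px (py g) p = py (px g) p" by (simp add: p)
qed

text \<open>On Y the nonlocal operator disappears: for u = g_x the function D_x^(-1) u_y is g_y,
  because mixed partials commute and g_y has compact support. The forms on X become integrals of
  derivatives of the potential.\<close>

lemma Dxinv_py_px:
  assumes "g \<in> C0inf" shows "Dxinv (py (px g)) = py g"
proof
  fix p :: "real \<times> real"
  obtain x y where p: "p = (x, y)" by (cases p)
  have "Dxinv (py (px g)) p = (\<integral>s. px (py g) (s, y) * indicator {..x} s \<partial>lebesgue)"
    by (simp add: Dxinv_def p px_py_commute[OF C0inf_smooth2[OF assms], symmetric]
        set_lebesgue_integral_def mult.commute)
  also have "\<dots> = (\<integral>s. px (py g) (s, y) * indicator {..x} s \<partial>lborel)"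
  proof (rule integral_completion)
    have "continuous_on UNIV (\<lambda>s. px (py g) (s, y))"
      by (rule continuous_on_compose2[OF C0inf_continuous[OF C0inf_px[OF C0inf_py[OF assms]], of UNIV]])
        (auto intro!: continuous_intros)
    then have [measurable]: "(\<lambda>s. px (py g) (s, y)) \<in> borel_measurable borel"
      by (rule borel_measurable_continuous_onI)
    show "(\<lambda>s. px (py g) (s, y) * indicator {..x} s) \<in> borel_measurable lborel" by measurable
  qed
  also have "\<dots> = py g (x, y)" by (rule C0inf_slice_x(2)[OF C0inf_py[OF assms]])
  finally show "Dxinv (py (px g)) p = py g p" by (simp add: p)
qed

text \<open>The increment is the integral of G' over [0, h]. Cauchy-Schwarz in s against the
  indicator of [0, h] bounds its square by h times the integral of the square of G', and Tonelli
  then gives h * (h b^2). A general family \<open>G\<close> covers a plain translate as well as a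
  translate minus its linear part.\<close>

lemma L2_increment:
  fixes G G' :: "real \<Rightarrow> 'a::euclidean_space \<Rightarrow> real"
  assumes h: "0 \<le> h" and b: "0 \<le> b"
    and der: "\<And>s p. 0 \<le> s \<Longrightarrow> s \<le> h \<Longrightarrow> ((\<lambda>s. G s p) has_real_derivative G' s p) (at s)"
    and cont: "continuous_on UNIV (\<lambda>(s, p). G' s p)"
    and bound: "\<And>s. 0 \<le> s \<Longrightarrow> s \<le> h \<Longrightarrow> L2 (G' s) \<and> nrm (G' s) \<le> b"
    and meas: "(\<lambda>p. G h p - G 0 p) \<in> borel_measurable lborel"
  shows "nrm (\<lambda>p. G h p - G 0 p) \<le> h * b"
proof (rule L2_nn_integralI(2)[OF meas])
  have contp: "continuous_on S (\<lambda>s. G' s p)" for S p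
    using continuous_on_compose2[OF cont, of S "\<lambda>s. (s, p)"]
    by (simp add: continuous_on_Pair continuous_on_id)
  have [measurable]: "(\<lambda>s. G' s p) \<in> borel_measurable borel" for p
    by (rule borel_measurable_continuous_onI) (rule contp)
  have [measurable]: "(\<lambda>z. G' (fst z) (snd z)) \<in> borel_measurable borel"
    by (rule borel_measurable_continuous_onI) (use cont in \<open>simp add: split_beta\<close>)
  have "(\<lambda>z. indicator {0..h} (fst z) :: real) \<in> borel_measurable (borel :: (real \<times> 'a) measure)"
    by (rule measurable_compose[OF borel_measurable_continuous_onI]) (auto intro!: continuous_intros)
  then have "(\<lambda>z. ennreal (indicator {0..h} (fst z) * (G' (fst z) (snd z))\<^sup>2)) \<in> borel_measurable borel"
    by measurable
  then have meas2: "(\<lambda>(s, p). ennreal (indicator {0..h} s * (G' s p)\<^sup>2)) \<in> borel_measurable (lborel \<Otimes>\<^sub>M lborel)"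
    unfolding lborel_prod split_beta by simp
  have pt: "ennreal ((G h p - G 0 p)\<^sup>2) \<le> ennreal h * (\<integral>\<^sup>+s. ennreal (indicator {0..h} s * (G' s p)\<^sup>2) \<partial>lborel)" for p
  proof -
    let ?f = "\<lambda>s. indicator {0..h} s * G' s p" and ?i = "indicator {0..h} :: real \<Rightarrow> real"
    have int: "integrable lborel (\<lambda>s. indicator {0..h} s * k s)" if "continuous_on {0..h} k" for k :: "real \<Rightarrow> real"
      using borel_integrable_compact[OF compact_Icc that] by simp
    have Lf: "L2 ?f"
      unfolding L2_def
    proof
      show "integrable lborel (\<lambda>s. (?f s)\<^sup>2)"
        using int[of "\<lambda>s. (G' s p)\<^sup>2"] by (simp add: power_mult_distrib indicator_def continuous_on_power contp cong: if_cong flip: power2_eq_square)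
          (auto simp: if_distrib intro!: continuous_intros contp elim!: back_subst[of "integrable lborel"])
    qed measurable
    have Li: "L2 ?i"
      using int[of "\<lambda>s. 1"] by (simp add: L2_def power2_eq_square flip: indicator_inter_arith)
    have "G h p - G 0 p = (\<integral>s. G' s p * indicator {0..h} s \<partial>lborel)"
      by (rule integral_FTC_Icc_real[symmetric, OF h])
        (use der contp[of UNIV p] in \<open>simp_all add: continuous_on_eq_continuous_at\<close>)
    also have "\<dots> = ip ?f ?i"
      unfolding ip_def by (rule Bochner_Integration.integral_cong) (auto simp: indicator_def)
    finally have "\<bar>G h p - G 0 p\<bar> \<le> nrm ?f * nrm ?i"
      using ip_abs_le[OF Lf Li] by simp
    then have "(G h p - G 0 p)\<^sup>2 \<le> (nrm ?f * nrm ?i)\<^sup>2"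
      using abs_le_square_iff by fastforce
    also have "\<dots> = h * (nrm ?f)\<^sup>2"
      using h by (simp add: power_mult_distrib nrm_sq_integral[of ?i] power2_eq_square[of "indicator _ _"] flip: indicator_inter_arith)
    finally have "ennreal ((G h p - G 0 p)\<^sup>2) \<le> ennreal (h * (nrm ?f)\<^sup>2)" by (rule ennreal_leI)
    also have "\<dots> = ennreal h * (\<integral>\<^sup>+s. ennreal ((?f s)\<^sup>2) \<partial>lborel)"
      using h by (simp add: nn_integral_sq[OF Lf] ennreal_mult)
    also have "(\<lambda>s. (?f s)\<^sup>2) = (\<lambda>s. indicator {0..h} s * (G' s p)\<^sup>2)"
      by (auto simp: indicator_def)
    finally show ?thesis .
  qed
  have "(\<integral>\<^sup>+p. ennreal ((G h p - G 0 p)\<^sup>2) \<partial>lborel)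
      \<le> (\<integral>\<^sup>+p. ennreal h * (\<integral>\<^sup>+s. ennreal (indicator {0..h} s * (G' s p)\<^sup>2) \<partial>lborel) \<partial>lborel)"
    by (rule nn_integral_mono) (rule pt)
  also have "\<dots> = ennreal h * (\<integral>\<^sup>+p. (\<integral>\<^sup>+s. ennreal (indicator {0..h} s * (G' s p)\<^sup>2) \<partial>lborel) \<partial>lborel)"
    using lborel.borel_measurable_nn_integral[of "\<lambda>p s. ennreal (indicator {0..h} s * (G' s p)\<^sup>2)" lborel]
      measurable_pair_swap[OF meas2]
    by (intro nn_integral_cmult) (simp add: split_beta)
  also have "(\<integral>\<^sup>+p. (\<integral>\<^sup>+s. ennreal (indicator {0..h} s * (G' s p)\<^sup>2) \<partial>lborel) \<partial>lborel)
      = (\<integral>\<^sup>+s. (\<integral>\<^sup>+p. ennreal (indicator {0..h} s * (G' s p)\<^sup>2) \<partial>lborel) \<partial>lborel)"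
    using lborel_pair.Fubini'[OF meas2] by simp
  also have "\<dots> \<le> (\<integral>\<^sup>+s. ennreal (b\<^sup>2) * indicator {0..h} s \<partial>lborel)"
  proof (rule nn_integral_mono)
    fix s :: real
    show "(\<integral>\<^sup>+p. ennreal (indicator {0..h} s * (G' s p)\<^sup>2) \<partial>lborel) \<le> ennreal (b\<^sup>2) * indicator {0..h} s"
      using bound[of s] nn_integral_sq[of "G' s"]
      by (cases "s \<in> {0..h}") (auto intro!: ennreal_leI power_mono)
  qed
  also have "\<dots> = ennreal (b\<^sup>2 * h)"
    using h by (simp add: nn_integral_cmult ennreal_mult)
  also have "ennreal h * ennreal (b\<^sup>2 * h) = ennreal ((h * b)\<^sup>2)"
    using h b by (subst ennreal_mult[symmetric]) (simp_all add: power2_eq_square ac_simps)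
  finally show "(\<integral>\<^sup>+p. ennreal ((G h p - G 0 p)\<^sup>2) \<partial>lborel) \<le> ennreal ((h * b)\<^sup>2)"
    by (simp add: mult_left_mono)
qed (use h b in simp)

lemma dd_uminus: "dd (- d) g = (\<lambda>p. - dd d g p)"
  by (simp add: dd_def fun_eq_iff)

lemma nrm_uminus: "nrm (\<lambda>p. - f p) = nrm f"
  using nrm_cmult[of "-1" f] by simp

lemma dd_smooth2: "smooth2 g \<Longrightarrow> smooth2 (dd d g)"
  unfolding dd_def by (intro smooth2_add smooth2_mult smooth2_const smooth2_px smooth2_py)

lemma dd_diff: "smooth2 f \<Longrightarrow> smooth2 g \<Longrightarrow> dd d (\<lambda>p. f p - g p) = (\<lambda>p. dd d f p - dd d g p)"
  by (simp add: dd_def smooth2_px_diff smooth2_py_diff fun_eq_iff algebra_simps)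

lemma dd_cmult: "smooth2 g \<Longrightarrow> dd d (\<lambda>p. c * g p) = (\<lambda>p. c * dd d g p)"
  by (simp add: dd_def smooth2_px_cmult smooth2_py_cmult fun_eq_iff algebra_simps)

lemma continuous_on_C0inf_shift:
  assumes "g \<in> C0inf" shows "continuous_on UNIV (\<lambda>(s, p). g (p + s *\<^sub>R d))"
  unfolding split_beta
  by (rule continuous_on_compose2[OF C0inf_continuous[OF assms, of UNIV]]) (auto intro!: continuous_intros)

lemma nrm_increment_nonneg:
  assumes g: "g \<in> C0inf" and h: "0 \<le> h"
  shows "nrm (\<lambda>p. g (p + h *\<^sub>R d) - g p) \<le> h * nrm (dd d g)"
proof -
  have "nrm (\<lambda>p. g (p + h *\<^sub>R d) - g (p + 0 *\<^sub>R d)) \<le> h * nrm (dd d g)"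
  proof (rule L2_increment[where G = "\<lambda>s p. g (p + s *\<^sub>R d)" and G' = "\<lambda>s p. dd d g (p + s *\<^sub>R d)", OF h nrm_nonneg])
    show "continuous_on UNIV (\<lambda>(s, p). dd d g (p + s *\<^sub>R d))"
      by (rule continuous_on_C0inf_shift[OF C0inf_dd[OF g]])
    show "(\<lambda>p. g (p + h *\<^sub>R d) - g (p + 0 *\<^sub>R d)) \<in> borel_measurable lborel"
      by (rule L2_measurable) (intro L2_diff L2_shift C0inf_L2 g)
  qed (use g in \<open>auto intro: smooth2_line_deriv L2_shift C0inf_L2 C0inf_dd C0inf_smooth2 simp: nrm_shift C0inf_L2 C0inf_dd\<close>)
  then show ?thesis by simp
qed

lemma nrm_increment:
  assumes g: "g \<in> C0inf"
  shows "nrm (\<lambda>p. g (p + h *\<^sub>R d) - g p) \<le> \<bar>h\<bar> * nrm (dd d g)"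
proof (cases "0 \<le> h")
  case True
  then show ?thesis using nrm_increment_nonneg[OF g, of h d] by simp
next
  case False
  then show ?thesis using nrm_increment_nonneg[OF g, of "-h" "-d"] by (simp add: dd_uminus nrm_uminus)
qed

text \<open>Taylor's formula in square mean: g(p + s d) - s g_d(p) has the s-derivative g_d(p + s d)
  - g_d(p), which is itself an increment, of norm at most h |g_dd|.\<close>

lemma nrm_increment2:
  assumes g: "g \<in> C0inf" and h: "0 \<le> h"
  shows "nrm (\<lambda>p. g (p + h *\<^sub>R d) - g p - h * dd d g p) \<le> h * (h * nrm (dd d (dd d g)))"
proof -
  let ?v = "dd d g"
  have v: "?v \<in> C0inf" by (rule C0inf_dd[OF g])
  have "nrm (\<lambda>p. (g (p + h *\<^sub>R d) - h * ?v p) - (g (p + 0 *\<^sub>R d) - 0 * ?v p)) \<le> h * (h * nrm (dd d ?v))"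
  proof (rule L2_increment[OF h, where G = "\<lambda>s p. g (p + s *\<^sub>R d) - s * ?v p" and G' = "\<lambda>s p. ?v (p + s *\<^sub>R d) - ?v p"])
    have "continuous_on UNIV (\<lambda>z :: real \<times> real \<times> real. ?v (snd z + fst z *\<^sub>R d) - ?v (snd z))"
      using continuous_on_C0inf_shift[OF v, of d]
        continuous_on_compose2[OF C0inf_continuous[OF v, of UNIV], of UNIV "snd :: real \<times> real \<times> real \<Rightarrow> _"]
      by (intro continuous_on_diff) (simp_all add: split_beta continuous_on_snd)
    then show "continuous_on UNIV (\<lambda>(s, p). ?v (p + s *\<^sub>R d) - ?v p)" by (simp add: split_beta)
    show "((\<lambda>s. g (p + s *\<^sub>R d) - s * ?v p) has_real_derivative ?v (p + s *\<^sub>R d) - ?v p) (at s)" for s p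
      by (auto intro!: derivative_eq_intros smooth2_line_deriv C0inf_smooth2 g)
    show "(\<lambda>p. g (p + h *\<^sub>R d) - h * ?v p - (g (p + 0 *\<^sub>R d) - 0 * ?v p)) \<in> borel_measurable lborel"
      by (rule L2_measurable) (intro L2_diff L2_shift L2_cmult C0inf_L2 g v)
    fix s assume s: "0 \<le> s" "s \<le> h"
    have "nrm (\<lambda>p. ?v (p + s *\<^sub>R d) - ?v p) \<le> s * nrm (dd d ?v)" by (rule nrm_increment_nonneg[OF v s(1)])
    also have "\<dots> \<le> h * nrm (dd d ?v)" using s by (intro mult_right_mono) auto
    finally show "L2 (\<lambda>p. ?v (p + s *\<^sub>R d) - ?v p) \<and> nrm (\<lambda>p. ?v (p + s *\<^sub>R d) - ?v p) \<le> h * nrm (dd d ?v)"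
      by (intro conjI L2_diff L2_shift C0inf_L2 v)
  qed (use h in simp)
  then show ?thesis by (simp add: algebra_simps)
qed

text \<open>The central difference quotient is antisymmetric for the inner product, as a derivative is.\<close>

definition cdq :: "real \<times> real \<Rightarrow> real \<Rightarrow> fun2 \<Rightarrow> fun2" where
  "cdq d h g = (\<lambda>p. (g (p + h *\<^sub>R d) - g (p - h *\<^sub>R d)) / (2 * h))"

lemma L2_shift_minus: "L2 f \<Longrightarrow> L2 (\<lambda>p. f (p - a))"
  using L2_shift[of f "-a"] by simp

lemma nrm_shift_minus: "L2 f \<Longrightarrow> nrm (\<lambda>p. f (p - a)) = nrm f"
  using nrm_shift[of f "-a"] by simp

lemma C0inf_shift_minus: "g \<in> C0inf \<Longrightarrow> (\<lambda>p. g (p - a)) \<in> C0inf"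
  using C0inf_shift[of g "-a"] by simp

lemma cdq_L2: "L2 f \<Longrightarrow> L2 (cdq d h f)"
  unfolding cdq_def by (intro L2_divide L2_diff L2_shift L2_shift_minus)

lemma cdq_C0inf: "g \<in> C0inf \<Longrightarrow> cdq d h g \<in> C0inf"
  unfolding cdq_def by (intro C0inf_divide C0inf_diff C0inf_shift C0inf_shift_minus)

lemma cdq_diff: "cdq d h (\<lambda>p. f p - g p) = (\<lambda>p. cdq d h f p - cdq d h g p)"
  by (simp add: cdq_def fun_eq_iff diff_divide_distrib)

lemma px_cdq:
  assumes "g \<in> C0inf" shows "px (cdq d h g) = cdq d h (px g)"
proof -
  have g: "smooth2 g" using assms by (rule C0inf_smooth2)
  have "px (\<lambda>p. inverse (2 * h) * (g (p + a) - g (p + b))) = (\<lambda>p. inverse (2 * h) * (px g (p + a) - px g (p + b)))" for a b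
    by (simp only: smooth2_px_cmult smooth2_px_diff smooth2_px_shift smooth2_shift smooth2_diff g)
  from this[of "h *\<^sub>R d" "- (h *\<^sub>R d)"] show ?thesis
    by (simp only: cdq_def divide_inverse mult.commute[of _ "inverse (2 * h)"] add_uminus_conv_diff)
qed

lemma py_cdq:
  assumes "g \<in> C0inf" shows "py (cdq d h g) = cdq d h (py g)"
proof -
  have g: "smooth2 g" using assms by (rule C0inf_smooth2)
  have "py (\<lambda>p. inverse (2 * h) * (g (p + a) - g (p + b))) = (\<lambda>p. inverse (2 * h) * (py g (p + a) - py g (p + b)))" for a b
    by (simp only: smooth2_py_cmult smooth2_py_diff smooth2_py_shift smooth2_shift smooth2_diff g)
  from this[of "h *\<^sub>R d" "- (h *\<^sub>R d)"] show ?thesis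
    by (simp only: cdq_def divide_inverse mult.commute[of _ "inverse (2 * h)"] add_uminus_conv_diff)
qed

text \<open>A central quotient with step h is a translate of a forward quotient with step 2
  h.\<close>

lemma nrm_cdq_le:
  assumes g: "g \<in> C0inf" and h: "0 < h" shows "nrm (cdq d h g) \<le> nrm (dd d g)"
proof -
  let ?f = "\<lambda>p. g (p + (2 * h) *\<^sub>R d) - g p"
  have "p - h *\<^sub>R d + (2 * h) *\<^sub>R d = p + h *\<^sub>R d" for p
  proof -
    have "(2 * h) *\<^sub>R d = h *\<^sub>R d + h *\<^sub>R d" by (simp only: mult_2 scaleR_add_left)
    then show ?thesis by (simp only: diff_add_cancel add.assoc[symmetric])
  qed
  then have eq: "cdq d h g = (\<lambda>p. ?f (p - h *\<^sub>R d) / (2 * h))"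
    by (simp only: cdq_def)
  have "nrm (cdq d h g) = nrm ?f / (2 * h)"
    unfolding eq nrm_divide using h nrm_shift_minus[of ?f "h *\<^sub>R d"]
    by (simp add: L2_diff L2_shift C0inf_L2 g)
  also have "\<dots> \<le> nrm (dd d g)"
    using nrm_increment[OF g, of "2 * h" d] h by (simp add: field_simps)
  finally show ?thesis .
qed

text \<open>A bound without derivatives, at the price of 1/h. It serves for approximation errors
  that are small compared with \<open>h\<close>.\<close>

lemma nrm_cdq_L2_le:
  assumes f: "L2 f" and h: "0 < h" shows "nrm (cdq d h f) \<le> nrm f / h"
proof -
  have "nrm (cdq d h f) = nrm (\<lambda>p. f (p + h *\<^sub>R d) - f (p - h *\<^sub>R d)) / (2 * h)"
    unfolding cdq_def nrm_divide using h by simp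
  also have "\<dots> \<le> (nrm f + nrm f) / (2 * h)"
    using nrm_triangle_diff[OF L2_shift[OF f] L2_shift_minus[OF f], of "h *\<^sub>R d" "h *\<^sub>R d"] h
    by (intro divide_right_mono) (simp_all add: nrm_shift nrm_shift_minus f)
  finally show ?thesis using h by simp
qed

text \<open>The Taylor remainders in the directions \<open>d\<close> and \<open>- d\<close> are
  subtracted: the values \<open>g p\<close> cancel and the two linear terms add up.\<close>

lemma nrm_cdq_minus_dd:
  assumes g: "g \<in> C0inf" and h: "0 < h"
  shows "nrm (\<lambda>p. cdq d h g p - dd d g p) \<le> h * nrm (dd d (dd d g))"
proof -
  let ?v = "dd d g"
  let ?a = "\<lambda>p. g (p + h *\<^sub>R d) - g p - h * ?v p"
  let ?b = "\<lambda>p. g (p + h *\<^sub>R (- d)) - g p - h * dd (- d) g p"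
  have La: "L2 ?a" and Lb: "L2 ?b"
    by (intro L2_diff L2_shift L2_cmult C0inf_L2 C0inf_dd g)+
  have ddm: "dd (- d) (dd (- d) g) = dd d ?v"
    by (simp add: dd_uminus dd_cmult[of ?v _ "-1", simplified] dd_smooth2 C0inf_smooth2 g)
  have "(\<lambda>p. cdq d h g p - ?v p) = (\<lambda>p. (?a p - ?b p) / (2 * h))"
    using h by (simp add: cdq_def fun_eq_iff dd_uminus field_simps)
  then have "nrm (\<lambda>p. cdq d h g p - ?v p) = nrm (\<lambda>p. ?a p - ?b p) / (2 * h)"
    using h by (simp only: nrm_divide)
  also have "\<dots> \<le> (nrm ?a + nrm ?b) / (2 * h)"
    using h by (intro divide_right_mono nrm_triangle_diff La Lb) simp
  also have "\<dots> \<le> (h * (h * nrm (dd d ?v)) + h * (h * nrm (dd d ?v))) / (2 * h)"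
    using nrm_increment2[OF g less_imp_le[OF h], of d] nrm_increment2[OF g less_imp_le[OF h], of "-d"] h
    by (intro divide_right_mono add_mono) (simp_all add: ddm)
  also have "\<dots> = h * nrm (dd d ?v)" using h by (simp add: field_simps)
  finally show ?thesis .
qed

text \<open>Function and step vary together. The quotient of g j - g N is controlled by its
  derivative uniformly in the step, so the step only has to be small relative to one fixed function
  g N.\<close>

lemma cdq_conv2:
  assumes g: "\<And>j. g j \<in> C0inf" and V: "conv2 (\<lambda>j. dd d (g j)) V"
    and h: "\<And>j. 0 < h j" "h \<longlonglongrightarrow> 0"
  shows "conv2 (\<lambda>j. cdq d (h j) (g j)) V"
  unfolding conv2_def LIMSEQ_iff
proof (intro conjI allI impI)
  show "L2 (cdq d (h j) (g j))" for j by (intro cdq_L2 C0inf_L2 g)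
  show LV: "L2 V" using V by (simp add: conv2_def)
  have Lv: "L2 (dd d (g j))" for j by (intro C0inf_L2 C0inf_dd g)
  fix e :: real assume e: "0 < e"
  obtain N where N: "\<And>n. n \<ge> N \<Longrightarrow> nrm (\<lambda>p. dd d (g n) p - V p) < e / 4"
    using conv2D[OF V, of "e / 4"] e by auto
  let ?K = "nrm (dd d (dd d (g N)))"
  have "(\<lambda>j. h j * ?K) \<longlonglongrightarrow> 0" using h(2) by (rule tendsto_mult_left_zero)
  then obtain M where M: "\<And>n. n \<ge> M \<Longrightarrow> h n * ?K < e / 4"
    using e LIMSEQ_D[of "\<lambda>j. h j * ?K" 0 "e / 4"] by force
  show "\<exists>M. \<forall>j\<ge>M. norm (nrm (\<lambda>p. cdq d (h j) (g j) p - V p) - 0) < e"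
  proof (intro exI allI impI)
    fix j assume j: "max M N \<le> j"
    have L1: "L2 (cdq d (h j) (g j))" "L2 (cdq d (h j) (g N))" by (intro cdq_L2 C0inf_L2 g)+
    have "nrm (\<lambda>p. cdq d (h j) (g j) p - cdq d (h j) (g N) p) \<le> nrm (dd d (\<lambda>p. g j p - g N p))"
      using nrm_cdq_le[OF C0inf_diff[OF g g] h(1)] by (simp add: cdq_diff)
    also have "\<dots> = nrm (\<lambda>p. dd d (g j) p - dd d (g N) p)" by (simp add: dd_diff C0inf_smooth2 g)
    also have "\<dots> \<le> nrm (\<lambda>p. dd d (g j) p - V p) + nrm (\<lambda>p. V p - dd d (g N) p)"
      by (rule nrm_triangle_trans) (rule Lv LV)+
    finally have 1: "nrm (\<lambda>p. cdq d (h j) (g j) p - cdq d (h j) (g N) p) \<le> \<dots>" .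
    have 2: "nrm (\<lambda>p. cdq d (h j) (g N) p - dd d (g N) p) \<le> h j * ?K" by (rule nrm_cdq_minus_dd[OF g h(1)])
    have "nrm (\<lambda>p. cdq d (h j) (g j) p - V p) \<le> nrm (\<lambda>p. cdq d (h j) (g j) p - cdq d (h j) (g N) p)
       + (nrm (\<lambda>p. cdq d (h j) (g N) p - dd d (g N) p) + nrm (\<lambda>p. dd d (g N) p - V p))"
      using nrm_triangle_trans[OF L1(1) L1(2) LV] nrm_triangle_trans[OF L1(2) Lv LV, of N] by linarith
    then show "norm (nrm (\<lambda>p. cdq d (h j) (g j) p - V p) - 0) < e"
      using 1 2 N[of j] N[of N] M[of j] j nrm_minus_commute[of V "dd d (g N)"] e by simp
  qed
qed

text \<open>Translations are continuous in square mean: this is quantitative for the smooth g N, and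
  a translation does not change the distance between g N and \<open>V\<close>.\<close>

lemma shift_conv2:
  assumes g: "\<And>j. g j \<in> C0inf" and V: "conv2 g V" and h: "h \<longlonglongrightarrow> 0"
  shows "conv2 (\<lambda>j p. V (p + h j *\<^sub>R d)) V"
  unfolding conv2_def LIMSEQ_iff
proof (intro conjI allI impI)
  show LV: "L2 V" using V by (simp add: conv2_def)
  then show "L2 (\<lambda>p. V (p + h j *\<^sub>R d))" for j by (rule L2_shift)
  fix e :: real assume e: "0 < e"
  obtain N where N: "\<And>n. n \<ge> N \<Longrightarrow> nrm (\<lambda>p. g n p - V p) < e / 4"
    using conv2D[OF V, of "e / 4"] e by auto
  let ?K = "nrm (dd d (g N))"
  have "(\<lambda>j. \<bar>h j\<bar> * ?K) \<longlonglongrightarrow> 0" using h by (intro tendsto_mult_left_zero tendsto_rabs_zero)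
  then obtain M where M: "\<And>n. n \<ge> M \<Longrightarrow> \<bar>h n\<bar> * ?K < e / 4"
    using e LIMSEQ_D[of "\<lambda>j. \<bar>h j\<bar> * ?K" 0 "e / 4"] by force
  have Lg: "L2 (g N)" by (rule C0inf_L2[OF g])
  show "\<exists>M. \<forall>j\<ge>M. norm (nrm (\<lambda>p. V (p + h j *\<^sub>R d) - V p) - 0) < e"
  proof (intro exI allI impI)
    fix j assume j: "M \<le> j"
    have "nrm (\<lambda>p. V (p + h j *\<^sub>R d) - g N (p + h j *\<^sub>R d)) = nrm (\<lambda>p. V p - g N p)"
      using nrm_shift[OF L2_diff[OF LV Lg]] by simp
    moreover have "nrm (\<lambda>p. g N (p + h j *\<^sub>R d) - g N p) < e / 4"
      using nrm_increment[OF g, of N "h j" d] M[OF j] by linarith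
    moreover have "nrm (\<lambda>p. V (p + h j *\<^sub>R d) - V p) \<le> nrm (\<lambda>p. V (p + h j *\<^sub>R d) - g N (p + h j *\<^sub>R d))
        + (nrm (\<lambda>p. g N (p + h j *\<^sub>R d) - g N p) + nrm (\<lambda>p. g N p - V p))"
      using nrm_triangle_trans[OF L2_shift[OF LV] L2_shift[OF Lg] LV, of "h j *\<^sub>R d" "h j *\<^sub>R d"]
        nrm_triangle_trans[OF L2_shift[OF Lg] Lg LV, of "h j *\<^sub>R d"] by linarith
    ultimately show "norm (nrm (\<lambda>p. V (p + h j *\<^sub>R d) - V p) - 0) < e"
      using N[of N] nrm_minus_commute[of V "g N"] e by simp
  qed
qed

lemma nrm_increment_limit:
  assumes g: "\<And>j. g j \<in> C0inf" and U: "conv2 g U" and V: "conv2 (\<lambda>j. dd d (g j)) V"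
  shows "nrm (\<lambda>p. U (p + h *\<^sub>R d) - U p) \<le> \<bar>h\<bar> * nrm V"
proof (rule LIMSEQ_le)
  show "(\<lambda>j. nrm (\<lambda>p. g j (p + h *\<^sub>R d) - g j p)) \<longlonglongrightarrow> nrm (\<lambda>p. U (p + h *\<^sub>R d) - U p)"
    by (intro conv2_nrm conv2_diff conv2_shift U)
  show "(\<lambda>j. \<bar>h\<bar> * nrm (dd d (g j))) \<longlonglongrightarrow> \<bar>h\<bar> * nrm V"
    by (intro tendsto_intros conv2_nrm V)
qed (use nrm_increment[OF g] in auto)

lemma ip_shift_far:
  assumes g: "g \<in> C0inf" shows "\<exists>R. \<forall>h\<ge>R. ip (\<lambda>p. g (p + (h, 0))) g = 0"
proof -
  obtain r where r: "r > 0" "\<And>p. r \<le> norm p \<Longrightarrow> g p = 0" using C0infE[OF g] by blast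
  have "ip (\<lambda>p. g (p + (h, 0))) g = 0" if "2 * r \<le> h" for h
  proof -
    have "g (p + (h, 0)) * g p = 0" for p
    proof (cases "r \<le> norm p")
      case False
      have "h \<le> norm ((h, 0) :: real \<times> real)" by simp
      also have "\<dots> \<le> norm (p + (h, 0)) + norm p"
        using norm_triangle_ineq4[of "p + (h, 0)" p] by simp
      finally have "r \<le> norm (p + (h, 0))" using False that by linarith
      then show ?thesis using r by simp
    qed (use r in simp)
    then show ?thesis unfolding ip_def by (simp only: Bochner_Integration.integral_zero)
  qed
  then show ?thesis by blast
qed

section \<open>The anisotropic Sobolev inequality\<close>

lemma C0inf_slice_integrable:
  assumes "f \<in> C0inf" shows "integrable lborel (\<lambda>s. f (s, y))"
proof -
  obtain r where r: "r > 0" "\<And>p. r \<le> norm p \<Longrightarrow> f p = 0" using C0infE[OF assms] by blast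
  show ?thesis
  proof (rule continuous_cpt_integrable)
    show "continuous_on UNIV (\<lambda>s. f (s, y))"
      by (rule continuous_on_compose2[OF C0inf_continuous[OF assms, of UNIV]]) (auto intro!: continuous_intros)
    show "f (s, y) = 0" if "r \<le> norm s" for s
      using that norm_Pair_ge(1)[where x = s and y = y] by (intro r(2)) simp
  qed
qed

lemma C0inf_slice_L2: "f \<in> C0inf \<Longrightarrow> L2 (\<lambda>s. f (s, y))"
  using C0inf_slice_integrable[OF C0inf_mult[of f f]] C0inf_slice_integrable[of f y]
  by (simp add: L2_def power2_eq_square)

text \<open>On a slice u^2 is the integral of 2 u u_x over a half-line; Cauchy-Schwarz and one more
  squaring produce the factor 4.\<close>

lemma slice_quartic_bound:
  assumes "u \<in> C0inf"
  shows "(u (x, y))^4 \<le> 4 * (\<integral>s. (u (s, y))\<^sup>2 \<partial>lborel) * (\<integral>s. (px u (s, y))\<^sup>2 \<partial>lborel)"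
proof -
  let ?u = "\<lambda>s. u (s, y)" and ?v = "\<lambda>s. px u (s, y)" and ?i = "indicator {..x} :: real \<Rightarrow> real"
  have Lu: "L2 ?u" and Lv: "L2 ?v" by (intro C0inf_slice_L2 C0inf_px assms)+
  have Li: "L2 (\<lambda>s. ?i s * ?u s)" by (rule L2_bmult[OF Lu, of _ 1]) (auto simp: indicator_def)
  have "(u (x, y))\<^sup>2 = (\<integral>s. px (\<lambda>p. u p * u p) (s, y) * ?i s \<partial>lborel)"
    by (simp add: C0inf_slice_x(2)[OF C0inf_mult[OF assms assms]] power2_eq_square)
  also have "\<dots> = (\<integral>s. 2 * (?i s * ?u s * ?v s) \<partial>lborel)"
    by (rule Bochner_Integration.integral_cong) (auto simp: smooth2_px_mult C0inf_smooth2 assms)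
  also have "\<dots> = 2 * ip (\<lambda>s. ?i s * ?u s) ?v" by (simp add: ip_def)
  finally have "(u (x, y))\<^sup>2 \<le> 2 * (nrm (\<lambda>s. ?i s * ?u s) * nrm ?v)"
    using ip_abs_le[OF Li Lv] by linarith
  also have "\<dots> \<le> 2 * ((1 * nrm ?u) * nrm ?v)"
    by (intro mult_left_mono mult_right_mono nrm_bmult_le Lu) (auto simp: indicator_def)
  finally have "((u (x, y))\<^sup>2)\<^sup>2 \<le> (2 * (nrm ?u * nrm ?v))\<^sup>2" by (intro power_mono) auto
  then show ?thesis by (simp add: power_mult_distrib nrm_sq_integral flip: power_mult)
qed

text \<open>The energy controls the mass of every horizontal slice: integrating by parts in \<open>x\<close>,
  half the derivative of the slice mass is the integral of \<open>u * u_y = u * w_x\<close>, that is, of \<open>- u_x * w\<close>.\<close>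

lemma slice_mass_bound:
  assumes g: "g \<in> C0inf"
  shows "(\<integral>s. (px g (s, y))\<^sup>2 \<partial>lborel) \<le> (nrm (px (px g)))\<^sup>2 + (nrm (py g))\<^sup>2"
proof -
  define u where "u = px g"
  define w where "w = py g"
  define K where "K = (\<lambda>p. u p * u p)"
  define D where "D = (\<lambda>p. u p * w p)"
  define i where "i = (\<lambda>p :: real \<times> real. indicator {..y} (snd p) :: real)"
  have u: "u \<in> C0inf" and w: "w \<in> C0inf" unfolding u_def w_def by (intro C0inf_px C0inf_py g)+
  have K: "K \<in> C0inf" and D: "D \<in> C0inf" unfolding K_def D_def by (intro C0inf_mult u w)+
  have "(\<lambda>p :: real \<times> real. snd p) \<in> borel_measurable borel"
    by (intro borel_measurable_continuous_onI continuous_intros)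
  then have [measurable]: "i \<in> borel_measurable borel"
    unfolding i_def by measurable
  have i01: "\<bar>i p\<bar> \<le> 1" for p by (simp add: i_def indicator_def)
  have int: "integrable lborel (\<lambda>p. i p * f p)" if "f \<in> C0inf" for f
  proof (rule Bochner_Integration.integrable_bound[OF C0inf_integrable[OF that]])
    show "(\<lambda>p. i p * f p) \<in> borel_measurable lborel" using C0inf_measurable[OF that] by measurable
    show "AE p in lborel. norm (i p * f p) \<le> norm (f p)"
      using i01 by (simp add: abs_mult mult_left_le_one_le)
  qed
  have pyK: "py K p = 2 * (u p * px w p)" for p
    by (simp add: K_def smooth2_py_mult C0inf_smooth2 u) (simp add: u_def w_def px_py_commute C0inf_smooth2 g)
  have pxD: "px D p = u p * px w p + px u p * w p" for p
    by (simp add: D_def smooth2_px_mult C0inf_smooth2 u w)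
  have "(\<integral>s. (px g (s, y))\<^sup>2 \<partial>lborel) = (\<integral>x. K (x, y) \<partial>lborel)"
    by (simp add: K_def u_def power2_eq_square)
  also have "\<dots> = (\<integral>x. \<integral>t. i (x, t) * py K (x, t) \<partial>lborel \<partial>lborel)"
    by (simp add: C0inf_slice_y(2)[OF K, symmetric] i_def mult.commute)
  also have "\<dots> = (\<integral>p. i p * py K p \<partial>lborel)"
    using lborel2_integral(1)[OF int[OF C0inf_py[OF K]]] by simp
  also have "\<dots> = (\<integral>p. 2 * (i p * px D p) - 2 * (i p * (px u p * w p)) \<partial>lborel)"
    by (rule Bochner_Integration.integral_cong) (simp_all add: pyK pxD algebra_simps)
  also have "\<dots> = 2 * (\<integral>p. i p * px D p \<partial>lborel) - 2 * (\<integral>p. i p * (px u p * w p) \<partial>lborel)"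
    using int[OF C0inf_px[OF D]] int[OF C0inf_mult[OF C0inf_px[OF u] w]] by simp
  \<comment> \<open>The half-plane indicator is constant along horizontal lines, and on each of them
    the integral of \<open>px D\<close> vanishes.\<close>
  also have "(\<integral>p. i p * px D p \<partial>lborel) = 0"
    using lborel2_integral(2)[OF int[OF C0inf_px[OF D]]] by (simp add: i_def C0inf_slice_x(1)[OF D])
  also have "2 * 0 - 2 * (\<integral>p. i p * (px u p * w p) \<partial>lborel)
      = (\<integral>p. - 2 * (i p * (px u p * w p)) \<partial>lborel)" by simp
  also have "\<dots> \<le> (\<integral>p. (px u p)\<^sup>2 + (w p)\<^sup>2 \<partial>lborel)"
  proof (rule integral_mono)
    show "integrable lborel (\<lambda>p. - 2 * (i p * (px u p * w p)))"
      using int[OF C0inf_mult[OF C0inf_px[OF u] w]] by simp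
    show "integrable lborel (\<lambda>p. (px u p)\<^sup>2 + (w p)\<^sup>2)"
      using C0inf_L2[OF C0inf_px[OF u]] C0inf_L2[OF w] by (simp add: L2_def)
    fix p
    have "- 2 * (i p * (px u p * w p)) \<le> 2 * \<bar>px u p\<bar> * \<bar>w p\<bar>"
    proof -
      have "- 2 * (i p * (px u p * w p)) \<le> \<bar>i p\<bar> * (2 * \<bar>px u p * w p\<bar>)"
        using abs_ge_self[of "- 2 * (i p * (px u p * w p))"] by (simp add: abs_mult)
      also have "\<dots> \<le> 1 * (2 * \<bar>px u p * w p\<bar>)" by (intro mult_right_mono i01) simp
      finally show ?thesis by (simp add: abs_mult)
    qed
    also have "\<dots> \<le> \<bar>px u p\<bar>\<^sup>2 + \<bar>w p\<bar>\<^sup>2" by (rule sum_squares_bound)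
    finally show "- 2 * (i p * (px u p * w p)) \<le> (px u p)\<^sup>2 + (w p)\<^sup>2" by simp
  qed
  also have "\<dots> = (nrm (px u))\<^sup>2 + (nrm w)\<^sup>2"
    using C0inf_L2[OF C0inf_px[OF u]] C0inf_L2[OF w] by (simp add: nrm_sq_integral L2_def)
  finally show ?thesis by (simp add: u_def w_def)
qed

text \<open>On a slice of mass m and x-energy a, u^6 is at most 4 m a u^2. Integrating in x gives 4
  m^2 a, where m is at most E by \<open>slice_mass_bound\<close>; integrating a in y gives the
  integral of u_x^2, again at most E.\<close>

lemma sobolev_C0inf:
  assumes g: "g \<in> C0inf"
  shows "(\<integral>p. (px g p)^6 \<partial>lborel) \<le> 4 * ((nrm (px (px g)))\<^sup>2 + (nrm (py g))\<^sup>2)^3"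
proof -
  define u where "u = px g"
  define E where "E = (nrm (px (px g)))\<^sup>2 + (nrm (py g))\<^sup>2"
  define m where "m y = (\<integral>s. (u (s, y))\<^sup>2 \<partial>lborel)" for y
  define a where "a y = (\<integral>s. (px u (s, y))\<^sup>2 \<partial>lborel)" for y
  have u: "u \<in> C0inf" unfolding u_def by (intro C0inf_px g)
  have sq: "f \<in> C0inf \<Longrightarrow> (\<lambda>p. (f p)\<^sup>2) \<in> C0inf" for f
    using C0inf_mult[of f f] by (simp add: power2_eq_square)
  have E0: "0 \<le> E" by (simp add: E_def)
  have m0: "0 \<le> m y" and a0: "0 \<le> a y" and mE: "m y \<le> E" for y
    using slice_mass_bound[OF g] by (simp_all add: m_def a_def u_def E_def)
  have u6: "(\<lambda>p. (u p)^6) \<in> C0inf"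
    using C0inf_mult[OF sq[OF u] C0inf_mult[OF sq[OF u] sq[OF u]]] by (simp flip: power_add)
  have i6: "integrable lborel (\<lambda>p. (u p)^6)" and ia: "integrable lborel (\<lambda>p. (px u p)\<^sup>2)"
    by (intro C0inf_integrable u6 sq C0inf_px u)+
  have snd_int: "integrable lborel (\<lambda>y. \<integral>x. f (x, y) \<partial>lborel)" if "integrable lborel f" for f :: fun2
  proof -
    have "integrable (lborel \<Otimes>\<^sub>M lborel) (\<lambda>(x, y). f (x, y))" using that by (simp add: lborel_prod)
    from lborel_pair.integrable_snd[OF this] show ?thesis by simp
  qed
  have "(\<integral>p. (u p)^6 \<partial>lborel) = (\<integral>y. \<integral>x. (u (x, y))^6 \<partial>lborel \<partial>lborel)"
    by (rule lborel2_integral(2)[OF i6])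
  also have "\<dots> \<le> (\<integral>y. 4 * E\<^sup>2 * a y \<partial>lborel)"
  proof (rule integral_mono)
    show "integrable lborel (\<lambda>y. \<integral>x. (u (x, y))^6 \<partial>lborel)" by (rule snd_int[OF i6])
    show "integrable lborel (\<lambda>y. 4 * E\<^sup>2 * a y)"
      unfolding a_def by (intro integrable_mult_right snd_int[OF ia])
    fix y
    have "(\<integral>x. (u (x, y))^6 \<partial>lborel) \<le> (\<integral>x. 4 * m y * a y * (u (x, y))\<^sup>2 \<partial>lborel)"
    proof (rule integral_mono)
      show "integrable lborel (\<lambda>x. (u (x, y))^6)" by (rule C0inf_slice_integrable[OF u6])
      show "integrable lborel (\<lambda>x. 4 * m y * a y * (u (x, y))\<^sup>2)"
        by (intro integrable_mult_right C0inf_slice_integrable[OF sq[OF u]])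
      fix x
      have "(u (x, y))^6 = (u (x, y))^4 * (u (x, y))\<^sup>2" by (simp flip: power_add)
      also have "\<dots> \<le> (4 * m y * a y) * (u (x, y))\<^sup>2"
        using slice_quartic_bound[OF u, of x y] by (intro mult_right_mono) (simp_all add: m_def a_def)
      finally show "(u (x, y))^6 \<le> 4 * m y * a y * (u (x, y))\<^sup>2" .
    qed
    also have "\<dots> = 4 * (m y * m y) * a y" by (simp add: m_def)
    also have "\<dots> \<le> 4 * (E * E) * a y"
      by (intro mult_right_mono mult_left_mono mult_mono mE m0 a0 E0) simp
    finally show "(\<integral>x. (u (x, y))^6 \<partial>lborel) \<le> 4 * E\<^sup>2 * a y" by (simp add: power2_eq_square)
  qed
  also have "\<dots> = 4 * E\<^sup>2 * (nrm (px u))\<^sup>2"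
    using lborel2_integral(2)[OF ia] by (simp add: a_def nrm_sq_integral)
  also have "\<dots> \<le> 4 * E\<^sup>2 * E"
    by (intro mult_left_mono) (simp_all add: E_def u_def)
  finally show ?thesis by (simp add: u_def E_def power2_eq_square power3_eq_cube mult.assoc)
qed

section \<open>Limit triples and closability\<close>

lemma conv2_unique:
  assumes "conv2 f g" "conv2 f g'" shows "nrm (\<lambda>p. g p - g' p) = 0"
proof -
  have "conv2 (\<lambda>n p. f n p - f n p) (\<lambda>p. g p - g' p)" by (rule conv2_diff[OF assms])
  from conv2_nrm[OF this] show ?thesis by (simp add: LIMSEQ_const_iff)
qed

lemma conv2_subseq_AE:
  assumes "conv2 f g"
  obtains r where "strict_mono r" "AE p in lborel. (\<lambda>n. f (r n) p) \<longlonglongrightarrow> g p"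
proof -
  obtain r g' where r: "strict_mono r" and g': "g' \<in> borel_measurable lborel"
    and ae: "AE p in lborel. (\<lambda>n. f (r n) p) \<longlonglongrightarrow> g' p"
    using cauchy2_subseq_AE[OF conv2_imp_cauchy2[OF assms]] .
  have c: "conv2 (\<lambda>n. f (r n)) g" by (rule conv2_subseq[OF assms r])
  have c': "conv2 (\<lambda>n. f (r n)) g'" by (rule cauchy2_AE_limit[OF conv2_imp_cauchy2[OF c] g' ae])
  have "AE p in lborel. g p - g' p = 0"
    using conv2_unique[OF c c'] c c' by (intro nrm_zero_AE L2_diff) (auto simp: conv2_def)
  with ae have "AE p in lborel. (\<lambda>n. f (r n) p) \<longlonglongrightarrow> g p" by eventually_elim simp
  with r show ?thesis by (rule that)
qed

text \<open>The triple of limits \<open>u\<close>, \<open>u_x\<close> and \<open>D_x^(-1) u_y\<close> of a sequence in \<open>Y\<close>.\<close>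

definition trip :: "(nat \<Rightarrow> fun2) \<Rightarrow> fun2 \<Rightarrow> fun2 \<Rightarrow> fun2 \<Rightarrow> bool" where
  "trip g U Ux W \<longleftrightarrow> (\<forall>n. g n \<in> C0inf) \<and> conv2 (\<lambda>n. px (g n)) U \<and>
     conv2 (\<lambda>n. px (px (g n))) Ux \<and> conv2 (\<lambda>n. py (g n)) W"

lemma tripD:
  assumes "trip g U Ux W"
  shows "g n \<in> C0inf" "conv2 (\<lambda>n. px (g n)) U" "conv2 (\<lambda>n. px (px (g n))) Ux" "conv2 (\<lambda>n. py (g n)) W"
    "L2 U" "L2 Ux" "L2 W"
  using assms by (auto simp: trip_def conv2_def)

lemma trip_const: "g \<in> C0inf \<Longrightarrow> trip (\<lambda>n. g) (px g) (px (px g)) (py g)"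
  by (simp add: trip_def conv2_const C0inf_L2 C0inf_px C0inf_py)

lemma trip_diff:
  assumes "trip g U Ux W" "trip g' U' Ux' W'"
  shows "trip (\<lambda>n p. g n p - g' n p) (\<lambda>p. U p - U' p) (\<lambda>p. Ux p - Ux' p) (\<lambda>p. W p - W' p)"
  using assms conv2_diff[of "\<lambda>n. px (g n)" U "\<lambda>n. px (g' n)" U']
    conv2_diff[of "\<lambda>n. px (px (g n))" Ux "\<lambda>n. px (px (g' n))" Ux']
    conv2_diff[of "\<lambda>n. py (g n)" W "\<lambda>n. py (g' n)" W']
  by (simp add: trip_def C0inf_diff smooth2_px_diff smooth2_py_diff C0inf_smooth2 smooth2_px)

lemma trip_shift:
  assumes "trip g U Ux W"
  shows "trip (\<lambda>n p. g n (p + a)) (\<lambda>p. U (p + a)) (\<lambda>p. Ux (p + a)) (\<lambda>p. W (p + a))"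
  using assms conv2_shift[of "\<lambda>n. px (g n)" U a] conv2_shift[of "\<lambda>n. px (px (g n))" Ux a]
    conv2_shift[of "\<lambda>n. py (g n)" W a]
  by (simp add: trip_def C0inf_shift smooth2_px_shift smooth2_py_shift C0inf_smooth2 smooth2_px)

text \<open>The approximants are only known to converge in square mean, so the bound on sixth powers
  passes to the limit by Fatou's lemma along an a.e. convergent subsequence.\<close>

lemma sobolev_trip:
  assumes T: "trip g U Ux W"
  shows "integrable lborel (\<lambda>p. (U p)^6)"
    and "(\<integral>p. (U p)^6 \<partial>lborel) \<le> 4 * ((nrm Ux)\<^sup>2 + (nrm W)\<^sup>2)^3"
proof -
  note D = tripD[OF T]
  define E where "E n = (nrm (px (px (g n))))\<^sup>2 + (nrm (py (g n)))\<^sup>2" for n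
  define E' where "E' = (nrm Ux)\<^sup>2 + (nrm W)\<^sup>2"
  have E: "E \<longlonglongrightarrow> E'"
    unfolding E_def E'_def using D by (intro tendsto_intros conv2_nrm)
  obtain r where r: "strict_mono r" and ae: "AE p in lborel. (\<lambda>n. px (g (r n)) p) \<longlonglongrightarrow> U p"
    using conv2_subseq_AE[OF D(2)] .
  have [measurable]: "px (g n) \<in> borel_measurable borel" for n by (intro C0inf_measurable C0inf_px D)
  have [measurable]: "U \<in> borel_measurable borel" using D(5) by (rule L2_borel_measurable)
  have "(\<integral>\<^sup>+p. ennreal ((U p)^6) \<partial>lborel) = (\<integral>\<^sup>+p. liminf (\<lambda>n. ennreal ((px (g (r n)) p)^6)) \<partial>lborel)"
  proof (rule nn_integral_cong_AE, use ae in eventually_elim)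
    fix p assume "(\<lambda>n. px (g (r n)) p) \<longlonglongrightarrow> U p"
    then have "(\<lambda>n. ennreal ((px (g (r n)) p)^6)) \<longlonglongrightarrow> ennreal ((U p)^6)" by (intro tendsto_intros)
    then show "ennreal ((U p)^6) = liminf (\<lambda>n. ennreal ((px (g (r n)) p)^6))"
      by (rule lim_imp_Liminf[OF sequentially_bot, symmetric])
  qed
  also have "\<dots> \<le> liminf (\<lambda>n. \<integral>\<^sup>+p. ennreal ((px (g (r n)) p)^6) \<partial>lborel)"
    by (rule nn_integral_liminf) measurable
  also have "\<dots> \<le> liminf (\<lambda>n. ennreal (4 * (E (r n))^3))"
  proof (rule Liminf_mono, rule always_eventually, rule allI)
    fix n
    have u: "px (g (r n)) \<in> C0inf" by (intro C0inf_px D)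
    have "(\<lambda>p. (px (g (r n)) p)^6) \<in> C0inf"
      using C0inf_mult[OF u C0inf_mult[OF u C0inf_mult[OF u C0inf_mult[OF u C0inf_mult[OF u u]]]]]
      by (simp add: numeral_eq_Suc)
    then have "(\<integral>\<^sup>+p. ennreal ((px (g (r n)) p)^6) \<partial>lborel) = ennreal (\<integral>p. (px (g (r n)) p)^6 \<partial>lborel)"
      by (intro nn_integral_eq_integral C0inf_integrable) auto
    also have "\<dots> \<le> ennreal (4 * (E (r n))^3)"
      unfolding E_def by (intro ennreal_leI sobolev_C0inf D)
    finally show "(\<integral>\<^sup>+p. ennreal ((px (g (r n)) p)^6) \<partial>lborel) \<le> ennreal (4 * (E (r n))^3)" .
  qed
  also have "\<dots> = ennreal (4 * E'^3)"
  proof (rule lim_imp_Liminf[OF sequentially_bot])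
    have "(\<lambda>n. E (r n)) \<longlonglongrightarrow> E'" using LIMSEQ_subseq_LIMSEQ[OF E r] by (simp add: o_def)
    then show "(\<lambda>n. ennreal (4 * (E (r n))^3)) \<longlonglongrightarrow> ennreal (4 * E'^3)" by (intro tendsto_intros)
  qed
  finally have le: "(\<integral>\<^sup>+p. ennreal ((U p)^6) \<partial>lborel) \<le> ennreal (4 * E'^3)" .
  have "(\<integral>\<^sup>+p. ennreal ((U p)^6) \<partial>lborel) < \<infinity>"
    using le by (rule le_less_trans) (simp add: ennreal_less_top)
  then show int: "integrable lborel (\<lambda>p. (U p)^6)" by (simp add: integrable_iff_bounded)
  have "0 \<le> E'" by (simp add: E'_def)
  have "(\<integral>\<^sup>+p. ennreal ((U p)^6) \<partial>lborel) = ennreal (\<integral>p. (U p)^6 \<partial>lborel)"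
    by (rule nn_integral_eq_integral[OF int]) simp
  then show "(\<integral>p. (U p)^6 \<partial>lborel) \<le> 4 * ((nrm Ux)\<^sup>2 + (nrm W)\<^sup>2)^3"
    using le \<open>0 \<le> E'\<close> by (simp add: E'_def ennreal_le_iff)
qed

text \<open>The quadratic form is closable. For \<open>u_x\<close> this is integration by parts. For \<open>W = D_x^(-1) u_y\<close>
  it only shows that \<open>W\<close> does not depend on \<open>x\<close>, so that square integrability is needed to conclude.\<close>

lemma trip_zero_x:
  assumes T: "trip g (\<lambda>p. 0) P Q" shows "nrm P = 0"
proof -
  note D = tripD[OF T]
  have z: "ip P (px (px (g m))) = 0" for m
  proof (rule LIMSEQ_unique)
    have v: "px (px (g m)) \<in> C0inf" by (intro C0inf_px D)
    show "(\<lambda>n. ip (px (px (g n))) (px (px (g m)))) \<longlonglongrightarrow> ip P (px (px (g m)))"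
      by (intro conv2_ip D conv2_const C0inf_L2 v)
    have "ip (px (px (g n))) (px (px (g m))) = - ip (px (g n)) (px (px (px (g m))))" for n
      using ip_px[OF C0inf_px[OF D(1)] v, of n] by simp
    moreover have "(\<lambda>n. - ip (px (g n)) (px (px (px (g m))))) \<longlonglongrightarrow> - ip (\<lambda>p. 0) (px (px (px (g m))))"
      by (intro tendsto_minus conv2_ip D conv2_const C0inf_L2 C0inf_px)
    ultimately show "(\<lambda>n. ip (px (px (g n))) (px (px (g m)))) \<longlonglongrightarrow> 0" by (simp add: ip_def)
  qed
  have "(\<lambda>m. ip P (px (px (g m)))) \<longlonglongrightarrow> ip P P" by (rule conv2_ip_right[OF D(3,6)])
  then have "ip P P = 0" by (simp add: z LIMSEQ_const_iff)
  then show ?thesis by (simp add: nrm_def)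
qed

text \<open>The potentials g n need not converge, but their x-increments do: these are bounded by
  |h| times the norm of \<open>px (g n)\<close>, which tends to 0. Moving the y-derivative to the
  other factor shows that Q(p + (h, 0)) - Q(p) is orthogonal to every \<open>py (g m)\<close>, hence
  to \<open>Q\<close>. So the correlation of \<open>Q\<close> with its translates is constant in h,
  whereas for compactly supported approximants of \<open>Q\<close> it vanishes for large h.\<close>

lemma trip_zero_w:
  assumes T: "trip g (\<lambda>p. 0) P Q" shows "nrm Q = 0"
proof -
  note D = tripD[OF T]
  have z: "ip (\<lambda>p. Q (p + (h, 0)) - Q p) (py (g m)) = 0" for m h
  proof (rule LIMSEQ_unique)
    have w: "py (g m) \<in> C0inf" by (intro C0inf_py D)
    show "(\<lambda>n. ip (\<lambda>p. py (g n) (p + (h, 0)) - py (g n) p) (py (g m)))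
        \<longlonglongrightarrow> ip (\<lambda>p. Q (p + (h, 0)) - Q p) (py (g m))"
      by (intro conv2_ip conv2_diff conv2_shift D conv2_const C0inf_L2 w)
    show "(\<lambda>n. ip (\<lambda>p. py (g n) (p + (h, 0)) - py (g n) p) (py (g m))) \<longlonglongrightarrow> 0"
    proof (rule tendsto_rabs_zero_cancel, rule tendsto_sandwich[of "\<lambda>n. 0"])
      let ?b = "\<lambda>n. \<bar>h\<bar> * nrm (px (g n)) * nrm (py (py (g m)))"
      have "\<bar>ip (\<lambda>p. py (g n) (p + (h, 0)) - py (g n) p) (py (g m))\<bar> \<le> ?b n" for n
      proof -
        let ?d = "\<lambda>p. g n (p + (h, 0)) - g n p"
        have d: "?d \<in> C0inf" by (intro C0inf_diff C0inf_shift D)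
        have "py ?d = (\<lambda>p. py (g n) (p + (h, 0)) - py (g n) p)"
          by (simp add: smooth2_py_diff smooth2_py_shift smooth2_shift C0inf_smooth2 D)
        then have "ip (\<lambda>p. py (g n) (p + (h, 0)) - py (g n) p) (py (g m)) = - ip ?d (py (py (g m)))"
          using ip_py[OF d w] by simp
        also have "\<bar>\<dots>\<bar> \<le> nrm ?d * nrm (py (py (g m)))"
          using ip_abs_le[OF C0inf_L2[OF d] C0inf_L2[OF C0inf_py[OF w]]] by simp
        also have "\<dots> \<le> ?b n"
          using nrm_increment[OF D(1)[of n], of h "(1, 0)"] by (intro mult_right_mono) (simp_all add: dd_coordinate)
        finally show ?thesis .
      qed
      then show "\<forall>\<^sub>F n in sequentially. \<bar>ip (\<lambda>p. py (g n) (p + (h, 0)) - py (g n) p) (py (g m))\<bar> \<le> ?b n" by simp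
      have "?b \<longlonglongrightarrow> \<bar>h\<bar> * nrm (\<lambda>p :: real \<times> real. 0) * nrm (py (py (g m)))"
        by (intro tendsto_intros conv2_nrm D)
      then show "?b \<longlonglongrightarrow> 0" by simp
    qed auto
  qed
  have const: "ip (\<lambda>p. Q (p + (h, 0))) Q = ip Q Q" for h
  proof -
    have "(\<lambda>m. ip (\<lambda>p. Q (p + (h, 0)) - Q p) (py (g m))) \<longlonglongrightarrow> ip (\<lambda>p. Q (p + (h, 0)) - Q p) Q"
      by (intro conv2_ip_right D L2_diff L2_shift)
    then have "ip (\<lambda>p. Q (p + (h, 0)) - Q p) Q = 0" by (simp add: z LIMSEQ_const_iff)
    then show ?thesis by (simp add: ip_diff_left L2_shift D)
  qed
  have le: "ip Q Q \<le> nrm (\<lambda>p. Q p - py (g m) p) * (nrm Q + nrm (py (g m)))" for m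
  proof -
    let ?w = "py (g m)"
    have w: "?w \<in> C0inf" by (intro C0inf_py D)
    note L = C0inf_L2[OF w] D(7)
    \<comment> \<open>The translate is moved so far that the supports are disjoint; only
      approximation errors remain.\<close>
    obtain h where h: "ip (\<lambda>p. ?w (p + (h, 0))) ?w = 0" using ip_shift_far[OF w] by blast
    have "ip Q Q = ip (\<lambda>p. Q (p + (h, 0)) - ?w (p + (h, 0))) Q + ip (\<lambda>p. ?w (p + (h, 0))) (\<lambda>p. Q p - ?w p)"
      using L h by (simp add: ip_diff_left ip_diff_right L2_shift const[of h, symmetric])
    also have "\<dots> \<le> nrm (\<lambda>p. Q (p + (h, 0)) - ?w (p + (h, 0))) * nrm Q + nrm (\<lambda>p. ?w (p + (h, 0))) * nrm (\<lambda>p. Q p - ?w p)"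
      using ip_abs_le[of "\<lambda>p. Q (p + (h, 0)) - ?w (p + (h, 0))" Q]
        ip_abs_le[of "\<lambda>p. ?w (p + (h, 0))" "\<lambda>p. Q p - ?w p"] L
      by (intro add_mono) (simp_all add: L2_diff L2_shift)
    also have "\<dots> = nrm (\<lambda>p. Q p - ?w p) * (nrm Q + nrm ?w)"
      using nrm_shift[OF L2_diff[OF L(2,1)], of "(h, 0)"] nrm_shift[OF L(1), of "(h, 0)"] by (simp add: algebra_simps)
    finally show ?thesis .
  qed
  have "ip Q Q \<le> 0 * (nrm Q + nrm Q)"
  proof (rule LIMSEQ_le_const)
    show "(\<lambda>m. nrm (\<lambda>p. Q p - py (g m) p) * (nrm Q + nrm (py (g m)))) \<longlonglongrightarrow> 0 * (nrm Q + nrm Q)"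
      using D(4) by (intro tendsto_intros conv2_nrm[OF D(4)]) (simp add: conv2_def nrm_minus_commute[of Q])
  qed (use le in auto)
  then show ?thesis using ip_self_nonneg[of Q] by (simp add: nrm_def)
qed

section \<open>Reduction to limit triples\<close>

lemma inner0Y_px:
  assumes "g \<in> C0inf" "k \<in> C0inf"
  shows "inner0Y (px g) (px k) = ip (px (px g)) (px (px k)) + ip (py g) (py k)"
proof -
  have "inner0Y (px g) (px k) = (\<integral>p. px (px g) p * px (px k) p + py g p * py k p \<partial>lebesgue)"
    by (simp add: inner0Y_def Dxinv_py_px assms)
  also have "\<dots> = (\<integral>p. px (px g) p * px (px k) p + py g p * py k p \<partial>lborel)"
    by (rule integral_completion)
      (use C0inf_measurable[OF C0inf_add[OF C0inf_mult[of "px (px g)" "px (px k)"] C0inf_mult[of "py g" "py k"]]] assms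
       in \<open>simp add: C0inf_px C0inf_py\<close>)
  also have "\<dots> = ip (px (px g)) (px (px k)) + ip (py g) (py k)"
    unfolding ip_def by (intro Bochner_Integration.integral_add C0inf_integrable C0inf_mult C0inf_px C0inf_py assms)
  finally show ?thesis .
qed

lemma normX_px:
  assumes g: "g \<in> C0inf"
  shows "(normX (px g))\<^sup>2 = (nrm (px (px g)))\<^sup>2 + (nrm (py g))\<^sup>2 + (nrm (px g))\<^sup>2"
proof -
  let ?F = "\<lambda>p. px (px g) p * px (px g) p + py g p * py g p + px g p * px g p"
  have F: "?F \<in> C0inf" by (intro C0inf_add C0inf_mult C0inf_px C0inf_py g)
  have "innerX (px g) (px g) = (\<integral>p. ?F p \<partial>lebesgue)"
    by (simp add: innerX_def Dxinv_py_px g)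
  also have "\<dots> = (\<integral>p. ?F p \<partial>lborel)"
    by (rule integral_completion) (use C0inf_measurable[OF F] in simp)
  also have "\<dots> = (\<integral>p. px (px g) p * px (px g) p + py g p * py g p \<partial>lborel) + ip (px g) (px g)"
    unfolding ip_def
    by (intro Bochner_Integration.integral_add C0inf_integrable C0inf_add C0inf_mult C0inf_px C0inf_py g)
  also have "(\<integral>p. px (px g) p * px (px g) p + py g p * py g p \<partial>lborel) = ip (px (px g)) (px (px g)) + ip (py g) (py g)"
    unfolding ip_def
    by (intro Bochner_Integration.integral_add C0inf_integrable C0inf_mult C0inf_px C0inf_py g)
  finally have "innerX (px g) (px g) = ip (px (px g)) (px (px g)) + ip (py g) (py g) + ip (px g) (px g)" .
  then show ?thesis by (simp add: normX_def nrm_sq)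
qed

lemma nrm_le_normX:
  assumes g: "g \<in> C0inf"
  shows "nrm (px (px g)) \<le> normX (px g)" (is ?A) "nrm (py g) \<le> normX (px g)" "nrm (px g) \<le> normX (px g)"
proof -
  have "0 \<le> innerX (px g) (px g)" by (simp add: innerX_def)
  then have "0 \<le> normX (px g)" by (simp add: normX_def)
  then show ?A "nrm (py g) \<le> normX (px g)" "nrm (px g) \<le> normX (px g)"
    by (auto intro!: power2_le_imp_le[of _ "normX (px g)"] simp: normX_px[OF g])
qed

text \<open>\<open>normX\<close> dominates the norms of g_x, g_xx and g_y, so each of the three is
  Cauchy in L2. The representative \<open>U\<close> is prescribed, so that all sequences
  approximating \<open>u\<close> share it.\<close>

lemma approx_seq_trip:
  assumes A: "approx_seq un u" and U: "U \<in> borel_measurable lborel" and ae: "AE p in lborel. u p = U p"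
  shows "\<exists>g Ux W. un = (\<lambda>n. px (g n)) \<and> trip g U Ux W"
proof -
  have "\<forall>n. \<exists>g. un n = px g \<and> g \<in> C0inf" using A by (auto simp: approx_seq_def Yspace_def)
  then obtain g where un: "\<And>n. un n = px (g n)" and g: "\<And>n. g n \<in> C0inf" by metis
  have cauchy: "\<exists>N. \<forall>j\<ge>N. \<forall>k\<ge>N. normX (px (\<lambda>p. g j p - g k p)) < e" if "0 < e" for e
    using A that by (simp add: approx_seq_def un smooth2_px_diff C0inf_smooth2 g)
  have d: "(\<lambda>p. g j p - g k p) \<in> C0inf" for j k by (intro C0inf_diff g)
  have "cauchy2 (\<lambda>n. px (g n))" "cauchy2 (\<lambda>n. px (px (g n)))" "cauchy2 (\<lambda>n. py (g n))"
    unfolding cauchy2_def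
    using cauchy nrm_le_normX[OF d]
    by (auto simp: smooth2_px_diff smooth2_py_diff C0inf_smooth2 smooth2_px g intro!: C0inf_L2 C0inf_px C0inf_py)
      (meson le_less_trans)+
  then obtain Ux W where c: "cauchy2 (\<lambda>n. px (g n))" "conv2 (\<lambda>n. px (px (g n))) Ux" "conv2 (\<lambda>n. py (g n)) W"
    using L2_complete by metis
  have "AE p in lborel. (\<lambda>n. px (g n) p) \<longlonglongrightarrow> u p"
    using A by (simp add: approx_seq_def un AE_completion_iff)
  with ae have "AE p in lborel. (\<lambda>n. px (g n) p) \<longlonglongrightarrow> U p" by eventually_elim simp
  then have "conv2 (\<lambda>n. px (g n)) U" by (rule cauchy2_AE_limit[OF c(1) U])
  then show ?thesis using c un g by (auto simp: trip_def fun_eq_iff)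
qed

text \<open>An element of \<open>Xspace\<close> is constrained only a.e. and need not be Borel; the
  pointwise \<open>lim\<close> of its approximants is.\<close>

lemma approx_seq_borel_limit:
  assumes A: "approx_seq un u"
  obtains U where "U \<in> borel_measurable lborel" "AE p in lborel. u p = U p"
proof
  have "un n \<in> borel_measurable lborel" for n
  proof -
    obtain g where "un n = px g" "g \<in> C0inf" using A unfolding approx_seq_def Yspace_def by blast
    then show ?thesis by (simp add: C0inf_measurable C0inf_px)
  qed
  then show "(\<lambda>p. lim (\<lambda>n. un n p)) \<in> borel_measurable lborel" by measurable
  have "AE p in lborel. (\<lambda>n. un n p) \<longlonglongrightarrow> u p"
    using A by (simp add: approx_seq_def AE_completion_iff)
  then show "AE p in lborel. u p = lim (\<lambda>n. un n p)" by eventually_elim (simp add: limI)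
qed

lemma conv2_limit_cong:
  assumes "conv2 f g'" "L2 g" "nrm (\<lambda>p. g' p - g p) = 0" shows "conv2 f g"
proof (rule conv2I_le)
  show "nrm (\<lambda>p. f n p - g p) \<le> nrm (\<lambda>p. f n p - g' p)" for n
    using nrm_triangle_trans[of "f n" g' g] assms by (simp add: conv2_def)
qed (use assms in \<open>auto simp: conv2_def\<close>)

text \<open>The difference of the two triples has first component 0, so closability identifies the
  other two limits.\<close>

lemma trip_limit_unique:
  assumes T: "trip g U Ux W" and T': "trip g' U Ux' W'" shows "trip g' U Ux W"
proof -
  have "trip (\<lambda>n p. g' n p - g n p) (\<lambda>p. 0) (\<lambda>p. Ux' p - Ux p) (\<lambda>p. W' p - W p)"
    using trip_diff[OF T' T] by simp
  note z = trip_zero_x[OF this] trip_zero_w[OF this]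
  show ?thesis
    using T T' conv2_limit_cong[OF _ _ z(1)] conv2_limit_cong[OF _ _ z(2)] unfolding trip_def by (meson conv2_L2(2))
qed

text \<open>Evaluates the definite description. That the limit is the same along all sequences comes
  from \<open>trip_limit_unique\<close>; that no other number qualifies comes from the existence of
  at least one pair of sequences, which membership in \<open>Xspace\<close> provides.\<close>

lemma inner0_eq:
  assumes X: "u \<in> Xspace" "v \<in> Xspace"
    and T: "trip g U Ux W" "AE p in lborel. u p = U p"
    and S: "trip k V Vx Z" "AE p in lborel. v p = V p"
  shows "inner0 u v = ip Ux Vx + ip W Z"
  unfolding inner0_def
proof (rule the_equality)
  have UV: "U \<in> borel_measurable lborel" "V \<in> borel_measurable lborel"
    using tripD(5)[OF T(1)] tripD(5)[OF S(1)] by (auto simp: L2_def)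
  show lim: "\<forall>un vn. approx_seq un u \<longrightarrow> approx_seq vn v \<longrightarrow> (\<lambda>n. inner0Y (un n) (vn n)) \<longlonglongrightarrow> ip Ux Vx + ip W Z"
  proof (intro allI impI)
    fix un vn assume "approx_seq un u" "approx_seq vn v"
    then obtain g' Ux' W' k' Vx' Z' where un: "un = (\<lambda>n. px (g' n))" "trip g' U Ux' W'"
      and vn: "vn = (\<lambda>n. px (k' n))" "trip k' V Vx' Z'"
      using approx_seq_trip[OF _ UV(1) T(2)] approx_seq_trip[OF _ UV(2) S(2)] by blast
    note D = tripD[OF trip_limit_unique[OF T(1) un(2)]]
    note E = tripD[OF trip_limit_unique[OF S(1) vn(2)]]
    have "(\<lambda>n. ip (px (px (g' n))) (px (px (k' n))) + ip (py (g' n)) (py (k' n))) \<longlonglongrightarrow> ip Ux Vx + ip W Z"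
      by (intro tendsto_add conv2_ip D E)
    then show "(\<lambda>n. inner0Y (un n) (vn n)) \<longlonglongrightarrow> ip Ux Vx + ip W Z"
      by (simp add: un(1) vn(1) inner0Y_px D E)
  qed
  fix L
  assume L: "\<forall>un vn. approx_seq un u \<longrightarrow> approx_seq vn v \<longrightarrow> (\<lambda>n. inner0Y (un n) (vn n)) \<longlonglongrightarrow> L"
  obtain un vn where "approx_seq un u" "approx_seq vn v" using X by (auto simp: Xspace_def)
  then show "L = ip Ux Vx + ip W Z" using L lim by (blast intro: LIMSEQ_unique)
qed

lemma normX_zero: "normX (\<lambda>p. 0) = 0"
  by (simp add: normX_def innerX_def Dxinv_def set_lebesgue_integral_def)

lemma px_in_Xspace: "g \<in> C0inf \<Longrightarrow> px g \<in> Xspace"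
  unfolding Xspace_def approx_seq_def Yspace_def
  by (auto simp: normX_zero intro!: exI[of _ "\<lambda>n. px g"])

text \<open>Measurability of \<open>F\<close> itself follows from a.e. equality with
  \<open>G\<close>, because Lebesgue measure is complete.\<close>

lemma integral_lebesgue_eq:
  fixes F G :: "real \<times> real \<Rightarrow> real"
  assumes "G \<in> borel_measurable lborel" "AE p in lborel. F p = G p"
  shows "(\<integral>p. F p \<partial>lebesgue) = (\<integral>p. G p \<partial>lborel)"
proof -
  have ae: "AE p in lebesgue. G p = F p" using assms(2) by (simp add: AE_completion_iff eq_commute)
  have G: "G \<in> borel_measurable lebesgue" using assms(1) by (rule measurable_completion)
  have F: "F \<in> borel_measurable lebesgue" by (rule borel_measurable_AE[OF G ae])
  have "(\<integral>p. F p \<partial>lebesgue) = (\<integral>p. G p \<partial>lebesgue)"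
    by (rule integral_cong_AE[OF F G]) (use ae in \<open>auto simp: eq_commute\<close>)
  also have "\<dots> = (\<integral>p. G p \<partial>lborel)" by (rule integral_completion[OF assms(1)])
  finally show ?thesis .
qed

text \<open>From here on only Borel functions and \<open>lborel\<close> occur. Test functions in Y
  suffice, since limits of them are recovered in \<open>weak_trip\<close>.\<close>

lemma weak_solution_trip:
  assumes w: "weak_solution f a u lam" and f: "f \<in> borel_measurable borel"
  obtains g U Ux W where "trip g U Ux W" "ip U U = a\<^sup>2"
    "\<And>k. k \<in> C0inf \<Longrightarrow> ip Ux (px (px k)) + ip W (py k) - lam * ip U (px k) - ip (\<lambda>p. f (U p)) (px k) = 0"
proof -
  have u: "u \<in> Xspace" and mass: "(\<integral>p. (u p)\<^sup>2 \<partial>lebesgue) = a\<^sup>2"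
    using w by (auto simp: weak_solution_def Sa_def)
  obtain un where A: "approx_seq un u" using u by (auto simp: Xspace_def)
  obtain U where U: "U \<in> borel_measurable lborel" "AE p in lborel. u p = U p"
    using approx_seq_borel_limit[OF A] .
  obtain g Ux W where T: "trip g U Ux W" using approx_seq_trip[OF A U] by blast
  have [measurable]: "U \<in> borel_measurable borel" "f \<in> borel_measurable borel" using U f by auto
  show ?thesis
  proof (rule that[OF T])
    have "(\<integral>p. (u p)\<^sup>2 \<partial>lebesgue) = (\<integral>p. (U p)\<^sup>2 \<partial>lborel)"
      by (rule integral_lebesgue_eq) (use U in auto)
    then show "ip U U = a\<^sup>2" using mass by (simp add: ip_def power2_eq_square)
    fix k assume k: "k \<in> C0inf"
    have [measurable]: "px k \<in> borel_measurable borel" by (intro C0inf_measurable C0inf_px k)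
    have "inner0 u (px k) = ip Ux (px (px k)) + ip W (py k)"
      by (rule inner0_eq[OF u px_in_Xspace[OF k] T U(2) trip_const[OF k]]) simp
    moreover have "(\<integral>p. u p * px k p \<partial>lebesgue) = ip U (px k)"
      unfolding ip_def by (rule integral_lebesgue_eq) (use U(2) in auto)
    moreover have "(\<integral>p. f (u p) * px k p \<partial>lebesgue) = ip (\<lambda>p. f (U p)) (px k)"
      unfolding ip_def by (rule integral_lebesgue_eq) (use U(2) in auto)
    ultimately show "ip Ux (px (px k)) + ip W (py k) - lam * ip U (px k) - ip (\<lambda>p. f (U p)) (px k) = 0"
      using bspec[OF w[unfolded weak_solution_def, THEN conjunct2] px_in_Xspace[OF k]] by simp
  qed
qed

section \<open>The power nonlinearity\<close>

definition nl :: "real \<Rightarrow> real" where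
  "nl t = \<bar>t\<bar> powr (4/3) * t"

lemma nl_minus: "nl (- t) = - nl t"
  by (simp add: nl_def)

lemma nl_nonneg_eq: "0 \<le> t \<Longrightarrow> nl t = t powr (7/3)"
  using powr_add[of t "4/3" 1] by (cases "t = 0") (simp_all add: nl_def)

lemma abs_nl: "\<bar>nl t\<bar> = \<bar>t\<bar> powr (7/3)"
  using powr_add[of "\<bar>t\<bar>" "4/3" 1] by (cases "t = 0") (simp_all add: nl_def abs_mult)

lemma nl_mult_self: "nl t * t = \<bar>t\<bar> powr (10/3)"
proof (cases "t = 0")
  case False
  then have "\<bar>t\<bar> powr (4/3 + 2) = \<bar>t\<bar> powr (4/3) * \<bar>t\<bar>\<^sup>2" by (subst powr_add) simp
  then show ?thesis by (simp add: nl_def power2_eq_square)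
qed (simp add: nl_def)

lemma nl_sq: "(nl t)\<^sup>2 = \<bar>t\<bar> powr (14/3)"
proof -
  have "(nl t)\<^sup>2 = \<bar>nl t\<bar> * \<bar>nl t\<bar>" by (simp add: power2_eq_square)
  also have "\<dots> = \<bar>t\<bar> powr (7/3 + 7/3)" unfolding abs_nl by (rule powr_add[symmetric])
  finally show ?thesis by simp
qed

lemma abs_powr_even: "\<bar>t\<bar> powr 2 = t\<^sup>2" "\<bar>t\<bar> powr 6 = t^6" for t :: real
  by (cases "t = 0"; simp)+

text \<open>The exponent 14/3 lies between 2 and 6; this is what makes the nonlinearity square
  integrable.\<close>

lemma nl_sq_le: "(nl t)\<^sup>2 \<le> t\<^sup>2 + t^6"
proof (cases "\<bar>t\<bar> \<le> 1")
  case True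
  then have "\<bar>t\<bar> powr (14/3) \<le> \<bar>t\<bar> powr 2" by (intro powr_mono') auto
  moreover have "0 \<le> t^6" by simp
  ultimately show ?thesis unfolding nl_sq abs_powr_even by linarith
next
  case False
  then have "\<bar>t\<bar> powr (14/3) \<le> \<bar>t\<bar> powr 6" by (intro powr_mono) auto
  moreover have "0 \<le> t^2" by simp
  ultimately show ?thesis unfolding nl_sq abs_powr_even by linarith
qed

lemma nl_measurable [measurable]: "nl \<in> borel_measurable borel"
  unfolding nl_def[abs_def] by measurable

text \<open>\<open>3/10 * nl t * t\<close> is the primitive of the nonlinearity; its convexity is Young's inequality.\<close>

lemma nl_convex: "nl u * v \<le> 7/10 * (nl u * u) + 3/10 * (nl v * v)"
proof -
  have "nl u * v \<le> \<bar>nl u\<bar> * \<bar>v\<bar>" using abs_ge_self[of "nl u * v"] by (simp add: abs_mult)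
  also have "\<dots> \<le> \<bar>nl u\<bar> powr (10/7) / (10/7) + \<bar>v\<bar> powr (10/3) / (10/3)"
    by (rule Youngs_inequality) auto
  also have "\<bar>nl u\<bar> powr (10/7) = \<bar>u\<bar> powr (10/3)" by (simp add: abs_nl powr_powr)
  finally show ?thesis by (simp add: nl_mult_self)
qed

text \<open>Convexity makes the remainder of the first-order expansion nonnegative, and convexity
  with \<open>u\<close> and \<open>v\<close> exchanged bounds it from above by a product of
  increments. No derivative of \<open>nl\<close> appears.\<close>

lemma nl_remainder:
  "\<bar>3/10 * (nl v * v) - 3/10 * (nl u * u) - nl u * (v - u)\<bar> \<le> \<bar>nl v - nl u\<bar> * \<bar>v - u\<bar>"
proof -
  have 1: "0 \<le> 3/10 * (nl v * v) - 3/10 * (nl u * u) - nl u * (v - u)"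
    using nl_convex[of u v] by (simp add: algebra_simps)
  have "3/10 * (nl v * v) - 3/10 * (nl u * u) - nl u * (v - u) \<le> (nl v - nl u) * (v - u)"
    using nl_convex[of v u] by (simp add: algebra_simps)
  also have "\<dots> \<le> \<bar>nl v - nl u\<bar> * \<bar>v - u\<bar>" using abs_ge_self[of "(nl v - nl u) * (v - u)"] by (simp add: abs_mult)
  finally show ?thesis using 1 by simp
qed

text \<open>The mean value estimate in the form of Young's inequality for b^(4/3) a with the
  conjugate exponents 7/4 and 7/3.\<close>

lemma nl_increment_nonneg:
  assumes "0 \<le> a" "a \<le> b" shows "nl b - nl a \<le> 7/3 * b powr (4/3) * (b - a)"
proof -
  have "b powr (4/3) * a \<le> (b powr (4/3)) powr (7/4) / (7/4) + a powr (7/3) / (7/3)"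
    by (rule Youngs_inequality) (use assms in auto)
  also have "(b powr (4/3)) powr (7/4) = b powr (7/3)" by (simp add: powr_powr)
  finally have "7/3 * (b powr (4/3) * a) \<le> 4/3 * nl b + nl a"
    using assms by (simp add: nl_nonneg_eq)
  moreover have "nl b = b powr (4/3) * b" using assms by (simp add: nl_def)
  ultimately show ?thesis by (simp add: algebra_simps)
qed

lemma nl_mono_nonneg: "0 \<le> a \<Longrightarrow> a \<le> b \<Longrightarrow> nl a \<le> nl b"
  by (simp add: nl_nonneg_eq powr_mono2)

text \<open>As \<open>nl\<close> is odd, arguments of equal sign reduce to nonnegative ones; for
  opposite signs the estimate goes through 0.\<close>

lemma nl_lipschitz:
  assumes "\<bar>u\<bar> \<le> K" "\<bar>v\<bar> \<le> K" shows "\<bar>nl v - nl u\<bar> \<le> 7/3 * K powr (4/3) * \<bar>v - u\<bar>"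
proof -
  have K: "b powr (4/3) \<le> K powr (4/3)" if "0 \<le> b" "b \<le> K" for b using that by (intro powr_mono2) auto
  have ord: "\<bar>nl b - nl a\<bar> \<le> 7/3 * K powr (4/3) * (b - a)" if "0 \<le> a" "a \<le> b" "b \<le> K" for a b
  proof -
    have "nl b - nl a \<le> 7/3 * b powr (4/3) * (b - a)" by (rule nl_increment_nonneg[OF that(1,2)])
    also have "\<dots> \<le> 7/3 * K powr (4/3) * (b - a)"
      using that K[of b] by (intro mult_right_mono mult_left_mono) auto
    finally show ?thesis using nl_mono_nonneg[OF that(1,2)] by simp
  qed
  have opp: "\<bar>nl b - nl (- a)\<bar> \<le> 7/3 * K powr (4/3) * (b + a)" if "0 \<le> a" "0 \<le> b" "a \<le> K" "b \<le> K" for a b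
    using ord[of 0 a] ord[of 0 b] that by (simp add: nl_minus nl_def[of 0] abs_if algebra_simps split: if_splits)
  show ?thesis
  proof (cases "0 \<le> u"; cases "0 \<le> v")
    assume "0 \<le> u" "0 \<le> v"
    then show ?thesis using ord[of u v] ord[of v u] assms
      by (cases "u \<le> v") (auto simp: abs_minus_commute)
  next
    assume "0 \<le> u" "\<not> 0 \<le> v"
    then show ?thesis using opp[of "-v" u] assms by (auto simp: abs_minus_commute)
  next
    assume "\<not> 0 \<le> u" "0 \<le> v"
    then show ?thesis using opp[of "-u" v] assms by auto
  next
    assume "\<not> 0 \<le> u" "\<not> 0 \<le> v"
    then show ?thesis using ord[of "-u" "-v"] ord[of "-v" "-u"] assms
      by (cases "u \<le> v") (auto simp: nl_minus abs_minus_commute)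
  qed
qed

text \<open>Below a level K the function is Lipschitz. Above it the growth 14/3 of the square falls
  short of 6 by 4/3, so sixth powers dominate with a coefficient that is as small as
  desired.\<close>

lemma nl_diff_sq_bound:
  assumes e: "0 < e" shows "\<exists>C\<ge>0. \<forall>u v. (nl v - nl u)\<^sup>2 \<le> C * (v - u)\<^sup>2 + e * (u^6 + v^6)"
proof -
  \<comment> \<open>Chosen so that the constant 4 in the estimate for large values equals e *
    K^(4/3).\<close>
  define K where "K = (4/e) powr (3/4)"
  have K: "0 < K" "K powr (4/3) = 4/e" using e by (simp_all add: K_def powr_powr)
  define C where "C = (7/3 * K powr (4/3))\<^sup>2"
  have "(nl v - nl u)\<^sup>2 \<le> C * (v - u)\<^sup>2 + e * (u^6 + v^6)" for u v
  proof (cases "\<bar>u\<bar> \<le> K \<and> \<bar>v\<bar> \<le> K")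
    case True
    then have "\<bar>nl v - nl u\<bar>\<^sup>2 \<le> (7/3 * K powr (4/3) * \<bar>v - u\<bar>)\<^sup>2"
      by (intro power_mono nl_lipschitz) auto
    also have "\<dots> = C * (v - u)\<^sup>2" unfolding C_def power_mult_distrib[of _ "\<bar>v - u\<bar>"] by simp
    finally have "(nl v - nl u)\<^sup>2 \<le> C * (v - u)\<^sup>2" by simp
    moreover have "0 \<le> e * (u^6 + v^6)" using e by simp
    ultimately show ?thesis by linarith
  next
    case False
    define s where "s = max \<bar>u\<bar> \<bar>v\<bar>"
    have s: "K < s" "\<bar>u\<bar> \<le> s" "\<bar>v\<bar> \<le> s" "s = \<bar>u\<bar> \<or> s = \<bar>v\<bar>" using False by (auto simp: s_def)
    have s0: "0 < s" using s K by linarith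
    have "(nl v - nl u)\<^sup>2 \<le> 2 * (nl u)\<^sup>2 + 2 * (nl v)\<^sup>2"
      using sum_squares_bound[of "nl u" "- nl v"] by (simp add: power2_diff mult.commute mult.left_commute)
    also have "\<dots> \<le> 2 * s powr (14/3) + 2 * s powr (14/3)"
      unfolding nl_sq by (intro add_mono mult_left_mono powr_mono2 s) auto
    also have "\<dots> = 4 * s powr (14/3)" by simp
    also have "\<dots> = e * (K powr (4/3)) * s powr (14/3)" using K e by simp
    also have "\<dots> \<le> e * (s powr (4/3)) * s powr (14/3)"
      using K s e by (intro mult_right_mono mult_left_mono powr_mono2) auto
    also have "\<dots> = e * s powr 6" by (simp add: mult.assoc flip: powr_add)
    also have "s powr 6 = s^6" using s0 by simp
    also have "s^6 \<le> u^6 + v^6" using s(4) by auto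
    finally have "(nl v - nl u)\<^sup>2 \<le> e * (u^6 + v^6)" using e by (simp add: mult_left_mono)
    moreover have "0 \<le> C * (v - u)\<^sup>2" by (simp add: C_def)
    ultimately show ?thesis by linarith
  qed
  then show ?thesis by (intro exI[of _ C]) (auto simp: C_def)
qed

lemma nl_L2:
  assumes "L2 U" "integrable lborel (\<lambda>p. (U p)^6)" shows "L2 (\<lambda>p. nl (U p))"
  unfolding L2_def
proof
  have [measurable]: "U \<in> borel_measurable borel" using assms(1) by (rule L2_borel_measurable)
  show "(\<lambda>p. nl (U p)) \<in> borel_measurable lborel" by measurable
  show "integrable lborel (\<lambda>p. (nl (U p))\<^sup>2)"
  proof (rule Bochner_Integration.integrable_bound)
    show "integrable lborel (\<lambda>p. (U p)\<^sup>2 + (U p)^6)" using assms by (simp add: L2_def)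
    show "AE p in lborel. norm ((nl (U p))\<^sup>2) \<le> norm ((U p)\<^sup>2 + (U p)^6)"
      using nl_sq_le by simp
  qed measurable
qed

text \<open>The integral of the sixth power is invariant under translation, so its contribution is
  uniformly small through the coefficient alone; convergence of the translates is used only in
  square mean.\<close>

lemma nl_shift_conv2:
  assumes c: "conv2 (\<lambda>j p. U (p + a j)) U" and i: "integrable lborel (\<lambda>p. (U p)^6)"
  shows "conv2 (\<lambda>j p. nl (U (p + a j))) (\<lambda>p. nl (U p))"
  unfolding conv2_def
proof (intro conjI allI)
  have U: "L2 U" using c by (simp add: conv2_def)
  have is6: "integrable lborel (\<lambda>p. (U (p + a j))^6)" for j using integrable_shift[OF i] by simp
  show nU: "L2 (\<lambda>p. nl (U p))" by (rule nl_L2[OF U i])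
  show nUs: "L2 (\<lambda>p. nl (U (p + a j)))" for j by (rule L2_shift[OF nU])
  define S where "S = (\<integral>p. (U p)^6 \<partial>lborel)"
  have Ss: "(\<integral>p. (U (p + a j))^6 \<partial>lborel) = S" for j
    unfolding S_def using integral_shift[of "\<lambda>p. (U p)^6" "a j"] i by auto
  have S0: "0 \<le> S" by (simp add: S_def)
  have "(\<lambda>j. (nrm (\<lambda>p. nl (U (p + a j)) - nl (U p)))\<^sup>2) \<longlonglongrightarrow> 0"
    unfolding LIMSEQ_iff
  proof (intro allI impI)
    fix e :: real assume e: "0 < e"
    \<comment> \<open>Makes e' * (S + S) at most e / 2; the summand 4 guards against S = 0.\<close>
    define e' where "e' = e / (4 * S + 4)"
    have e': "0 < e'" using e S0 by (simp add: e'_def)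
    obtain C where C: "0 \<le> C" "\<And>u v. (nl v - nl u)\<^sup>2 \<le> C * (v - u)\<^sup>2 + e' * (u^6 + v^6)"
      using nl_diff_sq_bound[OF e'] by blast
    have bound: "(nrm (\<lambda>p. nl (U (p + a j)) - nl (U p)))\<^sup>2 \<le> C * (nrm (\<lambda>p. U (p + a j) - U p))\<^sup>2 + e / 2" for j
    proof -
      have i1: "integrable lborel (\<lambda>p. (U (p + a j) - U p)\<^sup>2)"
        by (intro L2_integrable_sq L2_diff L2_shift U)
      have "(nrm (\<lambda>p. nl (U (p + a j)) - nl (U p)))\<^sup>2
          \<le> (\<integral>p. C * (U (p + a j) - U p)\<^sup>2 + e' * ((U p)^6 + (U (p + a j))^6) \<partial>lborel)"
        unfolding nrm_sq_integral
        by (intro integral_mono C Bochner_Integration.integrable_add integrable_mult_right i1 i is6 L2_integrable_sq L2_diff nU nUs)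
      also have "\<dots> = C * (nrm (\<lambda>p. U (p + a j) - U p))\<^sup>2 + e' * (S + S)"
        using i1 i is6[of j] Ss[of j] by (simp add: nrm_sq_integral S_def)
      also have "e' * (S + S) \<le> e / 2" using e S0 by (simp add: e'_def field_simps)
      finally show ?thesis by simp
    qed
    have "(\<lambda>j. C * (nrm (\<lambda>p. U (p + a j) - U p))\<^sup>2) \<longlonglongrightarrow> C * 0\<^sup>2"
      using c by (intro tendsto_intros) (simp add: conv2_def)
    then obtain N where N: "\<And>j. j \<ge> N \<Longrightarrow> C * (nrm (\<lambda>p. U (p + a j) - U p))\<^sup>2 < e / 2"
      using LIMSEQ_D[of _ "C * 0\<^sup>2" "e / 2"] e C(1) by force
    show "\<exists>N. \<forall>j\<ge>N. norm ((nrm (\<lambda>p. nl (U (p + a j)) - nl (U p)))\<^sup>2 - 0) < e"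
    proof (intro exI[of _ N] allI impI)
      fix j assume "N \<le> j"
      then show "norm ((nrm (\<lambda>p. nl (U (p + a j)) - nl (U p)))\<^sup>2 - 0) < e"
        using bound[of j] N[of j] by simp
    qed
  qed
  then have "(\<lambda>j. sqrt ((nrm (\<lambda>p. nl (U (p + a j)) - nl (U p)))\<^sup>2)) \<longlonglongrightarrow> sqrt 0" by (rule tendsto_real_sqrt)
  then show "(\<lambda>j. nrm (\<lambda>p. nl (U (p + a j)) - nl (U p))) \<longlonglongrightarrow> 0" by simp
qed

section \<open>Difference quotients against weights\<close>

definition fdq :: "real \<times> real \<Rightarrow> real \<Rightarrow> fun2 \<Rightarrow> fun2" where
  "fdq d h c = (\<lambda>p. (c (p + h *\<^sub>R d) - c p) / h)"

text \<open>Mean value theorem; a quotient with negative step is one with positive step based at the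
  shifted point.\<close>

lemma fdq_bound:
  assumes c: "smooth2 c" and K: "\<And>p. \<bar>dd d c p\<bar> \<le> K" and h: "h \<noteq> 0"
  shows "\<bar>fdq d h c p\<bar> \<le> K"
proof -
  have pos: "\<bar>fdq d h c p\<bar> \<le> K" if h: "0 < h" for h p
  proof -
    have "\<exists>z. 0 < z \<and> z < h \<and> c (p + h *\<^sub>R d) - c (p + 0 *\<^sub>R d) = (h - 0) * dd d c (p + z *\<^sub>R d)"
      by (rule MVT2[OF h]) (rule smooth2_line_deriv[OF c])
    then obtain z where "c (p + h *\<^sub>R d) - c p = h * dd d c (p + z *\<^sub>R d)" by auto
    then have "fdq d h c p = dd d c (p + z *\<^sub>R d)" using h by (simp add: fdq_def)
    then show ?thesis using K by simp
  qed
  show ?thesis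
  proof (cases "0 < h")
    case True
    then show ?thesis by (rule pos)
  next
    case False
    then have "0 < - h" using h by simp
    moreover have "fdq d h c p = fdq d (- h) c (p + h *\<^sub>R d)"
      using h by (simp add: fdq_def field_simps)
    ultimately show ?thesis using pos by metis
  qed
qed

lemma fdq_tendsto:
  assumes c: "smooth2 c" and h: "\<And>j. h j \<noteq> 0" "h \<longlonglongrightarrow> (0::real)"
  shows "(\<lambda>j. fdq d (h j) c p) \<longlonglongrightarrow> dd d c p"
proof -
  have "((\<lambda>t. (c (p + (0 + t) *\<^sub>R d) - c (p + 0 *\<^sub>R d)) / t) \<longlongrightarrow> dd d c (p + 0 *\<^sub>R d)) (at 0)"
    using smooth2_line_deriv[OF c, of p d 0] unfolding DERIV_def .
  moreover have "filterlim h (at 0) sequentially" by (rule filterlim_atI[OF h(2)]) (simp add: h)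
  ultimately have "((\<lambda>j. (c (p + (0 + h j) *\<^sub>R d) - c (p + 0 *\<^sub>R d)) / h j) \<longlonglongrightarrow> dd d c (p + 0 *\<^sub>R d))"
    by (rule filterlim_compose)
  then show ?thesis by (simp add: fdq_def)
qed

lemma smooth2_measurable: "smooth2 c \<Longrightarrow> c \<in> borel_measurable borel"
  by (intro borel_measurable_continuous_onI smooth2_continuous)

lemma fdq_measurable: assumes "smooth2 c" shows "fdq d h c \<in> borel_measurable borel"
proof -
  have [measurable]: "c \<in> borel_measurable borel" "(\<lambda>p. c (p + h *\<^sub>R d)) \<in> borel_measurable borel"
    using assms by (intro smooth2_measurable smooth2_shift; assumption)+
  show ?thesis unfolding fdq_def by measurable
qed

lemma dd_measurable: "smooth2 c \<Longrightarrow> dd d c \<in> borel_measurable borel"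
  by (intro smooth2_measurable dd_smooth2)

lemma bounded_weight_tendsto:
  fixes G :: "'a::euclidean_space \<Rightarrow> real"
  assumes G: "integrable lborel G" and m: "\<And>j. c j \<in> borel_measurable borel" "c' \<in> borel_measurable borel"
    and b: "\<And>j p. \<bar>c j p\<bar> \<le> K" and l: "\<And>p. (\<lambda>j. c j p) \<longlonglongrightarrow> c' p"
  shows "(\<lambda>j. \<integral>p. c j p * G p \<partial>lborel) \<longlonglongrightarrow> (\<integral>p. c' p * G p \<partial>lborel)"
proof (rule integral_dominated_convergence)
  show "integrable lborel (\<lambda>p. K * \<bar>G p\<bar>)" using G by simp
  show "AE p in lborel. norm (c j p * G p) \<le> K * \<bar>G p\<bar>" for j
    using b by (simp add: abs_mult mult_right_mono)
  show "AE p in lborel. (\<lambda>j. c j p * G p) \<longlonglongrightarrow> c' p * G p"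
    using l by (intro AE_I2 tendsto_intros)
qed (use m borel_measurable_integrable[OF G] in measurable)

text \<open>The weights converge pointwise and boundedly but not uniformly, so dominated convergence
  is applied to the square of \<open>(c j p - c' p) * V p\<close>.\<close>

lemma conv2_weight:
  assumes V: "L2 V" and m: "\<And>j. c j \<in> borel_measurable borel" "c' \<in> borel_measurable borel"
    and b: "\<And>j p. \<bar>c j p\<bar> \<le> K" "\<And>p. \<bar>c' p\<bar> \<le> K" and l: "\<And>p. (\<lambda>j. c j p) \<longlonglongrightarrow> c' p"
  shows "conv2 (\<lambda>j p. c j p * V p) (\<lambda>p. c' p * V p)"
  unfolding conv2_def
proof (intro conjI allI)
  show "L2 (\<lambda>p. c j p * V p)" for j by (rule L2_bmult[OF V, of _ K]) (simp_all add: m b)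
  show "L2 (\<lambda>p. c' p * V p)" by (rule L2_bmult[OF V, of _ K]) (simp_all add: m b)
  have "(\<lambda>j. \<integral>p. (c j p - c' p)\<^sup>2 * (V p)\<^sup>2 \<partial>lborel) \<longlonglongrightarrow> (\<integral>p. 0 * (V p)\<^sup>2 \<partial>lborel)"
  proof (rule bounded_weight_tendsto[where c = "\<lambda>j p. (c j p - c' p)\<^sup>2" and K = "(K + K)\<^sup>2"])
    show "integrable lborel (\<lambda>p. (V p)\<^sup>2)" by (rule L2_integrable_sq[OF V])
    show "(\<lambda>p. (c j p - c' p)\<^sup>2) \<in> borel_measurable borel" for j using m by measurable
    show "\<bar>(c j p - c' p)\<^sup>2\<bar> \<le> (K + K)\<^sup>2" for j p
    proof -
      have "\<bar>c j p - c' p\<bar> \<le> K + K" using b(1)[of j p] b(2)[of p] by linarith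
      then have "\<bar>c j p - c' p\<bar>\<^sup>2 \<le> (K + K)\<^sup>2" by (intro power_mono) auto
      then show ?thesis by simp
    qed
    show "(\<lambda>j. (c j p - c' p)\<^sup>2) \<longlonglongrightarrow> 0" for p
      using tendsto_power[OF tendsto_diff[OF l[of p] tendsto_const[of "c' p"]], of 2] by simp
  qed simp
  then have "(\<lambda>j. (nrm (\<lambda>p. c j p * V p - c' p * V p))\<^sup>2) \<longlonglongrightarrow> 0"
    by (simp add: nrm_sq_integral power_mult_distrib flip: left_diff_distrib)
  from tendsto_real_sqrt[OF this] show "(\<lambda>j. nrm (\<lambda>p. c j p * V p - c' p * V p)) \<longlonglongrightarrow> 0" by simp
qed

lemma ip_weight_commute: "ip f (\<lambda>p. c p * g p) = ip (\<lambda>p. c p * f p) g"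
  by (simp add: ip_def mult.left_commute mult.assoc)

text \<open>The discrete counterpart of: the integral of c V V_d is -1/2 times that of c_d V^2. A
  translation turns the backward term into one with the same product V(p) V(p + h d), so the
  subtraction leaves only an increment of the smooth weight.\<close>

lemma cdq_antisym:
  assumes V: "L2 V" and c: "c \<in> borel_measurable borel" "\<And>p. \<bar>c p\<bar> \<le> K" and h: "0 < h"
  shows "ip V (\<lambda>p. c p * cdq d h V p) = - 1/2 * ip (\<lambda>p. fdq d h c p * V p) (\<lambda>p. V (p + h *\<^sub>R d))"
proof -
  let ?a = "h *\<^sub>R d"
  have cV: "L2 (\<lambda>p. c p * V p)" by (rule L2_bmult[OF V, of _ K]) (simp_all add: c)
  have cV': "L2 (\<lambda>p. c (p + ?a) * V p)"
    using c by (intro L2_bmult[OF V, of _ K]) (auto intro!: measurable_compose[OF _ c(1)] borel_measurable_add)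
  have "ip V (\<lambda>p. c p * cdq d h V p) = ip (\<lambda>p. c p * V p) (cdq d h V)" by (rule ip_weight_commute)
  also have "\<dots> = (ip (\<lambda>p. c p * V p) (\<lambda>p. V (p + ?a)) - ip (\<lambda>p. c p * V p) (\<lambda>p. V (p - ?a))) / (2 * h)"
    unfolding cdq_def by (simp add: ip_divide_right ip_diff_right cV V L2_shift L2_shift_minus)
  also have "ip (\<lambda>p. c p * V p) (\<lambda>p. V (p - ?a)) = ip (\<lambda>p. c (p + ?a) * V (p + ?a)) V"
    using ip_shift_move[OF cV V, of ?a] by simp
  also have "\<dots> = ip (\<lambda>p. c (p + ?a) * V p) (\<lambda>p. V (p + ?a))"
    by (simp add: ip_def mult.assoc mult.commute mult.left_commute)
  also have "(ip (\<lambda>p. c p * V p) (\<lambda>p. V (p + ?a)) - ip (\<lambda>p. c (p + ?a) * V p) (\<lambda>p. V (p + ?a))) / (2 * h)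
      = ip (\<lambda>p. c p * V p - c (p + ?a) * V p) (\<lambda>p. V (p + ?a)) / (2 * h)"
    by (simp add: ip_diff_left cV cV' V L2_shift)
  also have "(\<lambda>p. c p * V p - c (p + ?a) * V p) = (\<lambda>p. - h * (fdq d h c p * V p))"
    using h by (simp add: fdq_def fun_eq_iff field_simps)
  finally show ?thesis using h by (simp only: ip_cmult_left) (simp add: field_simps)
qed

lemma cdq_antisym_tendsto:
  assumes V: "L2 V" and Vs: "conv2 (\<lambda>j p. V (p + h j *\<^sub>R d)) V"
    and c: "smooth2 c" "\<And>p. \<bar>c p\<bar> \<le> K" "\<And>p. \<bar>dd d c p\<bar> \<le> K"
    and h: "\<And>j. 0 < h j" "h \<longlonglongrightarrow> 0"
  shows "(\<lambda>j. ip V (\<lambda>p. c p * cdq d (h j) V p)) \<longlonglongrightarrow> - 1/2 * ip V (\<lambda>p. dd d c p * V p)"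
proof -
  have h0: "h j \<noteq> 0" for j using h(1)[of j] by simp
  have "conv2 (\<lambda>j p. fdq d (h j) c p * V p) (\<lambda>p. dd d c p * V p)"
    by (rule conv2_weight[OF V fdq_measurable[OF c(1)] dd_measurable[OF c(1)] fdq_bound[OF c(1,3) h0] c(3) fdq_tendsto[OF c(1) h0 h(2)]])
  from conv2_ip[OF this Vs]
  have "(\<lambda>j. - 1/2 * ip (\<lambda>p. fdq d (h j) c p * V p) (\<lambda>p. V (p + h j *\<^sub>R d))) \<longlonglongrightarrow> - 1/2 * ip (\<lambda>p. dd d c p * V p) V"
    by (rule tendsto_mult_left)
  then show ?thesis
    by (simp add: cdq_antisym[OF V smooth2_measurable[OF c(1)] c(2) h(1)] ip_commute[of V])
qed

text \<open>Division by the step costs a factor 1/h, so an approximation error of size h^2 still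
  leaves h.\<close>

lemma cdq_perturb:
  assumes A: "L2 A" and V: "L2 V" and v: "\<And>j. L2 (v j)" "\<And>j. nrm (\<lambda>p. v j p - V p) \<le> (h j)\<^sup>2"
    and c: "c \<in> borel_measurable borel" "\<And>p. \<bar>c p\<bar> \<le> K" and h: "\<And>j. 0 < h j" "h \<longlonglongrightarrow> 0"
    and l: "(\<lambda>j. ip A (\<lambda>p. c p * cdq d (h j) V p)) \<longlonglongrightarrow> l"
  shows "(\<lambda>j. ip A (\<lambda>p. c p * cdq d (h j) (v j) p)) \<longlonglongrightarrow> l"
proof -
  have K: "0 \<le> K" using order_trans[OF abs_ge_zero c(2)] .
  have Lc: "L2 (\<lambda>p. c p * cdq d (h j) f p)" if "L2 f" for f j
    by (rule L2_bmult[OF cdq_L2[OF that], of _ K]) (simp_all add: c)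
  have "(\<lambda>j. ip A (\<lambda>p. c p * cdq d (h j) (v j) p) - ip A (\<lambda>p. c p * cdq d (h j) V p)) \<longlonglongrightarrow> 0"
  proof (rule tendsto_rabs_zero_cancel, rule tendsto_sandwich[of "\<lambda>n. 0"])
    have "\<bar>ip A (\<lambda>p. c p * cdq d (h j) (v j) p) - ip A (\<lambda>p. c p * cdq d (h j) V p)\<bar> \<le> nrm A * (K * h j)" for j
    proof -
      have L: "L2 (\<lambda>p. v j p - V p)" by (intro L2_diff v V)
      have "ip A (\<lambda>p. c p * cdq d (h j) (v j) p) - ip A (\<lambda>p. c p * cdq d (h j) V p)
          = ip A (\<lambda>p. c p * cdq d (h j) (\<lambda>p. v j p - V p) p)"
        using ip_diff_right[OF Lc[OF v(1)] Lc[OF V] A, of j j j] by (simp add: cdq_diff right_diff_distrib)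
      also have "\<bar>\<dots>\<bar> \<le> nrm A * nrm (\<lambda>p. c p * cdq d (h j) (\<lambda>p. v j p - V p) p)"
        by (rule ip_abs_le[OF A Lc[OF L]])
      also have "\<dots> \<le> nrm A * (K * nrm (cdq d (h j) (\<lambda>p. v j p - V p)))"
        by (intro mult_left_mono nrm_bmult_le cdq_L2 L) (simp_all add: c)
      also have "\<dots> \<le> nrm A * (K * h j)"
      proof (intro mult_left_mono K nrm_nonneg)
        have "nrm (cdq d (h j) (\<lambda>p. v j p - V p)) \<le> nrm (\<lambda>p. v j p - V p) / h j"
          by (rule nrm_cdq_L2_le[OF L h(1)])
        also have "\<dots> \<le> (h j)\<^sup>2 / h j" using h(1)[of j] by (intro divide_right_mono v) simp
        finally show "nrm (cdq d (h j) (\<lambda>p. v j p - V p)) \<le> h j" by (simp add: power2_eq_square)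
      qed
      finally show ?thesis .
    qed
    then show "\<forall>\<^sub>F j in sequentially. \<bar>ip A (\<lambda>p. c p * cdq d (h j) (v j) p) - ip A (\<lambda>p. c p * cdq d (h j) V p)\<bar> \<le> nrm A * (K * h j)" by simp
    show "(\<lambda>j. nrm A * (K * h j)) \<longlonglongrightarrow> 0"
      by (intro tendsto_mult_right_zero h)
  qed auto
  from tendsto_add[OF this l] show ?thesis by simp
qed

lemma cdq_integral_antisym:
  assumes G: "integrable lborel G" and c: "smooth2 c" "\<And>p. \<bar>c p\<bar> \<le> K"
  shows "(\<integral>p. c p * cdq d h G p \<partial>lborel) = - (\<integral>p. cdq d h c p * G p \<partial>lborel)"
proof -
  let ?a = "h *\<^sub>R d"
  have [measurable]: "G \<in> borel_measurable borel" using G by simp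
  have cs: "(\<lambda>p. c (p + b)) \<in> borel_measurable borel" for b by (intro smooth2_measurable smooth2_shift c)
  have i: "integrable lborel (\<lambda>p. c (p + b) * G (p + e))" for b e
  proof (rule Bochner_Integration.integrable_bound)
    show "integrable lborel (\<lambda>p. K * \<bar>G (p + e)\<bar>)" using integrable_shift[OF G] by simp
    show "(\<lambda>p. c (p + b) * G (p + e)) \<in> borel_measurable lborel"
      using cs[of b] borel_measurable_integrable[OF integrable_shift[OF G, of e]] by simp
    show "AE p in lborel. norm (c (p + b) * G (p + e)) \<le> norm (K * \<bar>G (p + e)\<bar>)"
      using c(2) order_trans[OF abs_ge_zero c(2)] by (simp add: abs_mult mult_right_mono)
  qed
  have s: "(\<integral>p. c p * G (p + b) \<partial>lborel) = (\<integral>p. c (p - b) * G p \<partial>lborel)" for b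
    using integral_shift[of "\<lambda>p. c (p - b) * G p" b] i[of "-b" 0] by simp
  have "(\<integral>p. c p * cdq d h G p \<partial>lborel) = ((\<integral>p. c p * G (p + ?a) \<partial>lborel) - (\<integral>p. c p * G (p - ?a) \<partial>lborel)) / (2 * h)"
    using i[of 0 ?a] i[of 0 "- ?a"] by (simp add: cdq_def right_diff_distrib)
  also have "\<dots> = ((\<integral>p. c (p - ?a) * G p \<partial>lborel) - (\<integral>p. c (p + ?a) * G p \<partial>lborel)) / (2 * h)"
    using s[of ?a] s[of "- ?a"] by simp
  also have "\<dots> = - (\<integral>p. cdq d h c p * G p \<partial>lborel)"
    using i[of ?a 0] i[of "- ?a" 0] by (simp add: cdq_def left_diff_distrib diff_divide_distrib)
  finally show ?thesis .
qed

lemma cdq_fdq: "cdq d h c p = (fdq d h c p + fdq d (- h) c p) / 2"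
  by (simp add: cdq_def fdq_def diff_divide_distrib add_divide_distrib)

text \<open>For the nonlinear term the Lipschitz bound on translates replaces the chain rule.\<close>

lemma cdq_nl_tendsto:
  assumes U: "L2 U" "integrable lborel (\<lambda>p. (U p)^6)"
    and Us: "\<And>s. s \<longlonglongrightarrow> 0 \<Longrightarrow> conv2 (\<lambda>j p. U (p + s j *\<^sub>R d)) U"
    and lip: "\<And>s. nrm (\<lambda>p. U (p + s *\<^sub>R d) - U p) \<le> \<bar>s\<bar> * C"
    and c: "smooth2 c" "\<And>p. \<bar>c p\<bar> \<le> K" "\<And>p. \<bar>dd d c p\<bar> \<le> K"
    and h: "\<And>j. 0 < h j" "h \<longlonglongrightarrow> 0"
  shows "(\<lambda>j. ip (\<lambda>p. nl (U p)) (\<lambda>p. c p * cdq d (h j) U p))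
     \<longlonglongrightarrow> - 3/10 * ip (\<lambda>p. nl (U p)) (\<lambda>p. dd d c p * U p)"
proof -
  define F where "F p = nl (U p)" for p
  define G where "G p = 3/10 * (F p * U p)" for p
  have K: "0 \<le> K" using order_trans[OF abs_ge_zero c(2)] .
  have F: "L2 F" unfolding F_def by (rule nl_L2[OF U])
  have G: "integrable lborel G" unfolding G_def by (intro integrable_mult_right L2_integrable_mult F U)
  have h0: "h j \<noteq> 0" for j using h(1)[of j] by simp
  have [measurable]: "c \<in> borel_measurable borel" by (rule smooth2_measurable[OF c(1)])
  \<comment> \<open>Remainder of expanding \<open>G\<close>, the primitive of the nonlinearity along
    \<open>U\<close>, to first order: it measures how far \<open>F\<close> times an increment of
    \<open>U\<close> is from an increment of \<open>G\<close>.\<close>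
  define r where "r s p = G (p + s *\<^sub>R d) - G p - F p * (U (p + s *\<^sub>R d) - U p)" for s p
  have ir: "integrable lborel (r s)" for s
    unfolding r_def by (intro Bochner_Integration.integrable_diff integrable_shift G L2_integrable_mult F L2_diff L2_shift U)
  have ic: "integrable lborel (\<lambda>p. c p * f p)" if "integrable lborel f" for f
  proof (rule Bochner_Integration.integrable_bound)
    show "integrable lborel (\<lambda>p. K * \<bar>f p\<bar>)" using that by simp
    show "(\<lambda>p. c p * f p) \<in> borel_measurable lborel" using borel_measurable_integrable[OF that] by simp
    show "AE p in lborel. norm (c p * f p) \<le> norm (K * \<bar>f p\<bar>)"
      using c(2) K by (simp add: abs_mult mult_right_mono)
  qed
  \<comment> \<open>By \<open>nl_remainder\<close> the remainder is bounded by the product of the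
    increments of \<open>F\<close> and \<open>U\<close>. The Lipschitz bound for \<open>U\<close>
    pays for the division by the step, and continuity of translations for \<open>F\<close> makes the
    rest tend to 0. Both signs of the step are needed for the central quotient.\<close>
  have rest: "(\<lambda>j. (\<integral>p. c p * r (s j) p \<partial>lborel) / (2 * h j)) \<longlonglongrightarrow> 0" if s: "\<And>j. \<bar>s j\<bar> = h j" for s
  proof (rule tendsto_rabs_zero_cancel, rule tendsto_sandwich[of "\<lambda>n. 0"])
    have s0: "s \<longlonglongrightarrow> 0" by (rule tendsto_rabs_zero_cancel) (simp add: s h)
    let ?b = "\<lambda>j. K * (nrm (\<lambda>p. F (p + s j *\<^sub>R d) - F p) * C) / 2"
    have "\<bar>(\<integral>p. c p * r (s j) p \<partial>lborel) / (2 * h j)\<bar> \<le> ?b j" for j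
    proof -
      let ?dF = "\<lambda>p. F (p + s j *\<^sub>R d) - F p" and ?dU = "\<lambda>p. U (p + s j *\<^sub>R d) - U p"
      have L: "L2 (\<lambda>p. \<bar>?dF p\<bar>)" "L2 (\<lambda>p. \<bar>?dU p\<bar>)"
        using L2_diff[OF L2_shift[OF F] F, of "s j *\<^sub>R d"] L2_diff[OF L2_shift[OF U(1)] U(1), of "s j *\<^sub>R d"]
        by (auto simp: L2_def)
      have "\<bar>\<integral>p. c p * r (s j) p \<partial>lborel\<bar> \<le> (\<integral>p. \<bar>c p * r (s j) p\<bar> \<partial>lborel)" by (rule integral_abs_bound)
      also have "\<dots> \<le> (\<integral>p. K * (\<bar>?dF p\<bar> * \<bar>?dU p\<bar>) \<partial>lborel)"
      proof (rule integral_mono)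
        show "integrable lborel (\<lambda>p. \<bar>c p * r (s j) p\<bar>)" using ic[OF ir] by simp
        show "integrable lborel (\<lambda>p. K * (\<bar>?dF p\<bar> * \<bar>?dU p\<bar>))"
          by (intro integrable_mult_right L2_integrable_mult L)
        show "\<bar>c p * r (s j) p\<bar> \<le> K * (\<bar>?dF p\<bar> * \<bar>?dU p\<bar>)" for p
          unfolding abs_mult r_def G_def F_def by (intro mult_mono c(2) nl_remainder K) simp
      qed
      also have "\<dots> = K * ip (\<lambda>p. \<bar>?dF p\<bar>) (\<lambda>p. \<bar>?dU p\<bar>)" by (simp add: ip_def)
      also have "\<dots> \<le> K * (nrm ?dF * nrm ?dU)"
        using ip_abs_le[OF L] K by (intro mult_left_mono) (simp_all add: nrm_def ip_def)
      also have "\<dots> \<le> K * (nrm ?dF * (h j * C))"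
        using lip[of "s j"] s[of j] K by (intro mult_left_mono) simp_all
      finally show ?thesis using h(1)[of j] by (simp add: abs_mult field_simps)
    qed
    then show "\<forall>\<^sub>F j in sequentially. \<bar>(\<integral>p. c p * r (s j) p \<partial>lborel) / (2 * h j)\<bar> \<le> ?b j" by simp
    have lim: "(\<lambda>j. nrm (\<lambda>p. F (p + s j *\<^sub>R d) - F p)) \<longlonglongrightarrow> 0"
      using nl_shift_conv2[OF Us[OF s0] U(2)] unfolding conv2_def F_def by blast
    have "?b \<longlonglongrightarrow> K * (0 * C) / 2" by (intro tendsto_intros lim) simp
    then show "?b \<longlonglongrightarrow> 0" by simp
  qed auto
  have eq: "ip F (\<lambda>p. c p * cdq d (h j) U p)
      = - (\<integral>p. cdq d (h j) c p * G p \<partial>lborel) - ((\<integral>p. c p * r (h j) p \<partial>lborel) / (2 * h j) - (\<integral>p. c p * r (- h j) p \<partial>lborel) / (2 * h j))" for j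
  proof -
    have "F p * (c p * cdq d (h j) U p) = c p * cdq d (h j) G p - (c p * r (h j) p / (2 * h j) - c p * r (- h j) p / (2 * h j))" for p
      using h0[of j] by (simp add: cdq_def r_def field_simps)
    then have "ip F (\<lambda>p. c p * cdq d (h j) U p)
        = (\<integral>p. c p * cdq d (h j) G p - (c p * r (h j) p / (2 * h j) - c p * r (- h j) p / (2 * h j)) \<partial>lborel)"
      by (simp add: ip_def)
    also have "\<dots> = (\<integral>p. c p * cdq d (h j) G p \<partial>lborel) - ((\<integral>p. c p * r (h j) p \<partial>lborel) / (2 * h j) - (\<integral>p. c p * r (- h j) p \<partial>lborel) / (2 * h j))"
    proof -
      have "integrable lborel (cdq d (h j) G)"
        using integrable_shift[OF G, of "h j *\<^sub>R d"] integrable_shift[OF G, of "- (h j *\<^sub>R d)"] by (simp add: cdq_def)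
      then show ?thesis using ic ir by simp
    qed
    finally show ?thesis by (simp add: cdq_integral_antisym[OF G c(1,2)])
  qed
  have "(\<lambda>j. \<integral>p. cdq d (h j) c p * G p \<partial>lborel) \<longlonglongrightarrow> (\<integral>p. dd d c p * G p \<partial>lborel)"
  proof (rule bounded_weight_tendsto[OF G _ dd_measurable[OF c(1)], where K = K])
    have h': "- h j \<noteq> 0" for j using h0[of j] by simp
    show "cdq d (h j) c \<in> borel_measurable borel" for j
      unfolding cdq_fdq[abs_def] using fdq_measurable[OF c(1)] by simp
    show "\<bar>cdq d (h j) c p\<bar> \<le> K" for j p
      using fdq_bound[OF c(1,3) h0[of j], of p] fdq_bound[OF c(1,3) h'[of j], of p] by (simp add: cdq_fdq)
    have "(\<lambda>j. (fdq d (h j) c p + fdq d (- h j) c p) / 2) \<longlonglongrightarrow> (dd d c p + dd d c p) / 2" for p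
      using h0 h' h(2) by (intro tendsto_intros fdq_tendsto c(1)) (auto intro!: tendsto_eq_intros)
    then show "(\<lambda>j. cdq d (h j) c p) \<longlonglongrightarrow> dd d c p" for p by (simp add: cdq_fdq)
  qed
  then have "(\<lambda>j. ip F (\<lambda>p. c p * cdq d (h j) U p)) \<longlonglongrightarrow> - (\<integral>p. dd d c p * G p \<partial>lborel) - (0 - 0)"
    unfolding eq using h(1) by (intro tendsto_diff tendsto_minus rest) (simp_all add: less_imp_le)
  moreover have "(\<lambda>p. dd d c p * G p) = (\<lambda>p. 3/10 * (F p * (dd d c p * U p)))"
    by (simp add: G_def fun_eq_iff)
  then have "- (\<integral>p. dd d c p * G p \<partial>lborel) = - 3/10 * ip F (\<lambda>p. dd d c p * U p)"
    by (simp add: ip_def)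
  ultimately show ?thesis by (simp add: F_def[abs_def])
qed

section \<open>Regularity and Pohozaev identities\<close>

locale weak_eq =
  fixes g :: "nat \<Rightarrow> fun2" and U Ux W :: fun2 and lam :: real
  assumes T: "trip g U Ux W"
    and weak: "k \<in> C0inf \<Longrightarrow>
      ip Ux (px (px k)) + ip W (py k) - lam * ip U (px k) - ip (\<lambda>p. nl (U p)) (px k) = 0"
begin

definition F :: fun2 where "F = (\<lambda>p. nl (U p))"

lemmas D = tripD[OF T]

lemma U6: "integrable lborel (\<lambda>p. (U p)^6)"
  by (rule sobolev_trip(1)[OF T])

lemma F_L2: "L2 F"
  unfolding F_def by (rule nl_L2[OF D(5) U6])

text \<open>Extends the equation by continuity, so that \<open>U\<close> and combinations of its
  translates become admissible.\<close>

lemma weak_trip: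
  assumes S: "trip k V Vx Z" shows "ip Ux Vx + ip W Z - lam * ip U V - ip F V = 0"
proof (rule LIMSEQ_unique)
  note E = tripD[OF S]
  show "(\<lambda>n. ip Ux (px (px (k n))) + ip W (py (k n)) - lam * ip U (px (k n)) - ip F (px (k n)))
      \<longlonglongrightarrow> ip Ux Vx + ip W Z - lam * ip U V - ip F V"
    by (intro tendsto_intros conv2_ip_right E D F_L2)
  show "(\<lambda>n. ip Ux (px (px (k n))) + ip W (py (k n)) - lam * ip U (px (k n)) - ip F (px (k n))) \<longlonglongrightarrow> 0"
    using weak[OF E(1)] by (simp add: F_def)
qed

lemma nehari: "ip Ux Ux + ip W W - lam * ip U U - ip F U = 0"
  by (rule weak_trip[OF T])

text \<open>Summation by parts, the discrete form of integrating f f'' to minus the integral of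
  f'^2.\<close>

lemma second_difference:
  assumes f: "L2 f"
  shows "ip f (\<lambda>p. (f (p + a) - f p) - (f p - f (p + - a))) = - (nrm (\<lambda>p. f (p + a) - f p))\<^sup>2"
proof -
  note L = f L2_shift[OF f, of a] L2_shift[OF f, of "- a"]
  have 1: "ip f (\<lambda>p. f (p + - a)) = ip f (\<lambda>p. f (p + a))"
    using ip_shift_move[OF f f, of a] by (simp add: ip_commute[of f])
  have "ip f (\<lambda>p. (f (p + a) - f p) - (f p - f (p + - a)))
      = ip f (\<lambda>p. f (p + a)) - ip f f - (ip f f - ip f (\<lambda>p. f (p + - a)))"
    using L by (simp only: ip_diff_right L2_diff)
  moreover have "(nrm (\<lambda>p. f (p + a) - f p))\<^sup>2 = ip f f - ip f (\<lambda>p. f (p + a)) - (ip f (\<lambda>p. f (p + a)) - ip f f)"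
    using L by (simp add: nrm_sq ip_diff_left ip_diff_right L2_diff ip_shift ip_commute[of "\<lambda>p. f (p + a)" f])
  ultimately show ?thesis using 1 by simp
qed

text \<open>The bound for the norm of w_x: under the root are the contributions of the
  \<open>lam\<close> term and of the nonlinearity to the square of nrm (\<delta> W) / h in the next
  estimates.\<close>

definition regC :: real where
  "regC = sqrt (\<bar>lam\<bar> * (nrm Ux)\<^sup>2 + (nrm F)\<^sup>2)"

lemma U_x_increment: "nrm (\<lambda>p. U (p + h *\<^sub>R (1, 0)) - U p) \<le> \<bar>h\<bar> * nrm Ux"
  by (rule nrm_increment_limit[of "\<lambda>n. px (g n)"]) (simp_all add: dd_coordinate D C0inf_px)

text \<open>Testing with the second x-difference V of \<open>U\<close> gives the squared norms of
  \<delta> Ux and \<delta> W on one side. The \<open>lam\<close> term is of order h^2 because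
  \<open>Ux\<close> is in L2. In the nonlinear term V has norm at most h times that of \<delta> Ux,
  which the left side can absorb since \<open>F\<close> is in L2.\<close>

lemma W_x_increment:
  assumes h: "0 < h" shows "nrm (\<lambda>p. W (p + (h, 0)) - W p) \<le> h * regC"
proof -
  let ?a = "(h, 0) :: real \<times> real"
  define \<delta> where "\<delta> f = (\<lambda>p. f (p + ?a) - f p)" for f :: fun2
  define V where "V = (\<lambda>p. (U (p + ?a) - U p) - (U p - U (p + - ?a)))"
  have S: "trip (\<lambda>n p. g n (p + ?a) - g n p) (\<delta> U) (\<delta> Ux) (\<delta> W)"
    unfolding \<delta>_def by (rule trip_diff[OF trip_shift[OF T] T])
  note E = tripD[OF S]
  have "ip Ux (\<lambda>p. (Ux (p + ?a) - Ux p) - (Ux p - Ux (p + - ?a)))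
      + ip W (\<lambda>p. (W (p + ?a) - W p) - (W p - W (p + - ?a))) - lam * ip U V - ip F V = 0"
    unfolding V_def by (rule weak_trip[OF trip_diff[OF trip_diff[OF trip_shift[OF T] T] trip_diff[OF T trip_shift[OF T]]]])
  then have "- (nrm (\<delta> Ux))\<^sup>2 + - (nrm (\<delta> W))\<^sup>2 - lam * - (nrm (\<delta> U))\<^sup>2 - ip F V = 0"
    unfolding V_def \<delta>_def by (simp only: second_difference[OF D(5)] second_difference[OF D(6)] second_difference[OF D(7)])
  then have main: "(nrm (\<delta> Ux))\<^sup>2 + (nrm (\<delta> W))\<^sup>2 = lam * (nrm (\<delta> U))\<^sup>2 - ip F V" by simp
  \<comment> \<open>Read as a first difference of \<delta> U, \<open>V\<close> gains a factor h
    against \<delta> Ux.\<close>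
  have V: "V = (\<lambda>p. - (\<delta> U (p + (- h) *\<^sub>R (1, 0)) - \<delta> U p))"
    by (simp add: V_def \<delta>_def fun_eq_iff add.assoc flip: zero_prod_def)
  have nV: "nrm V \<le> h * nrm (\<delta> Ux)"
  proof -
    have "nrm (\<lambda>p. \<delta> U (p + (- h) *\<^sub>R (1, 0)) - \<delta> U p) \<le> \<bar>- h\<bar> * nrm (\<delta> Ux)"
      by (rule nrm_increment_limit[of "\<lambda>n. px (\<lambda>p. g n (p + ?a) - g n p)"])
        (unfold dd_coordinate, intro C0inf_px E, rule E, rule E)
    then show ?thesis unfolding V nrm_uminus using h by simp
  qed
  have LV: "L2 V" unfolding V by (intro L2_uminus L2_diff L2_shift E)
  have dU: "nrm (\<delta> U) \<le> h * nrm Ux"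
    using U_x_increment[of h] h by (simp add: \<delta>_def)
  have "(nrm (\<delta> W))\<^sup>2 \<le> \<bar>lam\<bar> * (h * nrm Ux)\<^sup>2 + nrm F * (h * nrm (\<delta> Ux)) - (nrm (\<delta> Ux))\<^sup>2"
  proof -
    have "lam * (nrm (\<delta> U))\<^sup>2 \<le> \<bar>lam\<bar> * (nrm (\<delta> U))\<^sup>2" by (intro mult_right_mono) auto
    also have "\<dots> \<le> \<bar>lam\<bar> * (h * nrm Ux)\<^sup>2" using dU by (intro mult_left_mono power_mono) auto
    finally have 1: "lam * (nrm (\<delta> U))\<^sup>2 \<le> \<bar>lam\<bar> * (h * nrm Ux)\<^sup>2" .
    have "- ip F V \<le> nrm F * nrm V" using ip_abs_le[OF F_L2 LV] by linarith
    also have "\<dots> \<le> nrm F * (h * nrm (\<delta> Ux))" by (intro mult_left_mono nV) simp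
    finally show ?thesis using 1 main by linarith
  qed
  \<comment> \<open>Young's inequality absorbs the mixed term into the negative square.\<close>
  also have "\<dots> \<le> \<bar>lam\<bar> * (h * nrm Ux)\<^sup>2 + (h * nrm F)\<^sup>2"
  proof -
    have "nrm F * (h * nrm (\<delta> Ux)) = h * nrm F * nrm (\<delta> Ux)" by simp
    then show ?thesis
      using sum_squares_bound[of "h * nrm F" "nrm (\<delta> Ux)"]
        zero_le_power2[of "h * nrm F"] zero_le_power2[of "nrm (\<delta> Ux)"] by linarith
  qed
  also have "\<dots> = (h * regC)\<^sup>2"
    by (simp add: regC_def power_mult_distrib algebra_simps)
  finally have "(nrm (\<delta> W))\<^sup>2 \<le> (h * regC)\<^sup>2" .
  then show ?thesis
    unfolding \<delta>_def by (rule power2_le_imp_le) (use h in \<open>simp add: regC_def\<close>)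
qed

text \<open>Here \<open>u_y = w_x\<close> enters: the \<open>x\<close>-difference quotient of the potential approximates \<open>u\<close>,
  and its \<open>y\<close>-derivative is the \<open>x\<close>-difference quotient of \<open>w\<close>.\<close>

lemma U_y_increment: "nrm (\<lambda>p. U (p + k *\<^sub>R (0, 1)) - U p) \<le> \<bar>k\<bar> * regC"
proof -
  let ?b = "k *\<^sub>R (0, 1) :: real \<times> real"
  \<comment> \<open>The x-step \<open>h\<close> is auxiliary: with \<open>k\<close> fixed it is sent
    to 0 at the end, which removes the error of replacing u by a difference quotient of the
    potential.\<close>
  have le: "nrm (\<lambda>p. U (p + ?b) - U p) \<le> \<bar>k\<bar> * regC + h * (2 * nrm Ux)" if h: "0 < h" for h
  proof -
    let ?a = "(h, 0) :: real \<times> real"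
    have "nrm (\<lambda>p. U (p + ?b) - U p) \<le> \<bar>k\<bar> * (nrm (\<lambda>p. W (p + ?a) - W p) / h) + 2 * (h * nrm Ux)"
    proof (rule LIMSEQ_le)
      show "(\<lambda>n. nrm (\<lambda>p. px (g n) (p + ?b) - px (g n) p)) \<longlonglongrightarrow> nrm (\<lambda>p. U (p + ?b) - U p)"
        by (intro conv2_nrm conv2_diff conv2_shift D)
      show "(\<lambda>n. \<bar>k\<bar> * (nrm (\<lambda>p. py (g n) (p + ?a) - py (g n) p) / h) + 2 * (h * nrm (px (px (g n)))))
          \<longlonglongrightarrow> \<bar>k\<bar> * (nrm (\<lambda>p. W (p + ?a) - W p) / h) + 2 * (h * nrm Ux)"
        using h by (intro tendsto_intros conv2_nrm conv2_diff conv2_shift D) simp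
      have "nrm (\<lambda>p. px (g n) (p + ?b) - px (g n) p)
          \<le> \<bar>k\<bar> * (nrm (\<lambda>p. py (g n) (p + ?a) - py (g n) p) / h) + 2 * (h * nrm (px (px (g n))))" for n
      proof -
        define u where "u = px (g n)"
        define q where "q = (\<lambda>p. (g n (p + ?a) - g n p) / h)"
        have u: "u \<in> C0inf" and q: "q \<in> C0inf"
          unfolding u_def q_def by (intro C0inf_px C0inf_divide C0inf_diff C0inf_shift D)+
        have "(\<lambda>p. u p - q p) = (\<lambda>p. - ((g n (p + h *\<^sub>R (1, 0)) - g n p - h * u p) / h))"
          using h by (simp add: q_def fun_eq_iff field_simps)
        then have "nrm (\<lambda>p. u p - q p) = nrm (\<lambda>p. g n (p + h *\<^sub>R (1, 0)) - g n p - h * u p) / h"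
          using h by (simp only: nrm_uminus nrm_divide)
        also have "\<dots> \<le> (h * (h * nrm (px u))) / h"
          using nrm_increment2[OF D(1)[of n], of h "(1, 0)"] h
          by (intro divide_right_mono) (simp_all add: dd_coordinate u_def)
        finally have uq: "nrm (\<lambda>p. u p - q p) \<le> h * nrm (px u)" using h by simp
        have "py (\<lambda>p. inverse h * (g n (p + ?a) - g n p)) = (\<lambda>p. inverse h * (py (g n) (p + ?a) - py (g n) p))"
          by (simp only: smooth2_py_cmult smooth2_py_diff smooth2_py_shift smooth2_shift smooth2_diff C0inf_smooth2[OF D(1)])
        then have pyq: "py q = (\<lambda>p. (py (g n) (p + ?a) - py (g n) p) / h)"
          by (simp only: q_def divide_inverse mult.commute[of _ "inverse h"])
        have Lu: "L2 u" "L2 (\<lambda>p. u (p + ?b))" "L2 q" "L2 (\<lambda>p. q (p + ?b))"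
          by (intro L2_shift C0inf_L2 u q)+
        have 1: "nrm (\<lambda>p. q (p + ?b) - q p) \<le> \<bar>k\<bar> * (nrm (\<lambda>p. py (g n) (p + ?a) - py (g n) p) / h)"
          using nrm_increment[OF q, of k "(0, 1)"] h by (simp only: dd_coordinate pyq nrm_divide)
        have 2: "nrm (\<lambda>p. u (p + ?b) - q (p + ?b)) = nrm (\<lambda>p. u p - q p)"
          using nrm_shift[OF L2_diff[OF Lu(1,3)], of ?b] by simp
        show ?thesis
          using nrm_triangle_trans[OF Lu(2,4,1)] nrm_triangle_trans[OF Lu(4,3,1)] 1 2 uq nrm_minus_commute[of u q]
          unfolding u_def[symmetric] by linarith
      qed
      then show "\<exists>N. \<forall>n\<ge>N. nrm (\<lambda>p. px (g n) (p + ?b) - px (g n) p)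
          \<le> \<bar>k\<bar> * (nrm (\<lambda>p. py (g n) (p + ?a) - py (g n) p) / h) + 2 * (h * nrm (px (px (g n))))" by blast
    qed
    also have "\<dots> \<le> \<bar>k\<bar> * regC + 2 * (h * nrm Ux)"
      using W_x_increment[OF h] h by (intro add_right_mono mult_left_mono) (simp_all add: field_simps)
    finally show ?thesis by simp
  qed
  show ?thesis
  proof (rule LIMSEQ_le_const)
    have "(\<lambda>n. \<bar>k\<bar> * regC + inverse (real (Suc n)) * (2 * nrm Ux)) \<longlonglongrightarrow> \<bar>k\<bar> * regC + 0 * (2 * nrm Ux)"
      by (intro tendsto_intros LIMSEQ_inverse_real_of_nat)
    then show "(\<lambda>n. \<bar>k\<bar> * regC + inverse (real (Suc n)) * (2 * nrm Ux)) \<longlonglongrightarrow> \<bar>k\<bar> * regC" by simp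
    show "\<exists>N. \<forall>n\<ge>N. nrm (\<lambda>p. U (p + ?b) - U p) \<le> \<bar>k\<bar> * regC + inverse (real (Suc n)) * (2 * nrm Ux)"
      using le by (intro exI[of _ 0] allI impI) simp
  qed
qed

section \<open>Pohozaev identities\<close>

definition h :: "nat \<Rightarrow> real" where "h j = inverse (real (Suc j))"

lemma h_pos: "0 < h j"
  by (simp add: h_def)

lemma h_lim: "h \<longlonglongrightarrow> 0"
  unfolding h_def by (rule LIMSEQ_inverse_real_of_nat)

text \<open>Approximants good enough to survive division by the increment \<open>h j\<close>.\<close>

lemma approx_rate:
  obtains G where "trip G U Ux W"
    "\<And>j. nrm (\<lambda>p. px (G j) p - U p) \<le> (h j)\<^sup>2"
    "\<And>j. nrm (\<lambda>p. px (px (G j)) p - Ux p) \<le> (h j)\<^sup>2"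
    "\<And>j. nrm (\<lambda>p. py (G j) p - W p) \<le> (h j)\<^sup>2"
proof -
  have "\<exists>n. nrm (\<lambda>p. px (g n) p - U p) \<le> (h j)\<^sup>2 \<and> nrm (\<lambda>p. px (px (g n)) p - Ux p) \<le> (h j)\<^sup>2
      \<and> nrm (\<lambda>p. py (g n) p - W p) \<le> (h j)\<^sup>2" for j
  proof -
    have e: "0 < (h j)\<^sup>2" using h_pos[of j] by simp
    obtain N1 N2 N3 where "\<forall>n\<ge>N1. nrm (\<lambda>p. px (g n) p - U p) < (h j)\<^sup>2"
      "\<forall>n\<ge>N2. nrm (\<lambda>p. px (px (g n)) p - Ux p) < (h j)\<^sup>2" "\<forall>n\<ge>N3. nrm (\<lambda>p. py (g n) p - W p) < (h j)\<^sup>2"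
      using conv2D[OF D(2) e] conv2D[OF D(3) e] conv2D[OF D(4) e] by blast
    then show ?thesis by (intro exI[of _ "max N1 (max N2 N3)"]) (simp add: less_imp_le)
  qed
  then obtain n where n: "\<And>j. nrm (\<lambda>p. px (g (n j)) p - U p) \<le> (h j)\<^sup>2"
    "\<And>j. nrm (\<lambda>p. px (px (g (n j))) p - Ux p) \<le> (h j)\<^sup>2" "\<And>j. nrm (\<lambda>p. py (g (n j)) p - W p) \<le> (h j)\<^sup>2"
    by metis
  have h2: "(\<lambda>j. (h j)\<^sup>2) \<longlonglongrightarrow> 0" using tendsto_power[OF h_lim, of 2] by simp
  have "trip (\<lambda>j. g (n j)) U Ux W"
    unfolding trip_def using conv2I_le[OF _ _ n(1) h2] conv2I_le[OF _ _ n(2) h2] conv2I_le[OF _ _ n(3) h2] D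
    by (simp add: C0inf_L2 C0inf_px C0inf_py)
  then show ?thesis using n by (rule that)
qed

lemma shifts:
  assumes "s \<longlonglongrightarrow> 0"
  shows "conv2 (\<lambda>j p. U (p + s j *\<^sub>R d)) U" "conv2 (\<lambda>j p. Ux (p + s j *\<^sub>R d)) Ux" "conv2 (\<lambda>j p. W (p + s j *\<^sub>R d)) W"
  by (rule shift_conv2[OF _ D(2) assms] shift_conv2[OF _ D(3) assms] shift_conv2[OF _ D(4) assms];
      intro C0inf_px C0inf_py D)+

text \<open>One discrete integration by parts for each term of the equation. The coefficients 1/2
  and 3/10 are the reciprocals of the homogeneities 2 and 10/3. The bound \<open>lip\<close> enters
  through the nonlinear term.\<close>

lemma cdq_limits:
  assumes G: "\<And>j. G j \<in> C0inf"
    and r: "\<And>j. nrm (\<lambda>p. px (G j) p - U p) \<le> (h j)\<^sup>2" "\<And>j. nrm (\<lambda>p. px (px (G j)) p - Ux p) \<le> (h j)\<^sup>2"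
    "\<And>j. nrm (\<lambda>p. py (G j) p - W p) \<le> (h j)\<^sup>2"
    and lip: "\<And>s. nrm (\<lambda>p. U (p + s *\<^sub>R d) - U p) \<le> \<bar>s\<bar> * C"
    and c: "smooth2 c" "\<And>p. \<bar>c p\<bar> \<le> K" "\<And>p. \<bar>dd d c p\<bar> \<le> K"
  shows "(\<lambda>j. ip Ux (\<lambda>p. c p * cdq d (h j) (px (px (G j))) p)) \<longlonglongrightarrow> - 1/2 * ip Ux (\<lambda>p. dd d c p * Ux p)" (is ?A)
    and "(\<lambda>j. ip W (\<lambda>p. c p * cdq d (h j) (py (G j)) p)) \<longlonglongrightarrow> - 1/2 * ip W (\<lambda>p. dd d c p * W p)" (is ?B)
    and "(\<lambda>j. ip U (\<lambda>p. c p * cdq d (h j) (px (G j)) p)) \<longlonglongrightarrow> - 1/2 * ip U (\<lambda>p. dd d c p * U p)" (is ?C)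
    and "(\<lambda>j. ip F (\<lambda>p. c p * cdq d (h j) (px (G j)) p)) \<longlonglongrightarrow> - 3/10 * ip F (\<lambda>p. dd d c p * U p)" (is ?D)
proof -
  have L: "L2 (px (G j))" "L2 (px (px (G j)))" "L2 (py (G j))" for j
    by (intro C0inf_L2 C0inf_px C0inf_py G)+
  note pert = cdq_perturb[OF _ _ _ _ smooth2_measurable[OF c(1)] c(2) h_pos h_lim]
  note lim = cdq_antisym_tendsto[OF _ _ c h_pos h_lim]
  show ?A
    by (rule pert[OF D(6) D(6) L(2) r(2) lim[OF D(6) shifts(2)[OF h_lim]]])
  show ?B
    by (rule pert[OF D(7) D(7) L(3) r(3) lim[OF D(7) shifts(3)[OF h_lim]]])
  show ?C
    by (rule pert[OF D(5) D(5) L(1) r(1) lim[OF D(5) shifts(1)[OF h_lim]]])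
  show ?D
    by (rule pert[OF F_L2 D(5) L(1) r(1)])
      (unfold F_def, rule cdq_nl_tendsto[OF D(5) U6 shifts(1) lip c h_pos h_lim])
qed

text \<open>The test function is (c Q)_x with c depending on y alone and Q tending to
  \<open>W\<close>, a substitute for c u_y. Its potential c Q has y-derivative c Q_y + c_y Q, and
  the extra term turns the coefficient -1/2 of the \<open>W\<close> integral into 1/2.\<close>

lemma pohozaev_y_weighted:
  assumes c: "smooth2 c" "px c = (\<lambda>p. 0)" "\<And>p. \<bar>c p\<bar> \<le> K" "\<And>p. \<bar>py c p\<bar> \<le> K"
  shows "- 1/2 * ip Ux (\<lambda>p. py c p * Ux p) + 1/2 * ip W (\<lambda>p. py c p * W p)
    + lam / 2 * ip U (\<lambda>p. py c p * U p) + 3/10 * ip F (\<lambda>p. py c p * U p) = 0"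
proof -
  let ?d = "(0, 1) :: real \<times> real"
  obtain G where G: "trip G U Ux W" and r:
    "\<And>j. nrm (\<lambda>p. px (G j) p - U p) \<le> (h j)\<^sup>2" "\<And>j. nrm (\<lambda>p. px (px (G j)) p - Ux p) \<le> (h j)\<^sup>2"
    "\<And>j. nrm (\<lambda>p. py (G j) p - W p) \<le> (h j)\<^sup>2"
    using approx_rate by blast
  note E = tripD[OF G]
  define Q where "Q j = cdq ?d (h j) (G j)" for j
  have Q: "Q j \<in> C0inf" for j unfolding Q_def by (intro cdq_C0inf E)
  have c': "\<And>p. \<bar>dd ?d c p\<bar> \<le> K" using c(4) by (simp add: dd_coordinate)
  have cm: "c \<in> borel_measurable borel" "py c \<in> borel_measurable borel"
    by (intro smooth2_measurable smooth2_py c)+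
  have QW: "conv2 Q W"
    unfolding Q_def by (rule cdq_conv2[OF E(1) _ h_pos h_lim]) (simp add: dd_coordinate E)
  let ?S = "\<lambda>j. ip Ux (\<lambda>p. c p * cdq ?d (h j) (px (px (G j))) p)
      + (ip W (\<lambda>p. c p * cdq ?d (h j) (py (G j)) p) + ip W (\<lambda>p. py c p * Q j p))
      - lam * ip U (\<lambda>p. c p * cdq ?d (h j) (px (G j)) p) - ip F (\<lambda>p. c p * cdq ?d (h j) (px (G j)) p)"
  let ?L = "- 1/2 * ip Ux (\<lambda>p. dd ?d c p * Ux p)
      + (- 1/2 * ip W (\<lambda>p. dd ?d c p * W p) + ip W (\<lambda>p. py c p * W p))
      - lam * (- 1/2 * ip U (\<lambda>p. dd ?d c p * U p)) - (- 3/10 * ip F (\<lambda>p. dd ?d c p * U p))"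
  have eq: "?S j = 0" for j
  proof -
    have Qs: "smooth2 (Q j)" by (rule C0inf_smooth2[OF Q])
    have 1: "px (\<lambda>p. c p * Q j p) = (\<lambda>p. c p * px (Q j) p)"
      by (simp add: smooth2_px_mult c Qs)
    have 2: "px (\<lambda>p. c p * px (Q j) p) = (\<lambda>p. c p * px (px (Q j)) p)"
      by (simp add: smooth2_px_mult c Qs smooth2_px)
    have 3: "py (\<lambda>p. c p * Q j p) = (\<lambda>p. c p * py (Q j) p + py c p * Q j p)"
      by (simp add: smooth2_py_mult c Qs)
    have L: "L2 (\<lambda>p. c p * py (Q j) p)" "L2 (\<lambda>p. py c p * Q j p)"
      by (intro C0inf_L2 C0inf_mult_left C0inf_py smooth2_py Q c)+
    have "ip Ux (\<lambda>p. c p * px (px (Q j)) p) + ip W (\<lambda>p. c p * py (Q j) p + py c p * Q j p)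
      - lam * ip U (\<lambda>p. c p * px (Q j) p) - ip F (\<lambda>p. c p * px (Q j) p) = 0"
      using weak[OF C0inf_mult_left[OF c(1) Q[of j]]] unfolding 1 2 3 F_def .
    then show ?thesis
      using L by (simp add: ip_add_right D(7)) (simp add: Q_def px_cdq py_cdq E C0inf_px)
  qed
  have "?S \<longlonglongrightarrow> ?L"
  proof (intro tendsto_diff tendsto_add tendsto_mult_left
      cdq_limits[OF E(1) r U_y_increment c(1,3) c'])
    show "(\<lambda>j. ip W (\<lambda>p. py c p * Q j p)) \<longlonglongrightarrow> ip W (\<lambda>p. py c p * W p)"
      by (intro conv2_ip_right conv2_bmult[OF QW _ c(4)] D) (simp add: cm)
  qed
  then have "?L = 0"
    unfolding eq by (simp only: LIMSEQ_const_iff)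
  then show ?thesis by (simp add: dd_coordinate algebra_simps)
qed

text \<open>The test function is (c Q)_x with c depending on x alone and Q tending to
  \<open>U\<close>. The product rule adds 2 c_x Q_x + c_xx Q to the second x-derivative and c_x Q to
  the first, which accounts for 3/2 = 2 - 1/2, for lam/2 and for 7/10 = 1 - 3/10.\<close>

lemma pohozaev_x_weighted:
  assumes c: "smooth2 c" "py c = (\<lambda>p. 0)" "\<And>p. \<bar>c p\<bar> \<le> K" "\<And>p. \<bar>px c p\<bar> \<le> K" "\<And>p. \<bar>px (px c) p\<bar> \<le> K"
  shows "ip Ux (\<lambda>p. px (px c) p * U p) + 3/2 * ip Ux (\<lambda>p. px c p * Ux p) - 1/2 * ip W (\<lambda>p. px c p * W p)
    - lam / 2 * ip U (\<lambda>p. px c p * U p) - 7/10 * ip F (\<lambda>p. px c p * U p) = 0"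
proof -
  let ?d = "(1, 0) :: real \<times> real"
  obtain G where G: "trip G U Ux W" and r:
    "\<And>j. nrm (\<lambda>p. px (G j) p - U p) \<le> (h j)\<^sup>2" "\<And>j. nrm (\<lambda>p. px (px (G j)) p - Ux p) \<le> (h j)\<^sup>2"
    "\<And>j. nrm (\<lambda>p. py (G j) p - W p) \<le> (h j)\<^sup>2"
    using approx_rate by blast
  note E = tripD[OF G]
  define Q where "Q j = cdq ?d (h j) (G j)" for j
  have Q: "Q j \<in> C0inf" for j unfolding Q_def by (intro cdq_C0inf E)
  have pxQ: "px (Q j) = cdq ?d (h j) (px (G j))" for j by (simp add: Q_def px_cdq E)
  have c': "\<And>p. \<bar>dd ?d c p\<bar> \<le> K" using c(4) by (simp add: dd_coordinate)
  have cm: "c \<in> borel_measurable borel" "px c \<in> borel_measurable borel" "px (px c) \<in> borel_measurable borel"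
    by (intro smooth2_measurable smooth2_px c)+
  have QU: "conv2 Q U"
    unfolding Q_def by (rule cdq_conv2[OF E(1) _ h_pos h_lim]) (simp add: dd_coordinate E)
  have QUx: "conv2 (\<lambda>j. px (Q j)) Ux"
    unfolding pxQ by (rule cdq_conv2[OF C0inf_px[OF E(1)] _ h_pos h_lim]) (simp add: dd_coordinate E)
  let ?S = "\<lambda>j. (ip Ux (\<lambda>p. c p * cdq ?d (h j) (px (px (G j))) p) + 2 * ip Ux (\<lambda>p. px c p * px (Q j) p) + ip Ux (\<lambda>p. px (px c) p * Q j p))
      + ip W (\<lambda>p. c p * cdq ?d (h j) (py (G j)) p)
      - lam * (ip U (\<lambda>p. c p * cdq ?d (h j) (px (G j)) p) + ip U (\<lambda>p. px c p * Q j p))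
      - (ip F (\<lambda>p. c p * cdq ?d (h j) (px (G j)) p) + ip F (\<lambda>p. px c p * Q j p))"
  let ?L = "(- 1/2 * ip Ux (\<lambda>p. dd ?d c p * Ux p) + 2 * ip Ux (\<lambda>p. px c p * Ux p) + ip Ux (\<lambda>p. px (px c) p * U p))
      + - 1/2 * ip W (\<lambda>p. dd ?d c p * W p)
      - lam * (- 1/2 * ip U (\<lambda>p. dd ?d c p * U p) + ip U (\<lambda>p. px c p * U p))
      - (- 3/10 * ip F (\<lambda>p. dd ?d c p * U p) + ip F (\<lambda>p. px c p * U p))"
  have eq: "?S j = 0" for j
  proof -
    have Qs: "smooth2 (Q j)" "smooth2 (px (Q j))" by (intro C0inf_smooth2 C0inf_px Q)+
    have cs: "smooth2 (px c)" by (intro smooth2_px c)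
    have 1: "px (\<lambda>p. c p * Q j p) = (\<lambda>p. c p * px (Q j) p + px c p * Q j p)"
      by (simp add: smooth2_px_mult c Qs)
    have 2: "px (\<lambda>p. c p * px (Q j) p + px c p * Q j p)
        = (\<lambda>p. c p * px (px (Q j)) p + 2 * (px c p * px (Q j) p) + px (px c) p * Q j p)"
      by (simp add: smooth2_px_add smooth2_px_mult smooth2_mult c(1) cs Qs fun_eq_iff)
    have 3: "py (\<lambda>p. c p * Q j p) = (\<lambda>p. c p * py (Q j) p)"
      by (simp add: smooth2_py_mult c Qs)
    have L: "L2 (\<lambda>p. c p * px (px (Q j)) p)" "L2 (\<lambda>p. px c p * px (Q j) p)" "L2 (\<lambda>p. px (px c) p * Q j p)"
      "L2 (\<lambda>p. c p * px (Q j) p)" "L2 (\<lambda>p. px c p * Q j p)"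
      by (intro C0inf_L2 C0inf_mult_left C0inf_px smooth2_px Q c)+
    have "ip Ux (\<lambda>p. c p * px (px (Q j)) p + 2 * (px c p * px (Q j) p) + px (px c) p * Q j p) + ip W (\<lambda>p. c p * py (Q j) p)
      - lam * ip U (\<lambda>p. c p * px (Q j) p + px c p * Q j p) - ip F (\<lambda>p. c p * px (Q j) p + px c p * Q j p) = 0"
      using weak[OF C0inf_mult_left[OF c(1) Q[of j]]] unfolding 1 2 3 F_def .
    then have "(ip Ux (\<lambda>p. c p * px (px (Q j)) p) + 2 * ip Ux (\<lambda>p. px c p * px (Q j) p) + ip Ux (\<lambda>p. px (px c) p * Q j p))
      + ip W (\<lambda>p. c p * py (Q j) p)
      - lam * (ip U (\<lambda>p. c p * px (Q j) p) + ip U (\<lambda>p. px c p * Q j p))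
      - (ip F (\<lambda>p. c p * px (Q j) p) + ip F (\<lambda>p. px c p * Q j p)) = 0"
      using L by (simp only: ip_add_right D F_L2 L2_add L2_cmult ip_cmult_right)
    moreover have "px (px (Q j)) = cdq ?d (h j) (px (px (G j)))" "py (Q j) = cdq ?d (h j) (py (G j))"
      by (simp_all add: Q_def px_cdq py_cdq E C0inf_px)
    ultimately show ?thesis by (simp only: pxQ)
  qed
  have "?S \<longlonglongrightarrow> ?L"
  proof (intro tendsto_diff tendsto_add tendsto_mult_left
      cdq_limits[OF E(1) r U_x_increment c(1,3) c'])
    show "(\<lambda>j. ip Ux (\<lambda>p. px c p * px (Q j) p)) \<longlonglongrightarrow> ip Ux (\<lambda>p. px c p * Ux p)"
      by (intro conv2_ip_right conv2_bmult[OF QUx _ c(4)] D) (simp add: cm)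
    show "(\<lambda>j. ip Ux (\<lambda>p. px (px c) p * Q j p)) \<longlonglongrightarrow> ip Ux (\<lambda>p. px (px c) p * U p)"
      by (intro conv2_ip_right conv2_bmult[OF QU _ c(5)] D) (simp add: cm)
    show "(\<lambda>j. ip U (\<lambda>p. px c p * Q j p)) \<longlonglongrightarrow> ip U (\<lambda>p. px c p * U p)"
      by (intro conv2_ip_right conv2_bmult[OF QU _ c(4)] D) (simp add: cm)
    show "(\<lambda>j. ip F (\<lambda>p. px c p * Q j p)) \<longlonglongrightarrow> ip F (\<lambda>p. px c p * U p)"
      by (intro conv2_ip_right conv2_bmult[OF QU _ c(4)] F_L2) (simp add: cm)
  qed
  then have "?L = 0"
    unfolding eq by (simp only: LIMSEQ_const_iff)
  then show ?thesis by (simp add: dd_coordinate algebra_simps)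
qed

text \<open>Removes the truncation by dominated convergence: the dilated weights share one bound and
  tend pointwise to their value at the origin. A zero for \<open>a\<close> or \<open>b\<close>
  freezes that coordinate.\<close>

lemma ip_dilated_weight:
  assumes k: "\<kappa> \<in> C0inf" and f: "L2 f" and f': "L2 f'"
  shows "(\<lambda>n. ip f (\<lambda>p. \<kappa> (diag_affine (a * h n) (b * h n) 0 p) * f' p)) \<longlonglongrightarrow> \<kappa> 0 * ip f f'"
proof -
  obtain K where K: "\<And>p. \<bar>\<kappa> p\<bar> \<le> K" using C0inf_bounded[OF k] by blast
  have "(\<lambda>n. \<integral>p. \<kappa> (diag_affine (a * h n) (b * h n) 0 p) * (f p * f' p) \<partial>lborel)
      \<longlonglongrightarrow> (\<integral>p. \<kappa> 0 * (f p * f' p) \<partial>lborel)"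
  proof (rule bounded_weight_tendsto[OF L2_integrable_mult[OF f f'], where K = K])
    show "(\<lambda>p. \<kappa> (diag_affine (a * h n) (b * h n) 0 p)) \<in> borel_measurable borel" for n
      by (intro smooth2_measurable smooth2_diag_affine C0inf_smooth2 k)
    show "(\<lambda>n. \<kappa> (diag_affine (a * h n) (b * h n) 0 p)) \<longlonglongrightarrow> \<kappa> 0" for p
    proof (rule continuous_on_tendsto_compose[OF C0inf_continuous[OF k, of UNIV]])
      have "(\<lambda>n. diag_affine (a * h n) (b * h n) 0 p) \<longlonglongrightarrow> (a * 0 * fst p + 0, b * 0 * snd p + 0)"
        unfolding diag_affine_def fst_zero snd_zero by (intro tendsto_intros h_lim)
      then show "(\<lambda>n. diag_affine (a * h n) (b * h n) 0 p) \<longlonglongrightarrow> 0" by (simp add: zero_prod_def)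
    qed auto
  qed (use K in auto)
  then show ?thesis by (simp add: ip_def mult.left_commute)
qed

text \<open>The weight c(y) = \<eta>(0, h y) / h with \<eta> = y \<theta> is a bounded truncation of
  y: its derivative is \<eta>_y(0, h y), which is bounded uniformly in h and tends to \<theta>(0) =
  1.\<close>

lemma pohozaev_y:
  assumes \<theta>: "\<theta> \<in> C0inf" "\<theta> 0 = 1"
  shows "- 1/2 * ip Ux Ux + 1/2 * ip W W + lam / 2 * ip U U + 3/10 * ip F U = 0"
proof -
  define \<eta> where "\<eta> p = snd p * \<theta> p" for p
  have \<eta>: "\<eta> \<in> C0inf" unfolding \<eta>_def[abs_def] by (intro C0inf_mult_left smooth2_snd \<theta>)
  note \<eta>s = C0inf_smooth2[OF \<eta>]
  have one: "py \<eta> 0 = 1"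
    by (simp add: \<eta>_def[abs_def] smooth2_py_mult smooth2_snd C0inf_smooth2 \<theta>)
  \<comment> \<open>The products \<open>0 * h n\<close> and \<open>1 * h n\<close> are left
    unevaluated to match \<open>ip_dilated_weight\<close>.\<close>
  let ?w = "\<lambda>n p. py \<eta> (diag_affine (0 * h n) (1 * h n) 0 p)"
  let ?S = "\<lambda>n. - 1/2 * ip Ux (\<lambda>p. ?w n p * Ux p) + 1/2 * ip W (\<lambda>p. ?w n p * W p)
    + lam / 2 * ip U (\<lambda>p. ?w n p * U p) + 3/10 * ip F (\<lambda>p. ?w n p * U p)"
  have id: "?S n = 0" for n
  proof -
    define c where "c p = inverse (h n) * \<eta> (diag_affine 0 (h n) 0 p)" for p
    have c: "smooth2 c" unfolding c_def[abs_def] by (intro smooth2_mult smooth2_const smooth2_diag_affine \<eta>s)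
    have pxc: "px c = (\<lambda>p. 0)"
      unfolding c_def[abs_def]
      by (simp add: smooth2_px_cmult smooth2_diag_affine \<eta>s px_diag_affine smooth2_differentiable fun_eq_iff)
    have pyc: "py c = (\<lambda>p. py \<eta> (diag_affine 0 (h n) 0 p))"
      unfolding c_def[abs_def] using h_pos[of n]
      by (simp add: smooth2_py_cmult smooth2_diag_affine \<eta>s py_diag_affine smooth2_differentiable fun_eq_iff)
    obtain K1 K2 where K: "\<And>p. \<bar>\<eta> p\<bar> \<le> K1" "\<And>p. \<bar>py \<eta> p\<bar> \<le> K2"
      using C0inf_bounded[OF \<eta>] C0inf_bounded[OF C0inf_py[OF \<eta>]] by metis
    have "\<bar>c p\<bar> \<le> max (inverse (h n) * K1) K2" for p
      using K(1)[of "diag_affine 0 (h n) 0 p"] h_pos[of n]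
      by (intro max.coboundedI1) (simp add: c_def abs_mult mult_left_mono)
    moreover have "\<bar>py c p\<bar> \<le> max (inverse (h n) * K1) K2" for p
      unfolding pyc by (intro max.coboundedI2 K(2))
    ultimately have "- 1/2 * ip Ux (\<lambda>p. py c p * Ux p) + 1/2 * ip W (\<lambda>p. py c p * W p)
        + lam / 2 * ip U (\<lambda>p. py c p * U p) + 3/10 * ip F (\<lambda>p. py c p * U p) = 0"
      by (rule pohozaev_y_weighted[OF c pxc])
    then show ?thesis by (simp add: pyc)
  qed
  note lim = ip_dilated_weight[OF C0inf_py[OF \<eta>], of _ _ 0 1, unfolded one]
  have "?S \<longlonglongrightarrow> - 1/2 * (1 * ip Ux Ux) + 1/2 * (1 * ip W W) + lam / 2 * (1 * ip U U) + 3/10 * (1 * ip F U)"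
    by (intro tendsto_add tendsto_mult_left lim D F_L2)
  then show ?thesis unfolding id by (simp add: LIMSEQ_const_iff)
qed

text \<open>The same truncation in x. The second derivative of the weight, which occurs only here,
  carries a factor \<open>h n\<close> and so drops out in the limit.\<close>

lemma pohozaev_x:
  assumes \<theta>: "\<theta> \<in> C0inf" "\<theta> 0 = 1"
  shows "3/2 * ip Ux Ux - 1/2 * ip W W - lam / 2 * ip U U - 7/10 * ip F U = 0"
proof -
  define \<eta> where "\<eta> p = fst p * \<theta> p" for p
  have \<eta>: "\<eta> \<in> C0inf" unfolding \<eta>_def[abs_def] by (intro C0inf_mult_left smooth2_fst \<theta>)
  note \<eta>s = C0inf_smooth2[OF \<eta>]
  have one: "px \<eta> 0 = 1"
    by (simp add: \<eta>_def[abs_def] smooth2_px_mult smooth2_fst C0inf_smooth2 \<theta>)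
  let ?w = "\<lambda>n p. px \<eta> (diag_affine (1 * h n) (0 * h n) 0 p)"
  let ?v = "\<lambda>n p. px (px \<eta>) (diag_affine (1 * h n) (0 * h n) 0 p)"
  let ?S = "\<lambda>n. h n * ip Ux (\<lambda>p. ?v n p * U p) + 3/2 * ip Ux (\<lambda>p. ?w n p * Ux p) - 1/2 * ip W (\<lambda>p. ?w n p * W p)
    - lam / 2 * ip U (\<lambda>p. ?w n p * U p) - 7/10 * ip F (\<lambda>p. ?w n p * U p)"
  have id: "?S n = 0" for n
  proof -
    define c where "c p = inverse (h n) * \<eta> (diag_affine (h n) 0 0 p)" for p
    have c: "smooth2 c" unfolding c_def[abs_def] by (intro smooth2_mult smooth2_const smooth2_diag_affine \<eta>s)
    have pyc: "py c = (\<lambda>p. 0)"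
      unfolding c_def[abs_def]
      by (simp add: smooth2_py_cmult smooth2_diag_affine \<eta>s py_diag_affine smooth2_differentiable fun_eq_iff)
    have pxc: "px c = (\<lambda>p. px \<eta> (diag_affine (h n) 0 0 p))"
      unfolding c_def[abs_def] using h_pos[of n]
      by (simp add: smooth2_px_cmult smooth2_diag_affine \<eta>s px_diag_affine smooth2_differentiable fun_eq_iff)
    have pxxc: "px (px c) = (\<lambda>p. h n * px (px \<eta>) (diag_affine (h n) 0 0 p))"
      unfolding pxc by (simp add: px_diag_affine smooth2_differentiable smooth2_px \<eta>s fun_eq_iff)
    obtain K1 where K1: "\<And>p. \<bar>\<eta> p\<bar> \<le> K1" using C0inf_bounded[OF \<eta>] by blast
    obtain K2 where K2: "\<And>p. \<bar>px \<eta> p\<bar> \<le> K2" using C0inf_bounded[OF C0inf_px[OF \<eta>]] by blast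
    obtain K3 where K3: "\<And>p. \<bar>px (px \<eta>) p\<bar> \<le> K3" using C0inf_bounded[OF C0inf_px[OF C0inf_px[OF \<eta>]]] by blast
    let ?K = "max (inverse (h n) * K1) (max K2 (h n * K3))"
    have "\<bar>c p\<bar> \<le> ?K" for p
      using K1[of "diag_affine (h n) 0 0 p"] h_pos[of n]
      by (intro max.coboundedI1) (simp add: c_def abs_mult mult_left_mono)
    moreover have "\<bar>px c p\<bar> \<le> ?K" for p
      unfolding pxc by (intro max.coboundedI2 max.coboundedI1 K2)
    moreover have "\<bar>px (px c) p\<bar> \<le> ?K" for p
      unfolding pxxc using K3[of "diag_affine (h n) 0 0 p"] h_pos[of n]
      by (intro max.coboundedI2) (simp add: abs_mult mult_left_mono)
    ultimately have "ip Ux (\<lambda>p. px (px c) p * U p) + 3/2 * ip Ux (\<lambda>p. px c p * Ux p) - 1/2 * ip W (\<lambda>p. px c p * W p)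
      - lam / 2 * ip U (\<lambda>p. px c p * U p) - 7/10 * ip F (\<lambda>p. px c p * U p) = 0"
      by (rule pohozaev_x_weighted[OF c pyc])
    then show ?thesis by (simp add: pxxc mult.assoc ip_cmult_right) (simp add: pxc)
  qed
  note lim = ip_dilated_weight[OF C0inf_px[OF \<eta>], of _ _ 1 0, unfolded one]
  have "?S \<longlonglongrightarrow> 0 * (px (px \<eta>) 0 * ip Ux U) + 3/2 * (1 * ip Ux Ux) - 1/2 * (1 * ip W W)
      - lam / 2 * (1 * ip U U) - 7/10 * (1 * ip F U)"
    by (intro tendsto_add tendsto_diff tendsto_mult_left lim D F_L2 tendsto_mult h_lim
        ip_dilated_weight[OF C0inf_px[OF C0inf_px[OF \<eta>]]])
  then show ?thesis unfolding id by (simp add: LIMSEQ_const_iff)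
qed

text \<open>The two identities add up to \<open>ip Ux Ux\<close> = 2/5 \<open>ip F U\<close>; the
  one for y plus half of \<open>nehari\<close> gives \<open>ip W W\<close> = 1/5
  \<open>ip F U\<close>. The multiplier cancels in both combinations.\<close>

lemma pohozaev:
  assumes "\<theta> \<in> C0inf" "\<theta> 0 = 1"
  shows "ip Ux Ux + ip W W = 3/5 * ip F U"
  using pohozaev_x[OF assms] pohozaev_y[OF assms] nehari by (simp add: field_simps)

text \<open>Young's inequality with exponents 3/2 and 3 for the splitting of |t|^(10/3) into (k
  t^2)^(2/3) and (t^6 / k^2)^(1/3), in which the powers of k cancel. The parameter is left free to
  balance the two integrals.\<close>

lemma interpolation:
  assumes k: "0 < k"
  shows "ip F U \<le> 2/3 * k * ip U U + 1/3 * (\<integral>p. (U p)^6 \<partial>lborel) / k\<^sup>2"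
proof -
  have pt: "nl t * t \<le> 2/3 * k * t\<^sup>2 + 1/3 * t^6 / k\<^sup>2" for t
  proof (cases "t = 0")
    case False
    have "\<bar>t\<bar> powr (10/3) = (k * t\<^sup>2) powr (2/3) * (t^6 / k\<^sup>2) powr (1/3)"
    proof -
      have "(k * t\<^sup>2) powr (2/3) * (t^6 / k\<^sup>2) powr (1/3)
          = (k powr (2/3) * \<bar>t\<bar> powr (4/3)) * (\<bar>t\<bar> powr 2 / k powr (2/3))"
        using k by (simp add: powr_mult powr_divide abs_powr_even[symmetric] powr_powr flip: powr_numeral)
      also have "\<dots> = \<bar>t\<bar> powr (4/3) * \<bar>t\<bar> powr 2" using k by simp
      also have "\<dots> = \<bar>t\<bar> powr (4/3 + 2)" by (rule powr_add[symmetric])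
      finally show ?thesis by simp
    qed
    also have "\<dots> \<le> 2/3 * (k * t\<^sup>2) + 1/3 * (t^6 / k\<^sup>2)"
      by (rule Youngs_inequality_0) (use k False in auto)
    finally show ?thesis by (simp add: nl_mult_self)
  qed (simp add: nl_def)
  have "ip F U \<le> (\<integral>p. 2/3 * k * (U p)\<^sup>2 + 1/3 * (U p)^6 / k\<^sup>2 \<partial>lborel)"
    unfolding ip_def
  proof (rule integral_mono)
    show "integrable lborel (\<lambda>p. F p * U p)" by (rule L2_integrable_mult[OF F_L2 D(5)])
    show "integrable lborel (\<lambda>p. 2/3 * k * (U p)\<^sup>2 + 1/3 * (U p)^6 / k\<^sup>2)"
      using L2_integrable_sq[OF D(5)] U6 by simp
  qed (use pt in \<open>simp add: F_def\<close>)
  also have "\<dots> = 2/3 * k * (\<integral>p. (U p)\<^sup>2 \<partial>lborel) + 1/3 * (\<integral>p. (U p)^6 \<partial>lborel) / k\<^sup>2"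
    using L2_integrable_sq[OF D(5)] U6 by simp
  finally show ?thesis by (simp add: ip_def power2_eq_square)
qed

text \<open>Spares the construction of a bump function: nonzero mass means that some approximating
  potential is nonzero at some point, and translating and normalising it gives \<theta>.\<close>

lemma cutoff_exists:
  assumes "ip U U \<noteq> 0" obtains \<theta> where "\<theta> \<in> C0inf" "\<theta> 0 = 1"
proof -
  have "\<exists>n p. g n p \<noteq> 0"
  proof (rule ccontr)
    assume "\<not> (\<exists>n p. g n p \<noteq> 0)"
    then have "g n = (\<lambda>p. 0)" for n by (simp add: fun_eq_iff)
    then have "conv2 (\<lambda>n p. 0) U" using D(2) by simp
    from conv2_ip[OF this this] show False using assms by (simp add: ip_def LIMSEQ_const_iff)
  qed
  then obtain n q where q: "g n q \<noteq> 0" by blast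
  have "(\<lambda>p. g n (p + q) / g n q) \<in> C0inf" by (intro C0inf_divide C0inf_shift D)
  moreover have "g n (0 + q) / g n q = 1" using q by simp
  ultimately show ?thesis by (rule that)
qed

lemma mass_lower_bound:
  assumes M: "ip U U \<noteq> 0" shows "1 \<le> ip U U"
proof -
  define E where "E = ip Ux Ux + ip W W"
  obtain \<theta> where "\<theta> \<in> C0inf" "\<theta> 0 = 1" using cutoff_exists[OF M] .
  then have P: "E = 3/5 * ip F U" unfolding E_def by (rule pohozaev)
  have S: "(\<integral>p. (U p)^6 \<partial>lborel) \<le> 4 * E^3"
    using sobolev_trip(2)[OF T] by (simp add: E_def nrm_sq)
  have E0: "0 \<le> E" by (simp add: E_def)
  \<comment> \<open>Zero energy would make \<open>U\<close> vanish a.e. by the Sobolev inequality.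
    Positivity permits both the choice of \<open>k\<close> and the final division by
    \<open>E\<close>.\<close>
  have "E \<noteq> 0"
  proof
    assume "E = 0"
    then have "(\<integral>p. (U p)^6 \<partial>lborel) = 0" using S by (intro antisym) simp_all
    then have "AE p in lborel. (U p)^6 = 0" using integral_nonneg_eq_0_iff_AE[OF U6] by simp
    then have "AE p in lborel. U p * U p = 0" by eventually_elim simp
    then have "ip U U = 0" unfolding ip_def by (rule integral_eq_zero_AE)
    with M show False ..
  qed
  then have E: "0 < E" using E0 by simp
  \<comment> \<open>With k = 2 E the Sobolev bound 4 E^3 divided by k^2 is just E, so that both
    terms are linear in E and E can be divided out against the Pohozaev identity.\<close>
  have "ip F U \<le> 2/3 * (2 * E) * ip U U + 1/3 * (\<integral>p. (U p)^6 \<partial>lborel) / (2 * E)\<^sup>2"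
    by (rule interpolation) (use E in simp)
  also have "\<dots> \<le> 2/3 * (2 * E) * ip U U + 1/3 * (4 * E^3) / (2 * E)\<^sup>2"
    by (intro add_left_mono divide_right_mono mult_left_mono S) simp_all
  also have "\<dots> = E * (4/3 * ip U U + 1/3)"
    using E by (simp add: power2_eq_square power3_eq_cube field_simps)
  finally have "ip F U \<le> E * (4/3 * ip U U + 1/3)" .
  moreover have "E * (4/5 * ip U U + 1/5) = 3/5 * (E * (4/3 * ip U U + 1/3))" by (simp add: algebra_simps)
  ultimately have "E * 1 \<le> E * (4/5 * ip U U + 1/5)" using P by linarith
  then have "1 \<le> 4/5 * ip U U + 1/5" using E by (rule mult_left_le_imp_le)
  then show ?thesis by simp
qed

end

theorem theorem1p2:
  fixes f :: "real \<Rightarrow> real"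
  assumes "\<And>t. f t = \<bar>t\<bar> powr (4/3) * t"
  shows "\<exists>astar>0. \<forall>a. 0 < a \<and> a \<le> astar \<longrightarrow>
           \<not> (\<exists>u lam. weak_solution f a u lam)"
proof (intro exI[of _ "1/2"] conjI allI impI notI)
  fix a :: real assume a: "0 < a \<and> a \<le> 1/2"
  assume "\<exists>u lam. weak_solution f a u lam"
  then obtain u lam where w: "weak_solution f a u lam" by blast
  have f: "f = nl" using assms by (simp add: nl_def fun_eq_iff)
  obtain g U Ux W where T: "trip g U Ux W" and M: "ip U U = a\<^sup>2"
    and eq: "\<And>k. k \<in> C0inf \<Longrightarrow> ip Ux (px (px k)) + ip W (py k) - lam * ip U (px k) - ip (\<lambda>p. nl (U p)) (px k) = 0"
    using weak_solution_trip[OF w] nl_measurable unfolding f by blast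
  interpret weak_eq g U Ux W lam by unfold_locales (fact T, fact eq)
  \<comment> \<open>Any threshold below 1 works: \<open>mass_lower_bound\<close> leaves no solution
    with mass strictly between 0 and 1.\<close>
  have "a\<^sup>2 \<le> (1/2)\<^sup>2" using a by (intro power_mono) auto
  moreover have "1 \<le> a\<^sup>2" using mass_lower_bound a by (simp add: M)
  ultimately show False by (simp add: power2_eq_square)
qed simp

end
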